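(* Let $d\ge 1$ be an integer and let $(X_N)$ be a sequence where $X_N$ is an $N$-point set drawn from the harmonic ensemble in $\mathbb{S}^d$ (so that $N$ runs over the values $N=d(L)=\dim \mathcal{P}_L(\mathbb{S}^d)$, $L$ a natural number). Then $(X_N)$ is a sequence of QMC designs on average for $\mathbb{H}^s(\mathbb{S}^d)$ for every $\frac{d}{2}<s<\frac{d+1}{2}$. Moreover, $$\lim_{N\to+\infty} N^{\frac{d+1}{d}}\,\mathbb{E}\left[\mathrm{wce}\big(X_N,\mathbb{H}^{\frac{d+1}{2}}(\mathbb{S}^d)\big)^2\right]=+\infty .$$ Therefore $(X_N)$ is not a sequence of QMC designs on average for $\mathbb{H}^s(\mathbb{S}^d)$ if $s>\frac{d+1}{2}$, and the average QMC strength of $(X_N)$ is $\frac{d+1}{2}$.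
   Context: $\mathbb{S}^d=\{x\in\mathbb{R}^{d+1}: |x|=1\}$ carries the normalized Lebesgue (surface) measure $\sigma=\sigma_d$, $\sigma(\mathbb{S}^d)=1$. For $\ell\ge 0$, $\mathcal{H}_\ell$ is the space of real spherical harmonics of degree $\ell$ on $\mathbb{S}^d$ (eigenfunctions of $-\Delta$, with $\Delta$ the Laplace–Beltrami operator, with eigenvalue $\lambda_\ell=\ell(\ell+d-1)$), $h_\ell=\dim\mathcal{H}_\ell$, and $\{Y_{\ell,k}\}_{k=1}^{h_\ell}$ is an orthonormal basis of $\mathcal{H}_\ell$ in $L^2(\mathbb{S}^d,\sigma)$. $\mathcal{P}_L(\mathbb{S}^d)=\bigoplus_{\ell=0}^L\mathcal{H}_\ell$ is the space of polynomials of degree at most $L$ in $\mathbb{R}^{d+1}$ restricted to $\mathbb{S}^d$, and $d(L)=\dim\mathcal{P}_L(\mathbb{S}^d)$. Sobolev spaces: for real $f\in L^2(\mathbb{S}^d)$ put $f_{\ell,k}=\int_{\mathbb{S}^d} fY_{\ell,k}\,d\sigma$. For $s\ge0$, $\mathbb{H}^s(\mathbb{S}^d)$ is the set of $f\in L^2(\mathbb{S}^d)$ with $\sum_{\ell\ge0}\sum_{k=1}^{h_\ell}(1+\lambda_\ell)^s|f_{\ell,k}|^2<\infty$, with norm $\|f\|_{\mathbb{H}^s(\mathbb{S}^d)}=\big(\sum_{\ell\ge0}\sum_{k=1}^{h_\ell}\frac{1}{a_\ell^{(s)}}|f_{\ell,k}|^2\big)^{1/2}$, where $(a_\ell^{(s)})_{\ell\ge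 0}$ is a fixed sequence of positive numbers with $a_\ell^{(s)}\sim(1+\ell^2)^{-s}$, i.e. the ratio is bounded above and below by positive constants depending only on $d,s$. For $s>d/2$, $\mathbb{H}^s(\mathbb{S}^d)$ embeds continuously in the continuous functions (so point evaluations make sense). Worst-case error: for an $N$-point set $X_N\subset\mathbb{S}^d$ and $s>d/2$, $$\mathrm{wce}(X_N,\mathbb{H}^s(\mathbb{S}^d))=\sup_{\|f\|_{\mathbb{H}^s(\mathbb{S}^d)}\le1}\left|\frac1N\sum_{x\in X_N}f(x)-\int_{\mathbb{S}^d}f\,d\sigma\right|.$$ QMC designs on average: a sequence $(X_N)$ of random $N$-point configurations on $\mathbb{S}^d$ (where $N$ may run only over a subsequence of the natural numbers tending to $+\infty$) is a sequence of QMC designs on average for $\mathbb{H}^s(\mathbb{S}^d)$, $s>d/2$, if there is $C_{d,s}>0$ such that $\sqrt{\mathbb{E}[\mathrm{wce}(X_N,\mathbb{H}^s(\mathbb{S}^d))^2]}\le C_{d,s}N^{-s/d}$ for all $N$ in the index set. The average QMC strength of $(X_N)$ is the maximal $s^*>d/2$ such that $(X_N)$ is a sequence of QMC designs on average for $\mathbb{H}^s(\mathbb{S}^d)$ for all $d/2<s<s^*$. Harmonic ensemble: the determinantal point process on $\mathbb{S}^d$, with $d(L)$ points almost surely, whose kernel is the reproducing kernel $K_L(x,y)$ of $\mathcal{P}_L(\mathbb{S}^d)\subset L^2(\mathbb{S}^d,\sigma)$; i.e. its joint intensities with respect to $\sigma$ are $\rho_k(x_1,\dots,x_k)=\det(K_L(x_i,x_j))_{1\le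 i,j\le k}$ for all $k\ge1$. Explicitly $K_L(x,y)=\frac{d(L)}{\binom{L+d/2}{L}}P_L^{(1+\lambda,\lambda)}(\langle x,y\rangle)$, with $\lambda=\frac{d-2}{2}$ and Jacobi polynomials normalized by $P_L^{(1+\lambda,\lambda)}(1)=\binom{L+d/2}{L}$. *)

theory Defs
  imports "HOL-Analysis.Analysis" "HOL-Probability.Probability" "HOL-Library.Function_Algebras"
begin

section \<open>Function spaces\<close>

text \<open>Pointwise scaling makes the real-valued functions a real vector space, so that
  \<^const>\<open>span\<close> and \<^const>\<open>dim\<close> apply to sets of functions.\<close>

instantiation "fun" :: (type, real_vector) real_vector
begin

definition "scaleR c f = (\<lambda>x. c *\<^sub>R f x)"

instance
  by standard (auto simp: scaleR_fun_def fun_eq_iff scaleR_add_right scaleR_add_left)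

end

lemma scaleR_fun_apply [simp]: "(c *\<^sub>R f) x = c *\<^sub>R f x"
  by (simp add: scaleR_fun_def)


section \<open>The sphere\<close>

text \<open>The unit sphere \<^term>\<open>sphere 0 1\<close> of \<^typ>\<open>'a::euclidean_space\<close> is $S^d$ with $d + 1$ the
  dimension of \<^typ>\<open>'a\<close>. Normalized surface measure is obtained as the cone measure: the uniform
  distribution on the unit ball, projected radially onto the sphere.\<close>

definition sphere_measure :: "'a::euclidean_space measure" where
  "sphere_measure =
     restrict_space (distr (uniform_measure lborel (ball 0 1)) borel sgn) (sphere 0 1)"

lemma prob_space_sphere_measure: "prob_space (sphere_measure :: 'a::euclidean_space measure)"
proof -
  let ?B = "ball 0 1 :: 'a set"
  let ?U = "uniform_measure lborel ?B"
  have pos: "emeasure lborel ?B \<noteq> 0"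
    using emeasure_lborel_ball_finite[of "0::'a" 1] content_ball_pos[of 1 "0::'a"]
    by (auto simp: emeasure_eq_measure2 measure_def)
  have fin: "emeasure lborel ?B \<noteq> \<infinity>"
    using emeasure_lborel_ball_finite[of "0::'a" 1] by simp
  interpret U: prob_space ?U
    using pos fin by (rule prob_space_uniform_measure)
  have meas: "sgn \<in> measurable ?U (borel :: 'a measure)"
    unfolding sgn_div_norm by simp
  interpret D: prob_space "distr ?U borel (sgn :: 'a \<Rightarrow> 'a)"
    using meas by (rule U.prob_space_distr)
  have "AE x in ?U. x \<noteq> (0::'a)"
    by (rule AE_uniform_measureI)
       (use AE_lborel_singleton[of "0::'a"] in \<open>auto elim: eventually_mono\<close>)
  then have "AE x in distr ?U borel sgn. x \<in> sphere (0::'a) 1"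
    using meas by (subst AE_distr_iff) (auto simp: norm_sgn elim!: eventually_mono)
  then have "emeasure (distr ?U borel sgn) (sphere (0::'a) 1) = 1"
    by (intro D.emeasure_eq_1_AE) auto
  then show ?thesis
    unfolding sphere_measure_def
    by (intro prob_spaceI) (simp add: space_restrict_space emeasure_restrict_space)
qed

text \<open>Functions on the sphere are represented by functions on the ambient space; for the
  finite-dimensional spaces below we take the representative that is zero off the sphere, which makes
  it unique.\<close>

definition on_sphere :: "('a::euclidean_space \<Rightarrow> real) \<Rightarrow> 'a \<Rightarrow> real" where
  "on_sphere p = (\<lambda>x. if x \<in> sphere 0 1 then p x else 0)"


section \<open>Polynomials and spherical harmonics\<close>

definition monomial :: "('a::euclidean_space \<Rightarrow> nat) \<Rightarrow> 'a \<Rightarrow> real" where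
  "monomial \<alpha> x = (\<Prod>b\<in>Basis. (x \<bullet> b) ^ \<alpha> b)"

definition polynomials_upto :: "nat \<Rightarrow> ('a::euclidean_space \<Rightarrow> real) set" where
  "polynomials_upto L = span (monomial ` {\<alpha>. (\<Sum>b\<in>Basis. \<alpha> b) \<le> L})"

definition homogeneous_polynomials :: "nat \<Rightarrow> ('a::euclidean_space \<Rightarrow> real) set" where
  "homogeneous_polynomials l = span (monomial ` {\<alpha>. (\<Sum>b\<in>Basis. \<alpha> b) = l})"

definition laplacian :: "('a::euclidean_space \<Rightarrow> real) \<Rightarrow> 'a \<Rightarrow> real" where
  "laplacian f x = (\<Sum>b\<in>Basis. (deriv ^^ 2) (\<lambda>t. f (x + t *\<^sub>R b)) 0)"

definition spherical_harmonics :: "nat \<Rightarrow> ('a::euclidean_space \<Rightarrow> real) set" where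
  "spherical_harmonics l =
     on_sphere ` {p \<in> homogeneous_polynomials l. \<forall>x. laplacian p x = 0}"

definition sphere_polynomials :: "nat \<Rightarrow> ('a::euclidean_space \<Rightarrow> real) set" where
  "sphere_polynomials L = on_sphere ` polynomials_upto L"

text \<open>With \<^term>\<open>d = DIM('a::euclidean_space) - 1\<close>, the eigenvalue is $l (l + d - 1)$.\<close>

definition sphere_eigenvalue :: "'a::euclidean_space itself \<Rightarrow> nat \<Rightarrow> real" where
  "sphere_eigenvalue _ l = real l * (real l + real DIM('a) - 2)"

text \<open>The Laplace--Beltrami operator is the Laplacian of the extension that is constant along rays.
  It enters only in \<open>spherical_harmonics_eigenfunction\<close>, which identifies the numbers
  \<^const>\<open>sphere_eigenvalue\<close>.\<close>

definition laplace_beltrami :: "('a::euclidean_space \<Rightarrow> real) \<Rightarrow> 'a \<Rightarrow> real" where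
  "laplace_beltrami f = laplacian (\<lambda>x. f (sgn x))"

lemma poly_along_line:
  assumes "p \<in> homogeneous_polynomials l"
  shows "\<exists>q::real poly. \<forall>t. p (x + t *\<^sub>R b) = poly q t"
  using assms unfolding homogeneous_polynomials_def
proof (induction rule: span_induct_alt)
  case base
  show ?case by (rule exI[of _ 0]) simp
next
  case (step c f g)
  then obtain \<alpha> q where \<alpha>: "f = monomial \<alpha>" and q: "\<And>t. g (x + t *\<^sub>R b) = poly q t"
    by auto
  have "f (x + t *\<^sub>R b) = poly (\<Prod>u\<in>Basis. [:x \<bullet> u, b \<bullet> u:] ^ \<alpha> u) t" for t
    by (simp add: \<alpha> monomial_def poly_prod inner_add_left)
  then show ?case
    by (intro exI[of _ "smult c (\<Prod>u\<in>Basis. [:x \<bullet> u, b \<bullet> u:] ^ \<alpha> u) + q"]) (simp add: q)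
qed

lemma homogeneous_scaleR:
  assumes "p \<in> homogeneous_polynomials l"
  shows "p (c *\<^sub>R x) = c ^ l * p x"
  using assms unfolding homogeneous_polynomials_def
proof (induction rule: span_induct_alt)
  case (step k f g)
  then obtain \<alpha> where \<alpha>: "f = monomial \<alpha>" "(\<Sum>u\<in>Basis. \<alpha> u) = l" by auto
  have "f (c *\<^sub>R x) = c ^ l * f x"
    by (simp add: \<alpha>(1) monomial_def power_mult_distrib prod.distrib power_sum flip: \<alpha>(2))
  with step show ?case by (simp add: algebra_simps)
qed simp

lemma homogeneous_differentiable:
  assumes "p \<in> homogeneous_polynomials l"
  shows "p differentiable (at x)"
  using assms unfolding homogeneous_polynomials_def
proof (induction rule: span_induct_alt)
  case base
  show ?case by (simp add: zero_fun_def)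
next
  case (step k f g)
  then obtain \<alpha> where \<alpha>: "f = monomial \<alpha>" by auto
  have "f differentiable (at x)"
    unfolding \<alpha> monomial_def[abs_def] differentiable_def
    by (intro exI) (rule derivative_intros has_derivative_prod | assumption)+
  moreover have "k *\<^sub>R f + g = (\<lambda>y. k *\<^sub>R f y + g y)" by auto
  ultimately show ?case using step by (auto intro!: derivative_intros)
qed

lemma euler:
  assumes p: "p \<in> homogeneous_polynomials l"
  shows "(\<Sum>b\<in>Basis. (x \<bullet> b) * deriv (\<lambda>t. p (x + t *\<^sub>R b)) 0) = real l * p x"
proof -
  obtain D where D: "(p has_derivative D) (at x)"
    using homogeneous_differentiable[OF p] by (auto simp: differentiable_def)
  interpret D: bounded_linear D using D by (rule has_derivative_bounded_linear)
  have line: "((\<lambda>t. p (x + t *\<^sub>R v)) has_field_derivative D v) (at 0)" for v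
  proof -
    have "((\<lambda>t. x + t *\<^sub>R v) has_derivative (\<lambda>t. t *\<^sub>R v)) (at 0)"
      by (auto intro!: derivative_eq_intros)
    from diff_chain_at[OF this, of p D] D show ?thesis
      by (simp add: o_def has_field_derivative_def D.scaleR mult.commute[of _ "D v"])
  qed
  have "p (x + t *\<^sub>R x) = (1 + t) ^ l * p x" for t
    using homogeneous_scaleR[OF p, of "1 + t" x] by (simp add: algebra_simps)
  with line[of x] have "((\<lambda>t. (1 + t) ^ l * p x) has_field_derivative D x) (at 0)" by simp
  moreover have "((\<lambda>t. (1 + t) ^ l * p x) has_field_derivative real l * p x) (at 0)"
    by (auto intro!: derivative_eq_intros)
  ultimately have "D x = real l * p x" by (rule DERIV_unique)
  moreover have "D x = (\<Sum>b\<in>Basis. (x \<bullet> b) * D b)"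
  proof -
    have "D x = D (\<Sum>b\<in>Basis. (x \<bullet> b) *\<^sub>R b)" by (simp add: euclidean_representation)
    also have "\<dots> = (\<Sum>b\<in>Basis. (x \<bullet> b) * D b)" by (simp add: D.sum D.scaleR)
    finally show ?thesis .
  qed
  ultimately show ?thesis using DERIV_imp_deriv[OF line] by simp
qed

lemma radial_second_deriv:
  fixes x b :: "'a::euclidean_space"
  assumes x: "norm x = 1" and b: "b \<in> Basis" and p: "p \<in> homogeneous_polynomials l"
  shows "(deriv ^^ 2) (\<lambda>t. p (sgn (x + t *\<^sub>R b))) 0 =
    (deriv ^^ 2) (\<lambda>t. p (x + t *\<^sub>R b)) 0
      - 2 * real l * ((x \<bullet> b) * deriv (\<lambda>t. p (x + t *\<^sub>R b)) 0)
      + p x * (real l * (real l + 2) * (x \<bullet> b)\<^sup>2 - real l)"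
proof -
  obtain q where q: "\<And>t. p (x + t *\<^sub>R b) = poly q t"
    using poly_along_line[OF p] by blast
  define c where "c = x \<bullet> b"
  define r where "r t = 1 + 2 * c * t + t\<^sup>2" for t :: real
  define S where "S = {t. 0 < r t}"
  have S: "open S" unfolding S_def r_def by (intro open_Collect_less continuous_intros)
  have 0: "0 \<in> S" by (simp add: S_def r_def)
  have bb: "b \<bullet> b = 1" using b by simp
  have nr: "(norm (x + t *\<^sub>R b))\<^sup>2 = r t" for t
  proof -
    have "(norm (x + t *\<^sub>R b))\<^sup>2 = (norm x)\<^sup>2 + 2 * t * (x \<bullet> b) + t\<^sup>2 * (b \<bullet> b)"
      unfolding power2_norm_eq_inner
      by (simp add: inner_add_left inner_add_right inner_commute[of b x] power2_eq_square algebra_simps)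
    then show ?thesis by (simp add: x bb r_def c_def algebra_simps)
  qed
  have F: "p (sgn (x + t *\<^sub>R b)) = poly q t * r t powr (- real l / 2)" if "t \<in> S" for t
  proof -
    have r: "r t > 0" using that by (simp add: S_def)
    have nq: "norm (x + t *\<^sub>R b) = sqrt (r t)"
      using nr[of t] by (metis norm_ge_zero real_sqrt_unique)
    have "p (sgn (x + t *\<^sub>R b)) = (inverse (sqrt (r t))) ^ l * poly q t"
      unfolding sgn_div_norm homogeneous_scaleR[OF p] nq q ..
    also have "(inverse (sqrt (r t))) ^ l = r t powr (- real l / 2)"
      using r by (simp add: powr_half_sqrt[symmetric] powr_minus[symmetric] powr_powr
          flip: powr_realpow)
    finally show ?thesis by simp
  qed
  define G1 where "G1 t = poly (pderiv q) t * r t powr (- real l / 2)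
     - real l * (poly q t * ((c + t) * r t powr (- real l / 2 - 1)))" for t
  have d1: "deriv (\<lambda>t. p (sgn (x + t *\<^sub>R b))) t = G1 t" if "t \<in> S" for t
  proof -
    have "((\<lambda>t. poly q t * r t powr (- real l / 2)) has_field_derivative G1 t) (at t)"
      using that unfolding S_def G1_def r_def
      by (auto intro!: derivative_eq_intros simp: powr_diff field_simps)
    then have "((\<lambda>t. p (sgn (x + t *\<^sub>R b))) has_field_derivative G1 t) (at t)"
      by (rule has_field_derivative_transform_within_open[OF _ S that]) (simp add: F)
    then show ?thesis by (rule DERIV_imp_deriv)
  qed
  have "(G1 has_field_derivative (poly (pderiv (pderiv q)) 0
      - 2 * real l * (c * poly (pderiv q) 0) + poly q 0 * (real l * (real l + 2) * c\<^sup>2 - real l))) (at 0)"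
    unfolding G1_def[abs_def] r_def
    by (auto intro!: derivative_eq_intros simp: field_simps power2_eq_square)
  then have "(deriv (\<lambda>t. p (sgn (x + t *\<^sub>R b))) has_field_derivative (poly (pderiv (pderiv q)) 0
      - 2 * real l * (c * poly (pderiv q) 0) + poly q 0 * (real l * (real l + 2) * c\<^sup>2 - real l))) (at 0)"
    by (rule has_field_derivative_transform_within_open[OF _ S 0]) (simp add: d1)
  then have lhs: "(deriv ^^ 2) (\<lambda>t. p (sgn (x + t *\<^sub>R b))) 0 = poly (pderiv (pderiv q)) 0
      - 2 * real l * (c * poly (pderiv q) 0) + poly q 0 * (real l * (real l + 2) * c\<^sup>2 - real l)"
    by (simp add: numeral_2_eq_2 DERIV_imp_deriv)
  have dp: "deriv (poly u) = poly (pderiv u)" for u :: "real poly"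
    by (auto intro!: DERIV_imp_deriv poly_DERIV)
  have "(\<lambda>t. p (x + t *\<^sub>R b)) = poly q" using q by auto
  moreover have "p x = poly q 0" using q[of 0] by simp
  ultimately show ?thesis
    unfolding lhs by (simp add: numeral_2_eq_2 dp c_def)
qed

lemma spherical_harmonics_eigenfunction:
  fixes f :: "'a::euclidean_space \<Rightarrow> real"
  assumes f: "f \<in> spherical_harmonics l" and x: "x \<in> sphere 0 1"
  shows "- laplace_beltrami f x = sphere_eigenvalue TYPE('a) l * f x"
proof -
  obtain p where p: "p \<in> homogeneous_polynomials l" and harm: "laplacian p x = 0"
    and fp: "f = on_sphere p"
    using f by (auto simp: spherical_harmonics_def)
  have nx: "norm x = 1" using x by simp
  let ?d = "\<lambda>b. deriv (\<lambda>t. p (x + t *\<^sub>R b)) 0"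
  have ext: "(deriv ^^ 2) (\<lambda>t. f (sgn (x + t *\<^sub>R b))) 0 = (deriv ^^ 2) (\<lambda>t. p (sgn (x + t *\<^sub>R b))) 0"
    for b
  proof -
    have "\<forall>\<^sub>F t in nhds (0::real). x + t *\<^sub>R b \<noteq> 0"
    proof -
      have "open {t. x + t *\<^sub>R b \<noteq> 0}" by (intro open_Collect_neq continuous_intros)
      moreover have "x \<noteq> 0" using nx by auto
      ultimately show ?thesis
        using eventually_nhds_in_open[of "{t. x + t *\<^sub>R b \<noteq> 0}" 0] by simp
    qed
    then have "\<forall>\<^sub>F t in nhds 0. f (sgn (x + t *\<^sub>R b)) = p (sgn (x + t *\<^sub>R b))"
      by eventually_elim (simp add: fp on_sphere_def norm_sgn)
    then show ?thesis by (rule higher_deriv_cong_ev) simp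
  qed
  have "laplace_beltrami f x = (\<Sum>b\<in>Basis. (deriv ^^ 2) (\<lambda>t. p (x + t *\<^sub>R b)) 0
      - 2 * real l * ((x \<bullet> b) * ?d b) + p x * (real l * (real l + 2) * (x \<bullet> b)\<^sup>2 - real l))"
    unfolding laplace_beltrami_def laplacian_def ext
    by (intro sum.cong refl radial_second_deriv[OF nx _ p])
  also have "\<dots> = laplacian p x - 2 * real l * (\<Sum>b\<in>Basis. (x \<bullet> b) * ?d b)
      + p x * (real l * (real l + 2) * (\<Sum>b\<in>Basis. (x \<bullet> b)\<^sup>2) - real l * real DIM('a))"
    by (simp add: laplacian_def sum.distrib sum_subtractf sum_distrib_left algebra_simps)
  also have "(\<Sum>b\<in>Basis. (x \<bullet> b)\<^sup>2) = 1"
    using nx euclidean_inner[of x x] by (simp add: power2_eq_square norm_eq_1)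
  also have "(\<Sum>b\<in>Basis. (x \<bullet> b) * ?d b) = real l * p x" by (rule euler[OF p])
  finally show ?thesis
    using harm x by (simp add: fp on_sphere_def sphere_eigenvalue_def algebra_simps)
qed

text \<open>A family \<^term>\<open>e\<close>, indexed by $1, \dots, \dim V$, is an orthonormal basis of \<^term>\<open>V\<close> in
  $L^2$ of the sphere.\<close>

definition orthonormal_basis ::
  "('a::euclidean_space \<Rightarrow> real) set \<Rightarrow> (nat \<Rightarrow> 'a \<Rightarrow> real) \<Rightarrow> bool" where
  "orthonormal_basis V e \<longleftrightarrow>
     e ` {1..dim V} \<subseteq> V \<and> V \<subseteq> span (e ` {1..dim V}) \<and>
     (\<forall>j\<in>{1..dim V}. \<forall>k\<in>{1..dim V}.
        (\<integral>x. e j x * e k x \<partial>sphere_measure) = (if j = k then 1 else 0))"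


section \<open>Sobolev spaces and worst-case error\<close>

text \<open>Throughout, \<^term>\<open>Y l k\<close> for $1 \le k \le h_l$ is the orthonormal basis of the spherical
  harmonics of degree \<^term>\<open>l\<close>, and \<^term>\<open>w\<close> is the weight sequence $a^{(s)}$.\<close>

definition fourier_coeff ::
  "(nat \<Rightarrow> nat \<Rightarrow> 'a::euclidean_space \<Rightarrow> real) \<Rightarrow> ('a \<Rightarrow> real) \<Rightarrow> nat \<Rightarrow> nat \<Rightarrow> real" where
  "fourier_coeff Y f l k = (\<integral>x. f x * Y l k x \<partial>sphere_measure)"

definition sobolev_space ::
  "(nat \<Rightarrow> nat \<Rightarrow> 'a::euclidean_space \<Rightarrow> real) \<Rightarrow> real \<Rightarrow> ('a \<Rightarrow> real) set" where
  "sobolev_space Y s =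
     {f. f \<in> borel_measurable sphere_measure \<and>
         integrable sphere_measure (\<lambda>x. (f x)\<^sup>2) \<and>
         summable (\<lambda>l. \<Sum>k = 1..dim (spherical_harmonics l :: ('a \<Rightarrow> real) set).
           (1 + sphere_eigenvalue TYPE('a) l) powr s * \<bar>fourier_coeff Y f l k\<bar>\<^sup>2)}"

definition sobolev_weight :: "real \<Rightarrow> (nat \<Rightarrow> real) \<Rightarrow> bool" where
  "sobolev_weight s w \<longleftrightarrow> (\<forall>l. w l > 0) \<and>
     (\<exists>c1>0. \<exists>c2>0. \<forall>l. c1 * (1 + (real l)\<^sup>2) powr (- s) \<le> w l \<and>
                         w l \<le> c2 * (1 + (real l)\<^sup>2) powr (- s))"

definition sobolev_norm ::
  "(nat \<Rightarrow> nat \<Rightarrow> 'a::euclidean_space \<Rightarrow> real) \<Rightarrow> (nat \<Rightarrow> real) \<Rightarrow> ('a \<Rightarrow> real) \<Rightarrow> real" where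
  "sobolev_norm Y w f =
     sqrt (\<Sum>l. \<Sum>k = 1..dim (spherical_harmonics l :: ('a \<Rightarrow> real) set).
       1 / w l * \<bar>fourier_coeff Y f l k\<bar>\<^sup>2)"

text \<open>For $s > d/2$ every element of the Sobolev space has a unique continuous representative, and
  this is the one whose point values are used; hence the continuity condition. The supremum is taken
  in \<^typ>\<open>ennreal\<close>, so that no boundedness is presupposed.\<close>

definition wce ::
  "(nat \<Rightarrow> nat \<Rightarrow> 'a::euclidean_space \<Rightarrow> real) \<Rightarrow> (nat \<Rightarrow> real) \<Rightarrow> real \<Rightarrow> 'a set \<Rightarrow> ennreal" where
  "wce Y w s P =
     (SUP f\<in>{f \<in> sobolev_space Y s. continuous_on (sphere 0 1) f \<and> sobolev_norm Y w f \<le> 1}.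
        ennreal \<bar>(\<Sum>x\<in>P. f x) / real (card P) - (\<integral>x. f x \<partial>sphere_measure)\<bar>)"

definition mean_square_wce ::
  "(nat \<Rightarrow> nat \<Rightarrow> 'a::euclidean_space \<Rightarrow> real) \<Rightarrow> (nat \<Rightarrow> real) \<Rightarrow> real
     \<Rightarrow> 'w measure \<Rightarrow> ('w \<Rightarrow> 'a set) \<Rightarrow> ennreal" where
  "mean_square_wce Y w s M X = (\<integral>\<^sup>+\<omega>. (wce Y w s (X \<omega>))\<^sup>2 \<partial>M)"


section \<open>QMC designs on average\<close>

text \<open>\<^term>\<open>I\<close> is the set of the numbers \<^term>\<open>N\<close> of points that occur; the configuration
  \<^term>\<open>X N\<close> is a random set on the probability space \<^term>\<open>M N\<close>. The exponent is $-s/d$.\<close>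

definition qmc_designs_on_average ::
  "(nat \<Rightarrow> nat \<Rightarrow> 'a::euclidean_space \<Rightarrow> real) \<Rightarrow> (real \<Rightarrow> nat \<Rightarrow> real) \<Rightarrow> nat set
     \<Rightarrow> (nat \<Rightarrow> 'w measure) \<Rightarrow> (nat \<Rightarrow> 'w \<Rightarrow> 'a set) \<Rightarrow> real \<Rightarrow> bool" where
  "qmc_designs_on_average Y a I M X s \<longleftrightarrow>
     (\<exists>C>0. \<forall>N\<in>I.
        mean_square_wce Y (a s) s (M N) (X N) < \<infinity> \<and>
        sqrt (enn2real (mean_square_wce Y (a s) s (M N) (X N)))
          \<le> C * real N powr (- s / (real DIM('a) - 1)))"

text \<open>The admissible values are the $s^* > d/2$ for which \<^term>\<open>X\<close> is a sequence of QMC designs on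
  average for all $d/2 < s < s^*$; the strength is the largest one.\<close>

definition is_average_qmc_strength ::
  "(nat \<Rightarrow> nat \<Rightarrow> 'a::euclidean_space \<Rightarrow> real) \<Rightarrow> (real \<Rightarrow> nat \<Rightarrow> real) \<Rightarrow> nat set
     \<Rightarrow> (nat \<Rightarrow> 'w measure) \<Rightarrow> (nat \<Rightarrow> 'w \<Rightarrow> 'a set) \<Rightarrow> real \<Rightarrow> bool" where
  "is_average_qmc_strength Y a I M X s\<^sub>0 \<longleftrightarrow>
     (let d = real DIM('a) - 1;
          A = {t. t > d / 2 \<and> (\<forall>s. d / 2 < s \<and> s < t \<longrightarrow> qmc_designs_on_average Y a I M X s)}
      in s\<^sub>0 \<in> A \<and> (\<forall>t\<in>A. t \<le> s\<^sub>0))"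


section \<open>The harmonic ensemble\<close>

definition reproducing_kernel ::
  "('a::euclidean_space \<Rightarrow> real) set \<Rightarrow> ('a \<Rightarrow> 'a \<Rightarrow> real) \<Rightarrow> bool" where
  "reproducing_kernel V K \<longleftrightarrow>
     (\<forall>x\<in>sphere 0 1. K x \<in> V \<and> (\<forall>f\<in>V. f x = (\<integral>y. f y * K x y \<partial>sphere_measure)))"

text \<open>A simple point process with finitely many points on the sphere.\<close>

definition sphere_point_process :: "'w measure \<Rightarrow> ('w \<Rightarrow> 'a::euclidean_space set) \<Rightarrow> bool" where
  "sphere_point_process M X \<longleftrightarrow> prob_space M \<and>
     (\<forall>\<omega>\<in>space M. finite (X \<omega>) \<and> X \<omega> \<subseteq> sphere 0 1) \<and>
     (\<forall>A\<in>sets sphere_measure. (\<lambda>\<omega>. card (X \<omega> \<inter> A)) \<in> measurable M (count_space UNIV))"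

text \<open>The joint intensity \<^term>\<open>\<rho> k\<close> is the density of the \<^term>\<open>k\<close>-th factorial moment measure,
  which counts ordered \<^term>\<open>k\<close>-tuples of distinct points of the process.\<close>

definition joint_intensities ::
  "'w measure \<Rightarrow> ('w \<Rightarrow> 'a::euclidean_space set) \<Rightarrow> (nat \<Rightarrow> (nat \<Rightarrow> 'a) \<Rightarrow> real) \<Rightarrow> bool" where
  "joint_intensities M X \<rho> \<longleftrightarrow>
     (\<forall>k\<ge>1. \<forall>B\<in>sets (PiM {..<k} (\<lambda>_. sphere_measure)).
        (\<integral>\<^sup>+\<omega>. of_nat (card {x \<in> {..<k} \<rightarrow>\<^sub>E X \<omega>. inj_on x {..<k} \<and> x \<in> B}) \<partial>M) =
        (\<integral>\<^sup>+x\<in>B. ennreal (\<rho> k x) \<partial>PiM {..<k} (\<lambda>_. sphere_measure)))"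

text \<open>The determinant of $(K(x_i, x_j))_{i,j<k}$. The size \<^term>\<open>k\<close> varies, so the Leibniz formula is
  written out instead of using \<^const>\<open>det\<close>, whose size is a type.\<close>

definition kernel_det :: "('a \<Rightarrow> 'a \<Rightarrow> real) \<Rightarrow> nat \<Rightarrow> (nat \<Rightarrow> 'a) \<Rightarrow> real" where
  "kernel_det K k x =
     (\<Sum>p | p permutes {..<k}. of_int (sign p) * (\<Prod>i<k. K (x i) (x (p i))))"

definition harmonic_ensemble :: "nat \<Rightarrow> 'w measure \<Rightarrow> ('w \<Rightarrow> 'a::euclidean_space set) \<Rightarrow> bool" where
  "harmonic_ensemble L M X \<longleftrightarrow>
     sphere_point_process M X \<and>
     (AE \<omega> in M. card (X \<omega>) = dim (sphere_polynomials L :: ('a \<Rightarrow> real) set)) \<and>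
     (\<exists>K. reproducing_kernel (sphere_polynomials L) K \<and> joint_intensities M X (kernel_det K))"

end

theory Submission
  imports Defs
begin

text \<open>The worst-case error is a dual norm, so by Cauchy--Schwarz its square is a sum over degrees: for
  an \<open>N\<close>-point set \<open>P\<close> it equals \<open>N\<^sup>-\<^sup>2 \<Sum>\<^bsub>l \<ge> 1\<^esub> a\<^sub>l \<Sum>\<^sub>k (\<Sum>\<^bsub>x \<in> P\<^esub> Y\<^sub>l\<^sub>k(x))\<^sup>2\<close>
  (\<open>wce_lower\<close>, \<open>wce_upper\<close>). The theorem is therefore about the size of
  \<open>V\<^sub>l = \<Sum>\<^sub>k E (\<Sum>\<^bsub>x \<in> X\<^esub> Y\<^sub>l\<^sub>k(x))\<^sup>2\<close> when \<open>X\<close> is drawn from the harmonic ensemble.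

  The kernel of the ensemble is the orthogonal projection onto the polynomials of degree at most
  \<open>L\<close>. For such a process the variance of \<open>\<Sum> f(x)\<close> is the squared Hilbert--Schmidt norm of
  the part of multiplication by \<open>f\<close> that leads out of the range of the projection. Hence, with
  \<open>c(i, j) = \<Sum>\<^sub>k \<langle>Y\<^sub>l\<^sub>k e\<^sub>i, e\<^sub>j\<rangle>\<^sup>2\<close> for a basis \<open>e\<close> of spherical harmonics,
  \<open>V\<^sub>l\<close> is the sum of \<open>c(i, j)\<close> over \<open>deg e\<^sub>i \<le> L < deg e\<^sub>j\<close> (\<open>expected_energy\<close>). Two
  identities determine the size of this sum: \<open>\<Sum>\<^sub>j c(i, j) = h\<^sub>l\<close> (\<open>coupling_mass\<close>), which is the addition theorem, and
  \<open>\<Sum>\<^sub>j (\<lambda>\<^sub>j - \<lambda>\<^sub>i) c(i, j) = h\<^sub>l \<lambda>\<^sub>l\<close> (\<open>coupling_drift\<close>), where \<open>\<lambda>\<^sub>i\<close>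
  is the Laplace--Beltrami eigenvalue of \<open>e\<^sub>i\<close>; this one is Green's formula together with
  the addition theorem.

  Multiplication by a harmonic of degree \<open>l\<close> raises the degree by at most \<open>l\<close>, so only the
  \<open>e\<^sub>i\<close> with degree in \<open>(L - l, L]\<close> contribute, each at most \<open>h\<^sub>l\<close>
  (\<open>leakage_upper\<close>). Conversely, sum the drift identity over all \<open>e\<^sub>i\<close> of degree at most
  \<open>L\<close>: pairs that both lie below \<open>L\<close> cancel, since \<open>c\<close> is symmetric, and for the other
  pairs \<open>\<lambda>\<^sub>j - \<lambda>\<^sub>i \<le> l (2 L + l + d - 1)\<close> (\<open>leakage_lower\<close>). Together,
  \<open>V\<^sub>l\<close> is of order \<open>h\<^sub>l min(l, L) L\<^bsup>d-1\<^esup>\<close>, where \<open>h\<^sub>l\<close> is of order \<open>l\<^bsup>d-1\<^esup>\<close> and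
  \<open>N\<close> of order \<open>L\<^sup>d\<close>; the two identities for \<open>l = 1\<close> even yield these orders, as a recursion
  for \<open>h\<close> (\<open>flow_rec\<close>).

  With \<open>a\<^sub>l\<close> of order \<open>l\<^bsup>-2s\<^esup>\<close> the mean square error is thus of order
  \<open>L\<^bsup>-d-1\<^esup> \<Sum>\<^sub>l l\<^bsup>d-1-2s\<^esup> min(l, L)\<close>. For \<open>d/2 < s < (d+1)/2\<close> this is \<open>L\<^bsup>-2s\<^esup>\<close>, the optimal
  rate. For \<open>s = (d+1)/2\<close> the sum over \<open>l \<le> L\<close> is harmonic and contributes a divergent logarithm.
  For larger \<open>s\<close> the term \<open>l = 1\<close> alone has order \<open>L\<^bsup>-d-1\<^esup>\<close>, which is larger than
  \<open>L\<^bsup>-2s\<^esup>\<close>.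

  The classical facts about spherical harmonics that this uses are obtained on the way from
  polynomial calculus and from the orthogonal invariance of the surface measure.\<close>

section \<open>Calculus of polynomial functions\<close>

definition dir_deriv :: "'a::euclidean_space \<Rightarrow> ('a \<Rightarrow> real) \<Rightarrow> 'a \<Rightarrow> real" where
  "dir_deriv v f x = deriv (\<lambda>t. f (x + t *\<^sub>R v)) 0"

lemma dir_deriv_eq:
  assumes D: "(p has_derivative D) (at x)"
  shows "dir_deriv v p x = D v"
proof -
  interpret D: bounded_linear D using D by (rule has_derivative_bounded_linear)
  have "((\<lambda>t. x + t *\<^sub>R v) has_derivative (\<lambda>t. t *\<^sub>R v)) (at 0)"
    by (auto intro!: derivative_eq_intros)
  from diff_chain_at[OF this, of p D] D
  have "((\<lambda>t. p (x + t *\<^sub>R v)) has_field_derivative D v) (at 0)"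
    by (simp add: o_def has_field_derivative_def D.scaleR mult.commute[of _ "D v"])
  then show ?thesis unfolding dir_deriv_def by (rule DERIV_imp_deriv)
qed

lemma has_derivative_dir_deriv:
  assumes "real_polynomial_function p"
  shows "(p has_derivative (\<lambda>v. dir_deriv v p x)) (at x)"
proof -
  have "p differentiable (at x)"
    using assms by (simp add: real_polynomial_function_eq differentiable_at_polynomial_function)
  then obtain D where D: "(p has_derivative D) (at x)" by (auto simp: differentiable_def)
  moreover have "(\<lambda>v. dir_deriv v p x) = D" using dir_deriv_eq[OF D] by auto
  ultimately show ?thesis by simp
qed

lemma dir_deriv_linear: "bounded_linear f \<Longrightarrow> dir_deriv v f = (\<lambda>x. f v)"
  by (rule ext, rule dir_deriv_eq, rule bounded_linear_imp_has_derivative)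

lemma dir_deriv_const: "dir_deriv v (\<lambda>x. c) = (\<lambda>x. 0)"
  by (simp add: dir_deriv_def fun_eq_iff)

lemma dir_deriv_add:
  assumes "real_polynomial_function f" "real_polynomial_function g"
  shows "dir_deriv v (\<lambda>x. f x + g x) = (\<lambda>x. dir_deriv v f x + dir_deriv v g x)"
  by (rule ext, rule dir_deriv_eq) (intro has_derivative_add has_derivative_dir_deriv assms)

lemma dir_deriv_diff:
  assumes "real_polynomial_function f" "real_polynomial_function g"
  shows "dir_deriv v (\<lambda>x. f x - g x) = (\<lambda>x. dir_deriv v f x - dir_deriv v g x)"
  by (rule ext, rule dir_deriv_eq) (intro has_derivative_diff has_derivative_dir_deriv assms)

lemma dir_deriv_mult:
  assumes "real_polynomial_function f" "real_polynomial_function g"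
  shows "dir_deriv v (\<lambda>x. f x * g x) = (\<lambda>x. dir_deriv v f x * g x + f x * dir_deriv v g x)"
proof
  fix x
  have "((\<lambda>x. f x * g x) has_derivative (\<lambda>v. f x * dir_deriv v g x + dir_deriv v f x * g x)) (at x)"
    by (intro has_derivative_mult has_derivative_dir_deriv assms)
  from dir_deriv_eq[OF this] show "dir_deriv v (\<lambda>x. f x * g x) x = dir_deriv v f x * g x + f x * dir_deriv v g x"
    by (simp add: add.commute)
qed

lemma dir_deriv_cmult:
  assumes "real_polynomial_function f"
  shows "dir_deriv v (\<lambda>x. c * f x) = (\<lambda>x. c * dir_deriv v f x)"
  by (subst dir_deriv_mult) (auto simp: dir_deriv_const assms)

lemma dir_deriv_sum:
  assumes "finite I" "\<And>i. i \<in> I \<Longrightarrow> real_polynomial_function (f i)"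
  shows "dir_deriv v (\<lambda>x. \<Sum>i\<in>I. f i x) = (\<lambda>x. \<Sum>i\<in>I. dir_deriv v (f i) x)"
  by (rule ext, rule dir_deriv_eq) (intro has_derivative_sum has_derivative_dir_deriv assms)

lemma real_polynomial_function_dir_deriv:
  assumes "real_polynomial_function p"
  shows "real_polynomial_function (dir_deriv v p)"
  using assms
  by (induction p rule: real_polynomial_function.induct)
     (auto simp: dir_deriv_linear dir_deriv_const dir_deriv_add dir_deriv_mult)

lemma real_polynomial_function_inner: "real_polynomial_function (\<lambda>x. x \<bullet> b)"
  by (intro real_polynomial_function.intros(1) bounded_linear_inner_left)

lemma real_polynomial_function_norm2: "real_polynomial_function (\<lambda>x::'a::euclidean_space. x \<bullet> x)"
proof -
  have "(\<lambda>x::'a. x \<bullet> x) = (\<lambda>x. \<Sum>b\<in>Basis. (x \<bullet> b) * (x \<bullet> b))"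
    by (rule ext) (rule euclidean_inner)
  then show ?thesis
    by (auto intro!: real_polynomial_function_inner)
qed

lemmas polyI = real_polynomial_function_inner real_polynomial_function_norm2
  real_polynomial_function_dir_deriv real_polynomial_function_sum
  real_polynomial_function.intros(2,3,4)
  real_polynomial_function_diff real_polynomial_function_minus

lemma dir_deriv_commute:
  assumes "real_polynomial_function p"
  shows "dir_deriv u (dir_deriv v p) = dir_deriv v (dir_deriv u p)"
  using assms
proof (induction p rule: real_polynomial_function.induct)
  case (mult f g)
  then show ?case
    by (simp add: dir_deriv_mult dir_deriv_add polyI algebra_simps)
qed (simp_all add: dir_deriv_linear dir_deriv_const dir_deriv_add polyI)

lemma dir_deriv_direction_sum:
  assumes "real_polynomial_function p"
  shows "dir_deriv (\<Sum>i\<in>I. c i *\<^sub>R v i) p x = (\<Sum>i\<in>I. c i * dir_deriv (v i) p x)"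
proof -
  interpret bounded_linear "\<lambda>v. dir_deriv v p x"
    using has_derivative_dir_deriv[OF assms] by (rule has_derivative_bounded_linear)
  show ?thesis by (simp add: sum scaleR)
qed

lemma dir_deriv_inner: "dir_deriv v (\<lambda>x. x \<bullet> b) = (\<lambda>x. v \<bullet> b)"
  by (rule dir_deriv_linear) (rule bounded_linear_inner_left)

lemma laplacian_eq:
  assumes "real_polynomial_function p"
  shows "laplacian p x = (\<Sum>b\<in>Basis. dir_deriv b (dir_deriv b p) x)"
proof -
  have "deriv (\<lambda>t. p (x + t *\<^sub>R b)) = (\<lambda>t. dir_deriv b p (x + t *\<^sub>R b))" for b
  proof
    fix t
    have "((\<lambda>t. x + t *\<^sub>R b) has_derivative (\<lambda>t. t *\<^sub>R b)) (at t)"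
      by (auto intro!: derivative_eq_intros)
    note d = diff_chain_at[OF this has_derivative_dir_deriv[OF assms]]
    interpret bounded_linear "\<lambda>v. dir_deriv v p (x + t *\<^sub>R b)"
      using has_derivative_dir_deriv[OF assms] by (rule has_derivative_bounded_linear)
    have "((\<lambda>t. p (x + t *\<^sub>R b)) has_field_derivative dir_deriv b p (x + t *\<^sub>R b)) (at t)"
      using d by (simp add: o_def has_field_derivative_def scaleR mult.commute[of _ "dir_deriv b p (x + t *\<^sub>R b)"])
    then show "deriv (\<lambda>t. p (x + t *\<^sub>R b)) t = dir_deriv b p (x + t *\<^sub>R b)"
      by (rule DERIV_imp_deriv)
  qed
  then have "(deriv ^^ 2) (\<lambda>t. p (x + t *\<^sub>R b)) 0 = dir_deriv b (dir_deriv b p) x" for b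
    unfolding numeral_2_eq_2 funpow.simps o_def id_def
    by (simp add: dir_deriv_def[of b "dir_deriv b p"])
  then show ?thesis by (simp add: laplacian_def)
qed

section \<open>Homogeneous polynomials\<close>

lemma monomial_polynomial: "real_polynomial_function (monomial \<alpha>)"
  unfolding monomial_def[abs_def]
  by (auto intro!: real_polynomial_function_prod real_polynomial_function_power real_polynomial_function_inner)

lemma span_polynomial:
  assumes "p \<in> span (monomial ` A)" shows "real_polynomial_function p"
  using assms
proof (induction rule: span_induct_alt)
  case base
  show ?case unfolding zero_fun_def by auto
next
  case (step c f g)
  then have "real_polynomial_function f" by (auto simp: monomial_polynomial)
  then have "real_polynomial_function (\<lambda>x. c * f x + g x)"
    using step by (intro polyI)
  moreover have "c *\<^sub>R f + g = (\<lambda>x. c * f x + g x)" by auto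
  ultimately show ?case by simp
qed

lemma homogeneous_polynomial:
  "p \<in> homogeneous_polynomials l \<Longrightarrow> real_polynomial_function p"
  unfolding homogeneous_polynomials_def by (rule span_polynomial)

lemma span_addI: "f \<in> span A \<Longrightarrow> g \<in> span A \<Longrightarrow> (\<lambda>x. f x + g x :: real) \<in> span A"
  using span_add[of f A g] by (simp add: plus_fun_def)

lemma span_cmultI: "f \<in> span A \<Longrightarrow> (\<lambda>x. c * f x :: real) \<in> span A"
  using span_scale[of f A c] by (simp add: scaleR_fun_def)

lemma span_diffI: "f \<in> span A \<Longrightarrow> g \<in> span A \<Longrightarrow> (\<lambda>x. f x - g x :: real) \<in> span A"
  using span_diff[of f A g] by (simp add: fun_diff_def)

lemma span_zeroI: "(\<lambda>x. 0 :: real) \<in> span A"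
  using span_zero[of A] by (simp add: zero_fun_def)

lemma span_sumI: "(\<And>i. i \<in> I \<Longrightarrow> f i \<in> span A) \<Longrightarrow> (\<lambda>x. \<Sum>i\<in>I. f i x :: real) \<in> span A"
  by (induction I rule: infinite_finite_induct) (auto intro: span_zeroI span_addI)

lemmas homogeneous_add = span_addI[of _ "monomial ` {\<alpha>. (\<Sum>b\<in>Basis. \<alpha> b) = l}" for l, folded homogeneous_polynomials_def]
lemmas homogeneous_diff = span_diffI[of _ "monomial ` {\<alpha>. (\<Sum>b\<in>Basis. \<alpha> b) = l}" for l, folded homogeneous_polynomials_def]
lemmas homogeneous_cmult = span_cmultI[of _ "monomial ` {\<alpha>. (\<Sum>b\<in>Basis. \<alpha> b) = l}" for l, folded homogeneous_polynomials_def]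
lemmas homogeneous_sum = span_sumI[of _ _ "monomial ` {\<alpha>. (\<Sum>b\<in>Basis. \<alpha> b) = l}" for l, folded homogeneous_polynomials_def]
lemmas homogeneous_zero = span_zeroI[of "monomial ` {\<alpha>. (\<Sum>b\<in>Basis. \<alpha> b) = l}" for l, folded homogeneous_polynomials_def]

text \<open>Induction over a linear span of functions with the vector operations written pointwise, which is
  the form in which polynomials occur as integrands and arguments of derivatives.\<close>

lemma span_induct_fun [consumes 1, case_names base step]:
  fixes p :: "'a \<Rightarrow> real"
  assumes "p \<in> span S" "P (\<lambda>x. 0)"
    and "\<And>c f g. f \<in> S \<Longrightarrow> g \<in> span S \<Longrightarrow> P g \<Longrightarrow> P (\<lambda>x. c * f x + g x)"
  shows "P p"
proof -
  have "p \<in> span S \<and> P p"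
    using assms(1)
  proof (induction rule: span_induct_alt)
    case base
    show ?case using assms(2) by (simp add: zero_fun_def span_zeroI)
  next
    case (step c f g)
    have "c *\<^sub>R f + g = (\<lambda>x. c * f x + g x)" by auto
    then show ?case using step assms(3)[of f g c]
      by (metis span_add span_base span_scale)
  qed
  then show ?thesis by simp
qed

lemma monomial_mult: "monomial \<alpha> x * monomial \<beta> x = monomial (\<lambda>b. \<alpha> b + \<beta> b) x"
  by (simp add: monomial_def power_add prod.distrib)

lemma span_mult:
  fixes f g :: "'a \<Rightarrow> real"
  assumes f: "f \<in> span A" and g: "g \<in> span B"
    and AB: "\<And>a b. a \<in> A \<Longrightarrow> b \<in> B \<Longrightarrow> (\<lambda>x. a x * b x) \<in> span C"
  shows "(\<lambda>x. f x * g x) \<in> span C"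
  using f
proof (induction rule: span_induct_fun)
  case base
  show ?case by (simp add: span_zeroI)
next
  case (step c a f')
  have "(\<lambda>x. a x * g x) \<in> span C"
    using g
  proof (induction rule: span_induct_fun)
    case base
    show ?case by (simp add: span_zeroI)
  next
    case (step c b g')
    have "(\<lambda>x. a x * (c * b x + g' x)) = (\<lambda>x. c * (a x * b x) + a x * g' x)"
      by (auto simp: algebra_simps)
    then show ?case using AB[OF \<open>a \<in> A\<close> \<open>b \<in> B\<close>] step by (auto intro!: span_addI span_cmultI)
  qed
  moreover have "(\<lambda>x. (c * a x + f' x) * g x) = (\<lambda>x. c * (a x * g x) + f' x * g x)"
    by (auto simp: algebra_simps)
  ultimately show ?case using step by (auto intro!: span_addI span_cmultI)
qed

lemma homogeneous_mult:
  assumes "p \<in> homogeneous_polynomials l" "q \<in> homogeneous_polynomials m"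
  shows "(\<lambda>x. p x * q x) \<in> homogeneous_polynomials (l + m)"
  using assms unfolding homogeneous_polynomials_def
  by (rule span_mult) (auto simp: monomial_mult sum.distrib intro!: span_base)

lemma polynomials_upto_mult:
  assumes "p \<in> polynomials_upto l" "q \<in> polynomials_upto m"
  shows "(\<lambda>x. p x * q x) \<in> polynomials_upto (l + m)"
  using assms unfolding polynomials_upto_def
  by (rule span_mult) (auto simp: monomial_mult sum.distrib intro!: span_base)

lemma homogeneous_inner:
  assumes "b \<in> Basis" shows "(\<lambda>x. x \<bullet> b) \<in> homogeneous_polynomials 1"
proof -
  have "(\<lambda>x. x \<bullet> b) = monomial (\<lambda>c. if c = b then 1 else 0)"
    using assms by (auto simp: monomial_def fun_eq_iff if_distrib[of "\<lambda>n. _ ^ n"] cong: if_cong)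
  then show ?thesis unfolding homogeneous_polynomials_def
    using assms by (auto intro!: span_base imageI)
qed

lemma homogeneous_norm2: "(\<lambda>x::'a::euclidean_space. x \<bullet> x) \<in> homogeneous_polynomials 2"
proof -
  have "(\<lambda>x::'a. x \<bullet> x) = (\<lambda>x. \<Sum>b\<in>Basis. (x \<bullet> b) * (x \<bullet> b))"
    by (rule ext) (rule euclidean_inner)
  then show ?thesis
    using homogeneous_mult[OF homogeneous_inner homogeneous_inner]
    by (auto intro!: homogeneous_sum simp: numeral_2_eq_2)
qed

lemma dir_deriv_monomial:
  assumes b: "b \<in> Basis"
  shows "dir_deriv b (monomial \<alpha>) = (\<lambda>x. real (\<alpha> b) * monomial (\<alpha>(b := \<alpha> b - 1)) x)"
proof
  fix x
  have "monomial \<alpha> (x + t *\<^sub>R b) = (x \<bullet> b + t) ^ \<alpha> b * (\<Prod>c\<in>Basis - {b}. (x \<bullet> c) ^ \<alpha> c)" for t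
    unfolding monomial_def using b
    by (subst prod.remove[of _ b]) (auto simp: inner_add_left inner_Basis intro!: prod.cong)
  moreover have "monomial (\<alpha>(b := \<alpha> b - 1)) x = (x \<bullet> b) ^ (\<alpha> b - 1) * (\<Prod>c\<in>Basis - {b}. (x \<bullet> c) ^ \<alpha> c)"
    unfolding monomial_def using b by (subst prod.remove[of _ b]) auto
  ultimately show "dir_deriv b (monomial \<alpha>) x = real (\<alpha> b) * monomial (\<alpha>(b := \<alpha> b - 1)) x"
    unfolding dir_deriv_def
    by (auto intro!: DERIV_imp_deriv derivative_eq_intros)
qed

lemma dir_deriv_homogeneous:
  fixes p :: "'a::euclidean_space \<Rightarrow> real"
  assumes b: "b \<in> Basis" and p: "p \<in> homogeneous_polynomials l"
  shows "dir_deriv b p \<in> homogeneous_polynomials (l - 1)"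
  using p unfolding homogeneous_polynomials_def
proof (induction rule: span_induct_fun)
  case base
  show ?case by (simp add: dir_deriv_const span_zeroI)
next
  case (step c f g)
  then obtain \<alpha> where \<alpha>: "f = monomial \<alpha>" "(\<Sum>b\<in>Basis. \<alpha> b) = l" by auto
  have "dir_deriv b (monomial \<alpha>) \<in> span (monomial ` {\<alpha>. (\<Sum>b\<in>Basis. \<alpha> b) = l - 1})"
  proof (cases "\<alpha> b = 0")
    case True
    then show ?thesis by (simp add: dir_deriv_monomial[OF b] span_zeroI)
  next
    case False
    have "(\<Sum>c\<in>Basis. (\<alpha>(b := \<alpha> b - 1)) c) = \<alpha> b - 1 + (\<Sum>c\<in>Basis - {b}. \<alpha> c)"
      using b by (subst sum.remove[of _ b]) auto
    moreover have "l = \<alpha> b + (\<Sum>c\<in>Basis - {b}. \<alpha> c)"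
      using b \<alpha>(2) by (subst (asm) sum.remove[of _ b]) auto
    ultimately show ?thesis unfolding dir_deriv_monomial[OF b]
      using False by (intro span_cmultI span_base) auto
  qed
  moreover have "real_polynomial_function g" using step span_polynomial by blast
  ultimately show ?case using step
    by (auto simp: dir_deriv_add dir_deriv_cmult \<alpha> monomial_polynomial polyI intro!: span_addI span_cmultI)
qed

lemma dir_deriv_homogeneous_0:
  assumes p: "p \<in> homogeneous_polynomials 0"
  shows "dir_deriv b p = (\<lambda>x. 0)"
proof -
  have "p x = p 0" for x using homogeneous_scaleR[OF p, of 0 x] by simp
  then have "p = (\<lambda>x. p 0)" by auto
  then show ?thesis by (metis dir_deriv_const)
qed

lemma euler_dir_deriv:
  assumes p: "p \<in> homogeneous_polynomials l"
  shows "(\<Sum>b\<in>Basis. (x \<bullet> b) * dir_deriv b p x) = real l * p x"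
  using euler[OF p] by (simp add: dir_deriv_def)

text \<open>Euler's identity for \<open>p\<close> and for its partial derivatives, which have one degree less.\<close>

lemma euler_second:
  assumes p: "p \<in> homogeneous_polynomials l"
  shows "(\<Sum>b\<in>Basis. \<Sum>c\<in>Basis. (x \<bullet> b) * (x \<bullet> c) * dir_deriv b (dir_deriv c p) x) = real l * (real l - 1) * p x"
proof (cases l)
  case 0
  with p show ?thesis by (simp add: dir_deriv_homogeneous_0 dir_deriv_const)
next
  case (Suc l')
  have "(\<Sum>b\<in>Basis. \<Sum>c\<in>Basis. (x \<bullet> b) * (x \<bullet> c) * dir_deriv b (dir_deriv c p) x)
      = (\<Sum>c\<in>Basis. (x \<bullet> c) * (\<Sum>b\<in>Basis. (x \<bullet> b) * dir_deriv b (dir_deriv c p) x))"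
    by (subst sum.swap) (simp add: sum_distrib_left algebra_simps)
  also have "\<dots> = (\<Sum>c\<in>Basis. (x \<bullet> c) * (real (l - 1) * dir_deriv c p x))"
    by (intro sum.cong refl arg_cong2[of _ _ _ _ "(*)"] euler_dir_deriv dir_deriv_homogeneous p)
  also have "\<dots> = real (l - 1) * (\<Sum>c\<in>Basis. (x \<bullet> c) * dir_deriv c p x)"
    by (simp add: sum_distrib_left algebra_simps)
  also have "\<dots> = real (l - 1) * (real l * p x)" by (simp only: euler_dir_deriv[OF p])
  finally show ?thesis using Suc by simp
qed

lemma laplacian_homogeneous:
  assumes "p \<in> homogeneous_polynomials l"
  shows "laplacian p \<in> homogeneous_polynomials (l - 2)"
proof -
  have "laplacian p = (\<lambda>x. \<Sum>b\<in>Basis. dir_deriv b (dir_deriv b p) x)"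
    using laplacian_eq[OF homogeneous_polynomial[OF assms]] by auto
  moreover have "dir_deriv b (dir_deriv b p) \<in> homogeneous_polynomials (l - 2)" if "b \<in> Basis" for b
    using dir_deriv_homogeneous[OF that dir_deriv_homogeneous[OF that assms]] by (simp add: numeral_2_eq_2)
  ultimately show ?thesis by (auto intro!: homogeneous_sum)
qed

section \<open>Decomposition into harmonic polynomials\<close>

lemma laplacian_norm2_mult:
  fixes p :: "'a::euclidean_space \<Rightarrow> real"
  assumes p: "p \<in> homogeneous_polynomials l"
  shows "laplacian (\<lambda>x. (x \<bullet> x) * p x) x =
    (x \<bullet> x) * laplacian p x + (4 * real l + 2 * real DIM('a)) * p x"
proof -
  have pp: "real_polynomial_function p" using p by (rule homogeneous_polynomial)
  have n: "dir_deriv b (\<lambda>x::'a. x \<bullet> x) = (\<lambda>x. 2 * (x \<bullet> b))" for b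
    by (rule ext, rule dir_deriv_eq) (auto intro!: derivative_eq_intros simp: inner_commute)
  have "laplacian (\<lambda>x. (x \<bullet> x) * p x) x
    = (\<Sum>b\<in>Basis. 2 * (b \<bullet> b) * p x + 4 * ((x \<bullet> b) * dir_deriv b p x) + (x \<bullet> x) * dir_deriv b (dir_deriv b p) x)"
    using pp
    by (subst laplacian_eq)
       (auto simp: n dir_deriv_mult dir_deriv_add dir_deriv_inner dir_deriv_const polyI algebra_simps intro!: sum.cong)
  also have "\<dots> = 2 * real DIM('a) * p x + 4 * (\<Sum>b\<in>Basis. (x \<bullet> b) * dir_deriv b p x) + (x \<bullet> x) * laplacian p x"
    by (simp add: sum.distrib sum_distrib_left laplacian_eq[OF pp])
  finally show ?thesis by (simp add: euler_dir_deriv[OF p] algebra_simps)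
qed

definition harmonic_polynomials :: "nat \<Rightarrow> ('a::euclidean_space \<Rightarrow> real) set" where
  "harmonic_polynomials l = {p \<in> homogeneous_polynomials l. \<forall>x. laplacian p x = 0}"

lemma spherical_harmonics_eq: "spherical_harmonics l = on_sphere ` harmonic_polynomials l"
  by (simp add: spherical_harmonics_def harmonic_polynomials_def)

lemma norm2_power_homogeneous:
  fixes q :: "'a::euclidean_space \<Rightarrow> real"
  assumes "q \<in> homogeneous_polynomials m"
  shows "(\<lambda>x. (x \<bullet> x) ^ j * q x) \<in> homogeneous_polynomials (2 * j + m)"
proof (induction j)
  case 0
  then show ?case using assms by simp
next
  case (Suc j)
  have "(\<lambda>x. (x \<bullet> x) * ((x \<bullet> x) ^ j * q x)) \<in> homogeneous_polynomials (2 + (2 * j + m))"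
    by (rule homogeneous_mult[OF homogeneous_norm2 Suc])
  moreover have "(\<lambda>x. (x \<bullet> x) * ((x \<bullet> x) ^ j * q x)) = (\<lambda>x. (x \<bullet> x) ^ Suc j * q x)"
    by (simp add: mult.assoc)
  moreover have "2 + (2 * j + m) = 2 * Suc j + m" by simp
  ultimately show ?case by simp
qed

text \<open>Dividing by the positive constant solves Poisson's equation with these functions as right-hand
  sides.\<close>

lemma laplacian_norm2_power_harmonic:
  fixes q :: "'a::euclidean_space \<Rightarrow> real"
  assumes q: "q \<in> harmonic_polynomials m"
  shows "\<exists>c>0. \<forall>x. laplacian (\<lambda>x. (x \<bullet> x) ^ Suc j * q x) x = c * ((x \<bullet> x) ^ j * q x)"
proof (induction j)
  case 0
  have "laplacian (\<lambda>x. (x \<bullet> x) * q x) x = (4 * real m + 2 * real DIM('a)) * q x" for x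
    using q by (subst laplacian_norm2_mult[of _ m]) (auto simp: harmonic_polynomials_def)
  then show ?case by (intro exI[of _ "4 * real m + 2 * real DIM('a)"]) (auto intro!: add_nonneg_pos)
next
  case (Suc j)
  then obtain c where c: "c > 0" "\<And>x. laplacian (\<lambda>x. (x \<bullet> x) ^ Suc j * q x) x = c * ((x \<bullet> x) ^ j * q x)"
    by auto
  let ?k = "4 * real (2 * Suc j + m) + 2 * real DIM('a)"
  have "laplacian (\<lambda>x. (x \<bullet> x) ^ Suc (Suc j) * q x) x = (c + ?k) * ((x \<bullet> x) ^ Suc j * q x)" for x
  proof -
    have "(\<lambda>x. (x \<bullet> x) ^ Suc j * q x) \<in> homogeneous_polynomials (2 * Suc j + m)"
      using q by (intro norm2_power_homogeneous) (simp add: harmonic_polynomials_def)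
    from laplacian_norm2_mult[OF this, of x] c(2)[of x] show ?thesis
      by (simp add: algebra_simps)
  qed
  moreover have "c + ?k > 0" using c by (intro add_pos_nonneg) auto
  ultimately show ?case by blast
qed

text \<open>The summands of the classical decomposition of homogeneous polynomials. On the sphere the power of
  \<open>x \<bullet> x\<close> is \<open>1\<close>, so that each of them becomes a spherical harmonic.\<close>

definition harmonic_terms :: "nat \<Rightarrow> ('a::euclidean_space \<Rightarrow> real) set" where
  "harmonic_terms l = {\<lambda>x. (x \<bullet> x) ^ j * q x |j q m. q \<in> harmonic_polynomials m \<and> 2 * j + m = l}"

lemma harmonic_terms_homogeneous:
  assumes "p \<in> span (harmonic_terms l)" shows "p \<in> homogeneous_polynomials l"
  using assms
proof (induction rule: span_induct_fun)
  case base
  show ?case by (rule homogeneous_zero)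
next
  case (step c f g)
  then show ?case using norm2_power_homogeneous
    by (auto simp: harmonic_terms_def harmonic_polynomials_def intro!: homogeneous_add homogeneous_cmult)
qed

lemma laplacian_add:
  assumes "real_polynomial_function f" "real_polynomial_function g"
  shows "laplacian (\<lambda>x. f x + g x) x = laplacian f x + laplacian g x"
  using assms by (simp add: laplacian_eq dir_deriv_add polyI sum.distrib)

lemma laplacian_diff:
  assumes "real_polynomial_function f" "real_polynomial_function g"
  shows "laplacian (\<lambda>x. f x - g x) x = laplacian f x - laplacian g x"
  using assms by (simp add: laplacian_eq dir_deriv_diff polyI sum_subtractf)

lemma laplacian_cmult:
  assumes "real_polynomial_function f"
  shows "laplacian (\<lambda>x. c * f x) x = c * laplacian f x"
  using assms by (simp add: laplacian_eq dir_deriv_cmult polyI sum_distrib_left)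

lemma laplacian_onto_harmonic_terms:
  fixes r :: "'a::euclidean_space \<Rightarrow> real"
  assumes "r \<in> span (harmonic_terms l)"
  shows "\<exists>p\<in>span (harmonic_terms (l + 2)). \<forall>x. laplacian p x = r x"
  using assms
proof (induction rule: span_induct_fun)
  case base
  have "laplacian (\<lambda>x::'a. 0) x = 0" for x by (subst laplacian_eq) (auto simp: dir_deriv_const)
  then show ?case by (intro bexI[of _ "\<lambda>x. 0"]) (auto simp: span_zeroI)
next
  case (step c f g)
  obtain p where p: "p \<in> span (harmonic_terms (l + 2))" "\<And>x. laplacian p x = g x"
    using step by auto
  obtain j q m where q: "f = (\<lambda>x. (x \<bullet> x) ^ j * q x)" "q \<in> harmonic_polynomials m" "2 * j + m = l"
    using step by (auto simp: harmonic_terms_def)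
  obtain k where k: "k > 0" "\<And>x. laplacian (\<lambda>x. (x \<bullet> x) ^ Suc j * q x) x = k * ((x \<bullet> x) ^ j * q x)"
    using laplacian_norm2_power_harmonic[OF q(2)] by blast
  define F where "F = (\<lambda>x. (x \<bullet> x) ^ Suc j * q x)"
  have "F \<in> harmonic_terms (l + 2)"
    unfolding harmonic_terms_def F_def using q
    by (intro CollectI exI[of _ "Suc j"] exI[of _ q] exI[of _ m]) auto
  then have F: "F \<in> span (harmonic_terms (l + 2))" by (rule span_base)
  have pF: "real_polynomial_function F" "real_polynomial_function p"
    using F p harmonic_terms_homogeneous homogeneous_polynomial by blast+
  define r where "r = c / k"
  have r: "r * k = c" using k by (simp add: r_def)
  have "laplacian (\<lambda>x. r * F x + p x) x = r * (k * f x) + g x" for x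
    using pF k p by (simp add: laplacian_add laplacian_cmult polyI F_def[symmetric] q(1) del: power_Suc)
  then have "laplacian (\<lambda>x. r * F x + p x) x = c * f x + g x" for x
    by (simp flip: r mult.assoc)
  then show ?case using F p by (intro bexI[of _ "\<lambda>x. r * F x + p x"] allI span_addI span_cmultI) auto
qed

text \<open>By induction on the degree \<open>laplacian p\<close> is a combination of harmonic terms, hence it is also
  \<open>laplacian r\<close> for a combination \<open>r\<close> of harmonic terms; and \<open>p - r\<close> is harmonic.\<close>

lemma homogeneous_subset_harmonic_terms:
  "p \<in> homogeneous_polynomials l \<Longrightarrow> p \<in> span (harmonic_terms l)"
proof (induction l arbitrary: p rule: less_induct)
  case (less l)
  have base: "p \<in> span (harmonic_terms l)" if "p \<in> harmonic_polynomials l" for p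
    unfolding harmonic_terms_def
    by (intro span_base CollectI exI[of _ 0] exI[of _ p] exI[of _ l]) (use that in auto)
  have pp: "real_polynomial_function p" using less by (blast intro: homogeneous_polynomial)
  show ?case
  proof (cases "l < 2")
    case True
    have "dir_deriv b (dir_deriv b p) = (\<lambda>x. 0)" if "b \<in> Basis" for b
      using dir_deriv_homogeneous[OF that less.prems] True
      by (intro dir_deriv_homogeneous_0) (auto simp: less_2_cases_iff)
    then have "laplacian p x = 0" for x by (simp add: laplacian_eq[OF pp])
    then show ?thesis using less.prems by (intro base) (auto simp: harmonic_polynomials_def)
  next
    case False
    then obtain r where r: "r \<in> span (harmonic_terms (l - 2 + 2))" "\<And>x. laplacian r x = laplacian p x"
      using laplacian_onto_harmonic_terms[OF less.IH[OF _ laplacian_homogeneous[OF less.prems]]] by auto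
    moreover have "l - 2 + 2 = l" using False by simp
    ultimately have rl: "r \<in> span (harmonic_terms l)" by simp
    have rh: "r \<in> homogeneous_polynomials l" using rl by (rule harmonic_terms_homogeneous)
    have "(\<lambda>x. p x - r x) \<in> harmonic_polynomials l"
      unfolding harmonic_polynomials_def
      using rh less.prems r by (auto intro!: homogeneous_diff simp: laplacian_diff[OF pp homogeneous_polynomial])
    from span_addI[OF base[OF this] rl] show ?thesis by simp
  qed
qed

section \<open>Infinitesimal rotations\<close>

text \<open>The infinitesimal rotation in the plane of \<open>b\<close> and \<open>c\<close>. Unlike partial derivatives these
  fields are tangential to the sphere and preserve its measure, so they can be integrated by parts
  there, and their squares sum up to twice the Laplace--Beltrami operator.\<close>

definition rot_deriv :: "'a::euclidean_space \<Rightarrow> 'a \<Rightarrow> ('a \<Rightarrow> real) \<Rightarrow> 'a \<Rightarrow> real" where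
  "rot_deriv b c p x = (x \<bullet> b) * dir_deriv c p x - (x \<bullet> c) * dir_deriv b p x"

lemma rot_deriv_polynomial: "real_polynomial_function p \<Longrightarrow> real_polynomial_function (rot_deriv b c p)"
  unfolding rot_deriv_def[abs_def] by (intro polyI)

lemma rot_deriv_mult:
  assumes "real_polynomial_function f" "real_polynomial_function g"
  shows "rot_deriv b c (\<lambda>x. f x * g x) x = rot_deriv b c f x * g x + f x * rot_deriv b c g x"
  using assms by (simp add: rot_deriv_def dir_deriv_mult algebra_simps)

lemma rot_deriv_sum:
  assumes "finite I" "\<And>i. i \<in> I \<Longrightarrow> real_polynomial_function (f i)"
  shows "rot_deriv b c (\<lambda>x. \<Sum>i\<in>I. f i x) x = (\<Sum>i\<in>I. rot_deriv b c (f i) x)"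
  using assms by (simp add: rot_deriv_def dir_deriv_sum sum_subtractf sum_distrib_left)

lemma rot_deriv_cmult:
  assumes "real_polynomial_function f"
  shows "rot_deriv b c (\<lambda>x. k * f x) x = k * rot_deriv b c f x"
  using assms by (simp add: rot_deriv_def dir_deriv_cmult algebra_simps)

text \<open>Expanding the squares gives the Laplacian and first- and second-order Euler terms, which are
  multiples of \<open>p\<close>. The factor 2 appears because both \<open>(b, c)\<close> and \<open>(c, b)\<close> are summed.\<close>

lemma casimir:
  fixes p :: "'a::euclidean_space \<Rightarrow> real"
  assumes p: "p \<in> homogeneous_polynomials l"
  shows "(\<Sum>b\<in>Basis. \<Sum>c\<in>Basis. rot_deriv b c (rot_deriv b c p) x) =
    2 * ((x \<bullet> x) * laplacian p x - sphere_eigenvalue TYPE('a) l * p x)"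
proof -
  have pp: "real_polynomial_function p" using p by (rule homogeneous_polynomial)
  let ?d = "\<lambda>b. dir_deriv b p x" and ?dd = "\<lambda>b c. dir_deriv b (dir_deriv c p) x"
  have d: "dir_deriv e (rot_deriv b c p) x = (e \<bullet> b) * ?d c + (x \<bullet> b) * ?dd e c - (e \<bullet> c) * ?d b - (x \<bullet> c) * ?dd e b" for e b c
    unfolding rot_deriv_def[abs_def] using pp
    by (simp add: dir_deriv_diff dir_deriv_mult dir_deriv_inner polyI)
  have "rot_deriv b c (rot_deriv b c p) x =
     (x \<bullet> b) * (x \<bullet> b) * ?dd c c + (x \<bullet> c) * (x \<bullet> c) * ?dd b b - 2 * ((x \<bullet> b) * (x \<bullet> c) * ?dd b c)
       - (x \<bullet> b) * ?d b - (x \<bullet> c) * ?d c + (b \<bullet> c) * ((x \<bullet> b) * ?d c) + (b \<bullet> c) * ((x \<bullet> c) * ?d b)"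
    if "b \<in> Basis" "c \<in> Basis" for b c
    using that dir_deriv_commute[OF pp, of b c]
    by (simp add: rot_deriv_def[of b c "rot_deriv b c p"] d inner_commute[of c b] algebra_simps)
  then have "(\<Sum>b\<in>Basis. \<Sum>c\<in>Basis. rot_deriv b c (rot_deriv b c p) x) =
     (\<Sum>b\<in>Basis. \<Sum>c\<in>Basis. (x \<bullet> b) * (x \<bullet> b) * ?dd c c) + (\<Sum>b\<in>Basis. \<Sum>c\<in>Basis. (x \<bullet> c) * (x \<bullet> c) * ?dd b b)
      - 2 * (\<Sum>b\<in>Basis. \<Sum>c\<in>Basis. (x \<bullet> b) * (x \<bullet> c) * ?dd b c)
      - (\<Sum>b\<in>Basis. \<Sum>c::'a\<in>Basis. (x \<bullet> b) * ?d b) - (\<Sum>b::'a\<in>Basis. \<Sum>c\<in>Basis. (x \<bullet> c) * ?d c)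
      + (\<Sum>b\<in>Basis. \<Sum>c\<in>Basis. (b \<bullet> c) * ((x \<bullet> b) * ?d c)) + (\<Sum>b\<in>Basis. \<Sum>c\<in>Basis. (b \<bullet> c) * ((x \<bullet> c) * ?d b))"
    by (simp add: sum.distrib sum_subtractf sum_distrib_left)
  also have "(\<Sum>b\<in>Basis. \<Sum>c\<in>Basis. (x \<bullet> b) * (x \<bullet> b) * ?dd c c) = (x \<bullet> x) * laplacian p x"
    by (simp add: laplacian_eq[OF pp] euclidean_inner[of x x] sum_product)
  also have "(\<Sum>b\<in>Basis. \<Sum>c\<in>Basis. (x \<bullet> c) * (x \<bullet> c) * ?dd b b) = (x \<bullet> x) * laplacian p x"
    by (subst sum.swap) (simp add: laplacian_eq[OF pp] euclidean_inner[of x x] sum_product)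
  also have "(\<Sum>b\<in>Basis. \<Sum>c\<in>Basis. (x \<bullet> b) * (x \<bullet> c) * ?dd b c) = real l * (real l - 1) * p x"
    by (rule euler_second[OF p])
  also have "(\<Sum>b\<in>Basis. \<Sum>c::'a\<in>Basis. (x \<bullet> b) * ?d b) = real DIM('a) * (real l * p x)"
    using euler_dir_deriv[OF p, of x] by (simp flip: sum_distrib_left)
  also have "(\<Sum>b::'a\<in>Basis. \<Sum>c\<in>Basis. (x \<bullet> c) * ?d c) = real DIM('a) * (real l * p x)"
    using euler_dir_deriv[OF p, of x] by simp
  also have "(\<Sum>b\<in>Basis. \<Sum>c\<in>Basis. (b \<bullet> c) * ((x \<bullet> b) * ?d c)) = (\<Sum>b\<in>Basis. (x \<bullet> b) * ?d b)"
    by (intro sum.cong refl) (simp add: inner_Basis if_distrib[of "\<lambda>t. t * _"] cong: if_cong)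
  also have "(\<Sum>b\<in>Basis. \<Sum>c\<in>Basis. (b \<bullet> c) * ((x \<bullet> c) * ?d b)) = (\<Sum>b\<in>Basis. (x \<bullet> b) * ?d b)"
    by (intro sum.cong refl) (simp add: inner_Basis if_distrib[of "\<lambda>t. t * _"] cong: if_cong)
  also note euler_dir_deriv[OF p, of x]
  finally show ?thesis by (simp add: sphere_eigenvalue_def algebra_simps)
qed

text \<open>For orthonormal \<open>b\<close> and \<open>c\<close>, the rotation by the angle \<open>t\<close> that turns \<open>b\<close> towards
  \<open>c\<close>.\<close>

definition plane_rotation :: "'a::euclidean_space \<Rightarrow> 'a \<Rightarrow> real \<Rightarrow> 'a \<Rightarrow> 'a" where
  "plane_rotation b c t x = x + ((cos t - 1) * (x \<bullet> b) - sin t * (x \<bullet> c)) *\<^sub>R b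
     + (sin t * (x \<bullet> b) + (cos t - 1) * (x \<bullet> c)) *\<^sub>R c"

lemma plane_rotation_0: "plane_rotation b c 0 x = x"
  by (simp add: plane_rotation_def)

lemma orthogonal_plane_rotation:
  assumes "b \<in> Basis" "c \<in> Basis" "b \<noteq> c"
  shows "orthogonal_transformation (plane_rotation b c t)"
proof -
  have [simp]: "b \<bullet> c = 0" "c \<bullet> b = 0" "b \<bullet> b = 1" "c \<bullet> c = 1"
    using assms by (auto simp: inner_Basis)
  have "linear (plane_rotation b c t)"
    by (rule linearI) (simp_all add: plane_rotation_def inner_add_left algebra_simps)
  moreover have "plane_rotation b c t v \<bullet> plane_rotation b c t w = v \<bullet> w" for v w
  proof -
    define C S where "C = cos t" and "S = sin t"
    have CS: "S * S = 1 - C * C" using sin_cos_squared_add[of t] by (simp add: C_def S_def power2_eq_square)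
    show ?thesis unfolding plane_rotation_def C_def[symmetric] S_def[symmetric]
      apply (simp add: inner_add_left inner_add_right inner_commute[of b v] inner_commute[of c v] inner_commute[of b w] inner_commute[of c w])
      using CS by algebra
  qed
  ultimately show ?thesis by (simp add: orthogonal_transformation_def)
qed

lemma plane_rotation_deriv:
  assumes p: "real_polynomial_function p" and bc: "b \<in> Basis" "c \<in> Basis" "b \<noteq> c"
  shows "((\<lambda>t. p (plane_rotation b c t x)) has_real_derivative
      rot_deriv b c p (plane_rotation b c t x)) (at t)"
proof -
  have [simp]: "b \<bullet> c = 0" "c \<bullet> b = 0" "b \<bullet> b = 1" "c \<bullet> c = 1"
    using bc by (auto simp: inner_Basis)
  let ?y = "plane_rotation b c t x"
  interpret bounded_linear "\<lambda>v. dir_deriv v p ?y"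
    using has_derivative_dir_deriv[OF p] by (rule has_derivative_bounded_linear)
  have y: "?y \<bullet> b = cos t * (x \<bullet> b) - sin t * (x \<bullet> c)" "?y \<bullet> c = sin t * (x \<bullet> b) + cos t * (x \<bullet> c)"
    by (simp_all add: plane_rotation_def inner_add_left algebra_simps)
  have "((\<lambda>t. plane_rotation b c t x) has_derivative (\<lambda>h. h *\<^sub>R ((?y \<bullet> b) *\<^sub>R c - (?y \<bullet> c) *\<^sub>R b))) (at t)"
    unfolding y unfolding plane_rotation_def
    by (auto intro!: derivative_eq_intros simp: algebra_simps)
  from diff_chain_at[OF this has_derivative_dir_deriv[OF p]]
  show ?thesis unfolding rot_deriv_def
    unfolding o_def by (rule has_derivative_imp_has_field_derivative) (simp add: scaleR diff)
qed

lemma orthogonal_sphere: "orthogonal_transformation f \<Longrightarrow> x \<in> sphere 0 1 \<Longrightarrow> f x \<in> sphere 0 1"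
  by (simp add: orthogonal_transformation_norm)

lemma rot_deriv_self: "rot_deriv b b p x = 0"
  by (simp add: rot_deriv_def)

text \<open>The orbit of a point of the sphere under rotations stays on the sphere, and \<open>rot_deriv\<close> is the
  derivative along it. So identities between polynomials that hold only on the sphere may be
  differentiated.\<close>

lemma rot_deriv_tangential:
  assumes "real_polynomial_function p" "real_polynomial_function q"
    and eq: "\<And>x. x \<in> sphere 0 1 \<Longrightarrow> p x = q x" and x: "x \<in> sphere 0 1"
    and bc: "b \<in> Basis" "c \<in> Basis"
  shows "rot_deriv b c p x = rot_deriv b c q x"
proof (cases "b = c")
  case True
  then show ?thesis by (simp add: rot_deriv_self)
next
  case False
  note o = orthogonal_plane_rotation[OF bc False]
  have "(\<lambda>t. p (plane_rotation b c t x)) = (\<lambda>t. q (plane_rotation b c t x))"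
    using orthogonal_sphere[OF o x] eq by auto
  with plane_rotation_deriv[OF assms(1) bc False, of x 0] plane_rotation_deriv[OF assms(2) bc False, of x 0]
  show ?thesis by (simp add: plane_rotation_0 DERIV_unique)
qed

section \<open>The sphere measure\<close>

lemma sets_sphere_measure: "sets (sphere_measure :: 'a::euclidean_space measure) = sets (restrict_space borel (sphere 0 1))"
  unfolding sphere_measure_def by (rule sets_restrict_space_cong) simp

lemma space_sphere_measure: "space (sphere_measure :: 'a::euclidean_space measure) = sphere 0 1"
  unfolding sphere_measure_def by (simp add: space_restrict_space)

lemma emeasure_sphere_measure:
  fixes A :: "'a::euclidean_space set"
  assumes A: "A \<in> sets borel" "A \<subseteq> sphere 0 1"
  shows "emeasure sphere_measure A = emeasure lborel (ball 0 1 \<inter> sgn -` A) / emeasure lborel (ball (0::'a) 1)"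
proof -
  have s: "sgn -` A \<in> sets (borel :: 'a measure)"
    using measurable_sets[OF borel_measurable_sgn A(1)] by simp
  have "emeasure sphere_measure A = emeasure (distr (uniform_measure lborel (ball 0 1)) borel sgn) A"
    unfolding sphere_measure_def using A by (subst emeasure_restrict_space) auto
  also have "\<dots> = emeasure (uniform_measure lborel (ball 0 1)) (sgn -` A)"
    using A by (subst emeasure_distr) auto
  also have "\<dots> = emeasure lborel (ball 0 1 \<inter> sgn -` A) / emeasure lborel (ball (0::'a) 1)"
    using s by (subst emeasure_uniform_measure) auto
  finally show ?thesis .
qed

lemma orthogonal_measurable:
  fixes f :: "'a::euclidean_space \<Rightarrow> 'a"
  assumes "orthogonal_transformation f" shows "f \<in> borel_measurable borel"
  using assms by (intro borel_measurable_continuous_onI linear_continuous_on)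
    (simp add: orthogonal_transformation_linear linear_linear)

lemma emeasure_ball_pos_finite:
  "emeasure lborel (ball (0::'a::euclidean_space) 1) \<noteq> 0" "emeasure lborel (ball (0::'a) 1) \<noteq> \<infinity>"
  using emeasure_lborel_ball_finite[of "0::'a" 1] content_ball_pos[of 1 "0::'a"]
  by (auto simp: emeasure_eq_measure2 measure_def)

lemma nn_integral_lborel_translate:
  fixes g :: "'a::euclidean_space \<Rightarrow> ennreal"
  assumes "g \<in> borel_measurable borel"
  shows "(\<integral>\<^sup>+x. g (c + x) \<partial>lborel) = (\<integral>\<^sup>+x. g x \<partial>lborel)"
proof -
  have "(\<integral>\<^sup>+x. g x \<partial>lborel) = (\<integral>\<^sup>+x. g x \<partial>distr lborel borel ((+) c))"
    by (simp add: lborel_distr_plus)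
  also have "\<dots> = (\<integral>\<^sup>+x. g (c + x) \<partial>lborel)"
    using assms by (subst nn_integral_distr) auto
  finally show ?thesis ..
qed

text \<open>The image measure \<open>\<mu>\<close> is translation invariant like Lebesgue measure. For two such measures,
  evaluating \<open>\<integral>\<integral> 1\<^sub>A(x + y) 1\<^sub>B(y) d\<mu>(x) dy\<close> in both orders gives \<open>\<mu>(A) |B| = |A| \<mu>(-B)\<close>; the unit
  ball \<open>B\<close> is mapped to itself, so the measures agree on it and hence everywhere.\<close>

lemma lborel_orthogonal:
  fixes f :: "'a::euclidean_space \<Rightarrow> 'a"
  assumes f: "orthogonal_transformation f"
  shows "distr lborel borel f = lborel"
proof (rule measure_eqI)
  fix A assume "A \<in> sets (distr lborel borel f)"
  then have A[measurable]: "A \<in> sets borel" by simp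
  note fm[measurable] = orthogonal_measurable[OF f]
  let ?B = "ball (0::'a) 1"
  have Bm[measurable]: "?B \<in> sets borel" by simp
  let ?T = "\<integral>\<^sup>+x. \<integral>\<^sup>+y. indicator A (f x + y) * indicator ?B y \<partial>lborel \<partial>lborel"
  have "?T = (\<integral>\<^sup>+y. \<integral>\<^sup>+x. indicator A (f x + y) * indicator ?B y \<partial>lborel \<partial>lborel)"
    by (rule lborel_pair.Fubini'[symmetric]) measurable
  also have "\<dots> = (\<integral>\<^sup>+y. emeasure (distr lborel borel f) A * indicator ?B y \<partial>lborel)"
  proof (rule nn_integral_cong)
    fix y :: 'a
    obtain z where z: "y = f z" using orthogonal_transformation_surj[OF f] by (auto simp: surj_def)
    have "f x + y = f (z + x)" for x
      using f by (simp add: z orthogonal_transformation_def linear_add add.commute)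
    then have "(\<integral>\<^sup>+x. indicator A (f x + y) \<partial>lborel) = (\<integral>\<^sup>+x. indicator A (f (z + x)) \<partial>lborel)"
      by simp
    also have "\<dots> = (\<integral>\<^sup>+x. indicator A (f x) \<partial>lborel)"
      by (rule nn_integral_lborel_translate[where g = "\<lambda>x. indicator A (f x)"]) measurable
    also have "\<dots> = emeasure (distr lborel borel f) A"
      by (subst nn_integral_distr[of f lborel borel "indicator A", symmetric]) auto
    finally show "(\<integral>\<^sup>+x. indicator A (f x + y) * indicator ?B y \<partial>lborel) = emeasure (distr lborel borel f) A * indicator ?B y"
      by (subst nn_integral_multc) auto
  qed
  also have "\<dots> = emeasure (distr lborel borel f) A * emeasure lborel ?B"
    by (subst nn_integral_cmult) auto
  finally have T1: "?T = emeasure (distr lborel borel f) A * emeasure lborel ?B" .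
  have "?T = (\<integral>\<^sup>+x. \<integral>\<^sup>+y. indicator A y * indicator ?B (y - f x) \<partial>lborel \<partial>lborel)"
  proof (rule nn_integral_cong)
    fix x
    show "(\<integral>\<^sup>+y. indicator A (f x + y) * indicator ?B y \<partial>lborel) = (\<integral>\<^sup>+y. indicator A y * indicator ?B (y - f x) \<partial>lborel)"
      using nn_integral_lborel_translate[of "\<lambda>y. indicator A y * indicator ?B (y - f x)" "f x"] by simp
  qed
  also have "\<dots> = (\<integral>\<^sup>+y. \<integral>\<^sup>+x. indicator A y * indicator ?B (y - f x) \<partial>lborel \<partial>lborel)"
    by (rule lborel_pair.Fubini'[symmetric]) measurable
  also have "\<dots> = (\<integral>\<^sup>+y. indicator A y * emeasure lborel ?B \<partial>lborel)"
  proof (rule nn_integral_cong)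
    fix y :: 'a
    obtain z where z: "y = f z" using orthogonal_transformation_surj[OF f] by (auto simp: surj_def)
    have "norm (y - f (z + x)) = norm x" for x
      using f by (simp add: z orthogonal_transformation_def linear_add orthogonal_transformation_norm[OF f])
    then have "indicator ?B (y - f (z + x)) = (indicator ?B x :: ennreal)" for x
      by (simp add: indicator_def)
    then have "(\<integral>\<^sup>+x. indicator ?B (y - f x) \<partial>lborel) = (\<integral>\<^sup>+x. indicator ?B x \<partial>lborel)"
      using nn_integral_lborel_translate[of "\<lambda>x. indicator ?B (y - f x)" z] by simp
    then show "(\<integral>\<^sup>+x. indicator A y * indicator ?B (y - f x) \<partial>lborel) = indicator A y * emeasure lborel ?B"
      by (subst nn_integral_cmult) auto
  qed
  also have "\<dots> = emeasure lborel A * emeasure lborel ?B"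
    by (subst nn_integral_multc) auto
  finally have "emeasure (distr lborel borel f) A * emeasure lborel ?B = emeasure lborel A * emeasure lborel ?B"
    using T1 by simp
  then show "emeasure (distr lborel borel f) A = emeasure lborel A"
    using emeasure_ball_pos_finite[where 'a='a]
    by (simp add: ennreal_mult_cancel_left mult.commute[of _ "emeasure lborel ?B"])
qed simp

lemma orthogonal_sgn:
  assumes "orthogonal_transformation f" shows "sgn (f x) = f (sgn x)"
  using assms by (simp add: sgn_div_norm orthogonal_transformation_norm orthogonal_transformation_scaleR)

lemma orthogonal_measurable_sphere:
  fixes f :: "'a::euclidean_space \<Rightarrow> 'a"
  assumes f: "orthogonal_transformation f"
  shows "f \<in> measurable sphere_measure sphere_measure"
proof -
  have "f \<in> measurable (restrict_space borel (sphere 0 1)) (restrict_space borel (sphere 0 1))"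
    using orthogonal_sphere[OF f]
    by (intro measurable_restrict_space3 orthogonal_measurable f) auto
  then show ?thesis
    by (simp add: measurable_cong_sets[OF sets_sphere_measure sets_sphere_measure])
qed

lemma sphere_measure_orthogonal:
  fixes f :: "'a::euclidean_space \<Rightarrow> 'a"
  assumes f: "orthogonal_transformation f"
  shows "distr sphere_measure sphere_measure f = sphere_measure"
proof (rule measure_eqI)
  fix A assume "A \<in> sets (distr sphere_measure sphere_measure f)"
  then have A: "A \<in> sets borel" "A \<subseteq> sphere 0 1"
    by (auto simp: sets_sphere_measure sets_restrict_space_iff)
  note [measurable] = orthogonal_measurable[OF f]
  let ?B = "ball (0::'a) 1"
  have fA: "f -` A \<in> sets borel" using measurable_sets[OF orthogonal_measurable[OF f] A(1)] by simp
  have fsub: "f -` A \<subseteq> sphere 0 1" using A f by (auto simp: orthogonal_transformation_norm[OF f])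
  have s: "?B \<inter> sgn -` A \<in> sets borel"
    using measurable_sets[OF borel_measurable_sgn A(1)] by auto
  have "emeasure (distr sphere_measure sphere_measure f) A = emeasure sphere_measure (f -` A)"
    using A fsub orthogonal_measurable_sphere[OF f]
    by (subst emeasure_distr) (auto simp: sets_sphere_measure sets_restrict_space_iff space_sphere_measure Int_absorb2)
  also have "\<dots> = emeasure lborel (?B \<inter> sgn -` (f -` A)) / emeasure lborel ?B"
    by (rule emeasure_sphere_measure[OF fA fsub])
  also have "?B \<inter> sgn -` (f -` A) = f -` (?B \<inter> sgn -` A)"
    by (auto simp: orthogonal_sgn[OF f] orthogonal_transformation_norm[OF f])
  also have "emeasure lborel (f -` (?B \<inter> sgn -` A)) = emeasure (distr lborel borel f) (?B \<inter> sgn -` A)"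
    using s by (subst emeasure_distr) auto
  also have "\<dots> = emeasure lborel (?B \<inter> sgn -` A)" by (simp add: lborel_orthogonal[OF f])
  finally show "emeasure (distr sphere_measure sphere_measure f) A = emeasure sphere_measure A"
    using emeasure_sphere_measure[OF A] by simp
qed simp

interpretation sphere: prob_space "sphere_measure :: 'a::euclidean_space measure"
  by (rule prob_space_sphere_measure)

lemma borel_measurable_sphere:
  "continuous_on (sphere 0 1) f \<Longrightarrow> f \<in> borel_measurable (sphere_measure :: 'a::euclidean_space measure)"
  using borel_measurable_continuous_on_restrict[of "sphere 0 1" f]
  by (simp add: measurable_cong_sets[OF sets_sphere_measure refl])

lemma continuous_sphere_bounded:
  fixes f :: "'a::euclidean_space \<Rightarrow> real"
  assumes "continuous_on (sphere 0 1) f"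
  obtains c where "c > 0" "\<And>x. x \<in> sphere 0 1 \<Longrightarrow> \<bar>f x\<bar> \<le> c"
proof -
  have "bounded (f ` sphere 0 1)"
    using assms by (intro compact_imp_bounded compact_continuous_image) auto
  then show ?thesis using that unfolding bounded_pos by auto
qed

lemma integrable_sphere:
  fixes f :: "'a::euclidean_space \<Rightarrow> real"
  assumes f: "continuous_on (sphere 0 1) f"
  shows "integrable sphere_measure f"
proof -
  obtain c where "\<And>x. x \<in> sphere 0 1 \<Longrightarrow> \<bar>f x\<bar> \<le> c" using continuous_sphere_bounded[OF f] by metis
  then show ?thesis
    by (intro sphere.integrable_const_bound[where B=c] AE_I2 borel_measurable_sphere f)
       (auto simp: space_sphere_measure)
qed

lemma continuous_on_poly:
  "real_polynomial_function p \<Longrightarrow> continuous_on S p"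
  by (simp add: real_polynomial_function_eq continuous_on_polymonial_function)

lemma integrable_poly:
  "real_polynomial_function p \<Longrightarrow> integrable sphere_measure p"
  by (intro integrable_sphere continuous_on_poly)

lemma integral_sphere_cong:
  assumes "\<And>x. x \<in> sphere 0 1 \<Longrightarrow> f x = (g x :: real)"
  shows "(\<integral>x. f x \<partial>sphere_measure) = (\<integral>x. g x \<partial>sphere_measure)"
  by (rule Bochner_Integration.integral_cong) (auto simp: space_sphere_measure assms)

lemma integral_orthogonal:
  fixes g :: "'a::euclidean_space \<Rightarrow> real" and f :: "'a \<Rightarrow> 'a"
  assumes f: "orthogonal_transformation f" and g: "continuous_on (sphere 0 1) g"
  shows "(\<integral>x. g (f x) \<partial>sphere_measure) = (\<integral>x. g x \<partial>sphere_measure)"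
  using integral_distr[OF orthogonal_measurable_sphere[OF f] borel_measurable_sphere[OF g]]
  by (simp add: sphere_measure_orthogonal[OF f])

text \<open>The integral of \<open>p\<close> composed with a rotation does not depend on the angle. Its derivative at angle
  0 may be taken under the integral: by the mean value theorem the difference quotients are bounded
  by the maximum of \<open>rot_deriv b c p\<close> on the sphere.\<close>

lemma integral_rot_deriv:
  fixes p :: "'a::euclidean_space \<Rightarrow> real"
  assumes p: "real_polynomial_function p" and bc: "b \<in> Basis" "c \<in> Basis"
  shows "(\<integral>x. rot_deriv b c p x \<partial>sphere_measure) = 0"
proof (cases "b = c")
  case True
  then show ?thesis by (simp add: rot_deriv_self)
next
  case False
  note o = orthogonal_plane_rotation[OF bc False]
  obtain C where C: "\<And>x. x \<in> sphere 0 1 \<Longrightarrow> \<bar>rot_deriv b c p x\<bar> \<le> C"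
    using continuous_sphere_bounded[OF continuous_on_poly[OF rot_deriv_polynomial[OF p]]] by metis
  define t where "t n = inverse (real (Suc n))" for n
  have t: "t n > 0" for n by (simp add: t_def)
  have t0: "t \<longlonglongrightarrow> 0" unfolding t_def by (rule LIMSEQ_inverse_real_of_nat)
  define F where "F n x = (p (plane_rotation b c (t n) x) - p x) / t n" for n x
  have cont: "continuous_on (sphere 0 1) (\<lambda>x. p (plane_rotation b c t x))" for t
    by (rule continuous_on_compose2[OF continuous_on_poly[OF p, of UNIV]])
       (auto intro!: linear_continuous_on simp: linear_linear orthogonal_transformation_linear[OF o])
  have intF: "(\<integral>x. F n x \<partial>sphere_measure) = 0" for n
    unfolding F_def
    using integral_orthogonal[OF o continuous_on_poly[OF p]] integrable_sphere[OF cont] integrable_poly[OF p]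
    by simp
  have "(\<lambda>n. \<integral>x. F n x \<partial>sphere_measure) \<longlonglongrightarrow> (\<integral>x. rot_deriv b c p x \<partial>sphere_measure)"
  proof (rule integral_dominated_convergence[where w="\<lambda>_. C"])
    show "rot_deriv b c p \<in> borel_measurable sphere_measure"
      by (intro borel_measurable_sphere continuous_on_poly rot_deriv_polynomial p)
    show "F n \<in> borel_measurable sphere_measure" for n
      unfolding F_def using t[of n]
      by (intro borel_measurable_sphere continuous_intros cont continuous_on_poly p) auto
    show "integrable sphere_measure (\<lambda>_::'a. C)" by simp
    show "AE x in sphere_measure. (\<lambda>n. F n x) \<longlonglongrightarrow> rot_deriv b c p x"
    proof (rule AE_I2)
      fix x :: 'a
      have "((\<lambda>h. (p (plane_rotation b c h x) - p x) / h) \<longlongrightarrow> rot_deriv b c p x) (at 0)"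
        using plane_rotation_deriv[OF p bc False, of x 0]
        by (simp add: has_field_derivative_iff plane_rotation_0)
      moreover have "filterlim t (at 0) sequentially"
        using t0 t by (auto simp: filterlim_at less_imp_neq intro!: always_eventually) (metis less_irrefl)
      ultimately show "(\<lambda>n. F n x) \<longlonglongrightarrow> rot_deriv b c p x"
        unfolding F_def by (rule filterlim_compose)
    qed
    show "AE x in sphere_measure. norm (F n x) \<le> C" for n
    proof (rule AE_I2)
      fix x :: 'a assume "x \<in> space sphere_measure"
      then have x: "x \<in> sphere 0 1" by (simp add: space_sphere_measure)
      obtain z where z: "p (plane_rotation b c (t n) x) - p (plane_rotation b c 0 x) = (t n - 0) * rot_deriv b c p (plane_rotation b c z x)"
        using MVT2[OF t[of n], of "\<lambda>t. p (plane_rotation b c t x)" "\<lambda>t. rot_deriv b c p (plane_rotation b c t x)"]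
          plane_rotation_deriv[OF p bc False, of x] by blast
      then have "F n x = rot_deriv b c p (plane_rotation b c z x)"
        using t[of n] by (simp add: F_def plane_rotation_0)
      then show "norm (F n x) \<le> C" using C[OF orthogonal_sphere[OF o x]] by simp
    qed
  qed
  then show ?thesis by (simp add: intF LIMSEQ_const_iff)
qed

lemma rot_deriv_skew:
  fixes p q :: "'a::euclidean_space \<Rightarrow> real"
  assumes p: "real_polynomial_function p" and q: "real_polynomial_function q"
    and bc: "b \<in> Basis" "c \<in> Basis"
  shows "(\<integral>x. rot_deriv b c p x * q x \<partial>sphere_measure) = - (\<integral>x. p x * rot_deriv b c q x \<partial>sphere_measure)"
proof -
  have "0 = (\<integral>x. rot_deriv b c (\<lambda>x. p x * q x) x \<partial>sphere_measure)"
    using integral_rot_deriv[OF _ bc, of "\<lambda>x. p x * q x"] p q by (simp add: polyI)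
  also have "\<dots> = (\<integral>x. rot_deriv b c p x * q x + p x * rot_deriv b c q x \<partial>sphere_measure)"
    by (simp add: rot_deriv_mult p q)
  also have "\<dots> = (\<integral>x. rot_deriv b c p x * q x \<partial>sphere_measure) + (\<integral>x. p x * rot_deriv b c q x \<partial>sphere_measure)"
    using p q by (intro Bochner_Integration.integral_add integrable_poly polyI rot_deriv_polynomial)
  finally show ?thesis by simp
qed

text \<open>The surface measure has full support: a nonempty relatively open subset of the sphere spans a cone
  with nonempty interior, which has positive volume.\<close>

lemma sphere_integral_square_zero:
  fixes f :: "'a::euclidean_space \<Rightarrow> real"
  assumes f: "continuous_on (sphere 0 1) f" and 0: "(\<integral>x. (f x)\<^sup>2 \<partial>sphere_measure) = 0"
    and x0: "x0 \<in> sphere 0 1"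
  shows "f x0 = 0"
proof (rule ccontr)
  assume nz: "f x0 \<noteq> 0"
  have "openin (top_of_set (sphere 0 1)) (sphere 0 1 \<inter> f -` (- {0}))"
    using f by (rule continuous_openin_preimage_gen) auto
  then obtain T where T: "open T" "sphere 0 1 \<inter> f -` (- {0}) = sphere 0 1 \<inter> T"
    by (auto simp: openin_open)
  have ae: "AE x in sphere_measure. (f x)\<^sup>2 = 0"
    using integrable_sphere[of "\<lambda>x. (f x)\<^sup>2"] f 0
    by (subst (asm) integral_nonneg_eq_0_iff_AE) (auto intro!: continuous_intros)
  have Us: "sphere 0 1 \<inter> T \<in> sets sphere_measure"
    using T by (auto simp: sets_sphere_measure sets_restrict_space)
  have U0: "emeasure sphere_measure (sphere 0 1 \<inter> T) = 0"
  proof -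
    have "AE x in sphere_measure. x \<notin> sphere 0 1 \<inter> T"
      using ae
    proof eventually_elim
      case (elim x)
      have "f x \<noteq> 0" if "x \<in> sphere 0 1 \<inter> T" using that T(2) by blast
      with elim show ?case by auto
    qed
    with AE_iff_null_sets[OF Us] show ?thesis by (blast intro: null_setsD1)
  qed
  \<comment> \<open>The part of the cone over \<open>T\<close> inside the unit ball; it contains \<open>x0 / 2\<close>.\<close>
  define W where "W = (- {0} \<inter> sgn -` T) \<inter> ball (0::'a) 1"
  have W: "open W" unfolding W_def
    by (intro open_Int continuous_open_preimage continuous_intros T(1)) auto
  have "(1/2) *\<^sub>R x0 \<in> W"
  proof -
    have "x0 \<in> T" using nz x0 T(2) by blast
    moreover have "sgn ((1/2) *\<^sub>R x0) = x0" using x0 by (simp add: sgn_div_norm)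
    ultimately show ?thesis using x0 by (auto simp: W_def)
  qed
  then obtain e where e: "e > 0" "ball ((1/2) *\<^sub>R x0) e \<subseteq> W"
    using W by (meson openE)
  have sub: "W \<subseteq> ball 0 1 \<inter> sgn -` (sphere 0 1 \<inter> T)"
    by (auto simp: W_def norm_sgn)
  have "emeasure lborel (ball 0 1 \<inter> sgn -` (sphere 0 1 \<inter> T)) = 0"
  proof -
    have "emeasure lborel (ball 0 1 \<inter> sgn -` (sphere 0 1 \<inter> T)) / emeasure lborel (ball (0::'a) 1) = 0"
      using U0 T(1) by (subst (asm) emeasure_sphere_measure) auto
    then show ?thesis using emeasure_ball_pos_finite[where 'a='a] by (auto simp: ennreal_divide_eq_0_iff)
  qed
  moreover have "emeasure lborel (ball ((1/2) *\<^sub>R x0) e) \<le> emeasure lborel (ball 0 1 \<inter> sgn -` (sphere 0 1 \<inter> T))"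
  proof (rule emeasure_mono)
    show "ball ((1/2) *\<^sub>R x0) e \<subseteq> ball 0 1 \<inter> sgn -` (sphere 0 1 \<inter> T)" using e sub by blast
    have "sgn -` (sphere 0 1 \<inter> T) \<in> sets (borel :: 'a measure)"
      using measurable_sets[OF borel_measurable_sgn, of "sphere 0 1 \<inter> T"] T(1) by simp
    then show "ball 0 1 \<inter> sgn -` (sphere 0 1 \<inter> T) \<in> sets (lborel :: 'a measure)" by auto
  qed
  ultimately have "emeasure lborel (ball ((1/2) *\<^sub>R x0) e) = 0" by simp
  then show False using content_ball_pos[OF e(1), of "(1/2) *\<^sub>R x0"] by (simp add: measure_def)
qed

section \<open>Orthogonal invariance of harmonic polynomials\<close>

text \<open>For \<open>u = 0\<close> this is the identity, because division by zero yields zero; \<open>reflection (x - y)\<close> is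
  therefore an orthogonal map that takes \<open>x\<close> to \<open>y\<close> even if \<open>x = y\<close>.\<close>

definition reflection :: "'a::euclidean_space \<Rightarrow> 'a \<Rightarrow> 'a" where
  "reflection u x = x - (2 * (x \<bullet> u) / (u \<bullet> u)) *\<^sub>R u"

lemma orthogonal_reflection: "orthogonal_transformation (reflection u)"
proof (cases "u = 0")
  case True
  then show ?thesis by (simp add: reflection_def[abs_def])
next
  case False
  have "linear (reflection u)"
    unfolding reflection_def[abs_def]
    by (rule linearI) (simp_all add: inner_add_left distrib_left add_divide_distrib scaleR_add_left scaleR_diff_right)
  moreover have "reflection u v \<bullet> reflection u w = v \<bullet> w" for v w
  proof -
    define k r s where "k = u \<bullet> u" and "r = v \<bullet> u" and "s = w \<bullet> u"
    have k: "k \<noteq> 0" using False by (simp add: k_def)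
    have "reflection u v \<bullet> reflection u w = v \<bullet> w - 2 * s / k * r - (2 * r / k * s - 2 * r / k * (2 * s / k * k))"
      by (simp add: reflection_def inner_diff_left inner_diff_right inner_commute[of u w] k_def r_def s_def algebra_simps)
    also have "\<dots> = v \<bullet> w" using k by (simp add: field_simps)
    finally show ?thesis .
  qed
  ultimately show ?thesis by (simp add: orthogonal_transformation_def)
qed

lemma reflection_transitive:
  assumes "x \<in> sphere 0 1" "y \<in> sphere 0 1"
  shows "reflection (x - y) x = y"
proof (cases "x = y")
  case True
  then show ?thesis by (simp add: reflection_def)
next
  case False
  have [simp]: "x \<bullet> x = 1" "y \<bullet> y = 1" using assms by (auto simp: norm_eq_1)
  have "(x - y) \<bullet> (x - y) = 2 * (x \<bullet> (x - y))"
    by (simp add: inner_diff_left inner_diff_right inner_commute[of y x])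
  moreover have "(x - y) \<bullet> (x - y) \<noteq> 0" using False by simp
  ultimately show ?thesis unfolding reflection_def by simp
qed

lemma homogeneous_const: "(\<lambda>x. c) \<in> homogeneous_polynomials 0"
proof -
  have "(\<lambda>x. c * monomial (\<lambda>_. 0) x) \<in> homogeneous_polynomials 0"
    unfolding homogeneous_polynomials_def by (intro span_cmultI span_base) auto
  then show ?thesis by (simp add: monomial_def)
qed

lemma homogeneous_power:
  assumes "p \<in> homogeneous_polynomials l" shows "(\<lambda>x. p x ^ n) \<in> homogeneous_polynomials (n * l)"
proof (induction n)
  case 0
  then show ?case by (simp add: homogeneous_const)
next
  case (Suc n)
  from homogeneous_mult[OF assms Suc] show ?case by simp
qed

lemma homogeneous_prod:
  assumes "finite I" "\<And>i. i \<in> I \<Longrightarrow> p i \<in> homogeneous_polynomials (l i)"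
  shows "(\<lambda>x. \<Prod>i\<in>I. p i x) \<in> homogeneous_polynomials (\<Sum>i\<in>I. l i)"
  using assms by (induction I) (auto simp: homogeneous_const intro!: homogeneous_mult)

lemma homogeneous_orthogonal:
  fixes f :: "'a::euclidean_space \<Rightarrow> 'a"
  assumes f: "orthogonal_transformation f" and p: "p \<in> homogeneous_polynomials l"
  shows "(\<lambda>x. p (f x)) \<in> homogeneous_polynomials l"
proof -
  have 1: "(\<lambda>x. f x \<bullet> b) \<in> homogeneous_polynomials 1" for b
  proof -
    have eq: "(\<lambda>x. f x \<bullet> b) = (\<lambda>x. \<Sum>c\<in>Basis. (f c \<bullet> b) * (x \<bullet> c))"
    proof
      fix x
      have "f x = f (\<Sum>c\<in>Basis. (x \<bullet> c) *\<^sub>R c)" by (simp add: euclidean_representation)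
      also have "\<dots> = (\<Sum>c\<in>Basis. (x \<bullet> c) *\<^sub>R f c)"
        using orthogonal_transformation_linear[OF f] by (simp add: linear_sum linear_scale)
      finally show "f x \<bullet> b = (\<Sum>c\<in>Basis. (f c \<bullet> b) * (x \<bullet> c))"
        by (simp add: inner_sum_left mult.commute)
    qed
    show ?thesis
      by (subst eq) (intro homogeneous_sum homogeneous_cmult homogeneous_inner)
  qed
  show ?thesis
    using p unfolding homogeneous_polynomials_def[of l]
  proof (induction rule: span_induct_fun)
    case base
    show ?case using homogeneous_zero[of l] by (simp add: homogeneous_polynomials_def)
  next
    case (step c g h)
    then obtain \<alpha> where \<alpha>: "g = monomial \<alpha>" "(\<Sum>b\<in>Basis. \<alpha> b) = l" by auto
    have "(\<lambda>x. g (f x)) \<in> homogeneous_polynomials (\<Sum>b\<in>Basis. \<alpha> b * 1)"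
      unfolding \<alpha> monomial_def by (intro homogeneous_prod homogeneous_power 1) auto
    then have "(\<lambda>x. g (f x)) \<in> homogeneous_polynomials l" using \<alpha> by simp
    then show ?case using step unfolding homogeneous_polynomials_def by (intro span_addI span_cmultI)
  qed
qed

lemma dir_deriv_orthogonal:
  fixes f :: "'a::euclidean_space \<Rightarrow> 'a"
  assumes f: "orthogonal_transformation f" and p: "real_polynomial_function p"
  shows "dir_deriv v (\<lambda>x. p (f x)) = (\<lambda>x. dir_deriv (f v) p (f x))"
proof
  fix x
  have "(f has_derivative f) (at x)"
    using orthogonal_transformation_linear[OF f]
    by (intro bounded_linear_imp_has_derivative) (simp add: linear_conv_bounded_linear)
  from diff_chain_at[OF this has_derivative_dir_deriv[OF p]]
  have "((\<lambda>x. p (f x)) has_derivative (\<lambda>v. dir_deriv (f v) p (f x))) (at x)"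
    by (simp add: o_def)
  then show "dir_deriv v (\<lambda>x. p (f x)) x = dir_deriv (f v) p (f x)" by (rule dir_deriv_eq)
qed

text \<open>The Laplacian is the trace of the Hessian, which may be computed in any orthonormal basis; the
  images of the standard basis form one.\<close>

lemma laplacian_orthogonal:
  fixes f :: "'a::euclidean_space \<Rightarrow> 'a"
  assumes f: "orthogonal_transformation f" and p: "real_polynomial_function p"
    and pf: "real_polynomial_function (\<lambda>x. p (f x))"
  shows "laplacian (\<lambda>x. p (f x)) x = laplacian p (f x)"
proof -
  let ?dd = "\<lambda>c c'. dir_deriv c (dir_deriv c' p) (f x)"
  obtain g where g: "orthogonal_transformation g" "\<And>b c. f b \<bullet> c = b \<bullet> g c"
  proof
    show "orthogonal_transformation (inv f)" by (rule orthogonal_transformation_inv[OF f])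
    have "f (inv f c) = c" for c using orthogonal_transformation_surj[OF f] by (simp add: surj_f_inv_f)
    then show "f b \<bullet> c = b \<bullet> inv f c" for b c
      using f unfolding orthogonal_transformation_def by metis
  qed
  have fb: "f b = (\<Sum>c\<in>Basis. (f b \<bullet> c) *\<^sub>R c)" for b by (simp add: euclidean_representation)
  have d1: "dir_deriv (f b) q y = (\<Sum>c\<in>Basis. (f b \<bullet> c) * dir_deriv c q y)" if "real_polynomial_function q" for b q y
    by (subst fb) (rule dir_deriv_direction_sum[OF that])
  have d2: "dir_deriv c (dir_deriv (f b) p) y = (\<Sum>c'\<in>Basis. (f b \<bullet> c') * dir_deriv c (dir_deriv c' p) y)" for b c y
  proof -
    have "dir_deriv (f b) p = (\<lambda>y. \<Sum>c\<in>Basis. (f b \<bullet> c) * dir_deriv c p y)" using d1[OF p] by auto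
    then have "dir_deriv c (dir_deriv (f b) p) y = dir_deriv c (\<lambda>y. \<Sum>c\<in>Basis. (f b \<bullet> c) * dir_deriv c p y) y"
      by (rule arg_cong)
    also have "\<dots> = (\<Sum>c'\<in>Basis. dir_deriv c (\<lambda>y. (f b \<bullet> c') * dir_deriv c' p y) y)"
      by (subst dir_deriv_sum) (use p in \<open>auto intro!: polyI\<close>)
    also have "\<dots> = (\<Sum>c'\<in>Basis. (f b \<bullet> c') * dir_deriv c (dir_deriv c' p) y)"
      by (simp add: dir_deriv_cmult real_polynomial_function_dir_deriv p)
    finally show ?thesis .
  qed
  have "laplacian (\<lambda>x. p (f x)) x = (\<Sum>b\<in>Basis. dir_deriv (f b) (dir_deriv (f b) p) (f x))"
    by (simp add: laplacian_eq[OF pf] dir_deriv_orthogonal f p polyI)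
  also have "\<dots> = (\<Sum>b\<in>Basis. \<Sum>c\<in>Basis. \<Sum>c'\<in>Basis. (f b \<bullet> c) * (f b \<bullet> c') * ?dd c c')"
    by (subst d1[OF real_polynomial_function_dir_deriv[OF p]]) (simp add: d2 sum_distrib_left mult.assoc)
  also have "\<dots> = (\<Sum>c\<in>Basis. \<Sum>c'\<in>Basis. (\<Sum>b\<in>Basis. (f b \<bullet> c) * (f b \<bullet> c')) * ?dd c c')"
    unfolding sum_distrib_right
    by (subst sum.swap) (intro sum.cong refl sum.swap)
  also have "\<dots> = (\<Sum>c\<in>Basis. \<Sum>c'\<in>Basis. (c \<bullet> c') * ?dd c c')"
  proof (intro sum.cong refl arg_cong2[of _ _ _ _ "(*)"])
    fix c c' :: 'a
    have "(\<Sum>b\<in>Basis. (f b \<bullet> c) * (f b \<bullet> c')) = (\<Sum>b\<in>Basis. (g c \<bullet> b) * (g c' \<bullet> b))"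
      unfolding g(2) by (simp only: inner_commute)
    also have "\<dots> = g c \<bullet> g c'" by (rule euclidean_inner[symmetric])
    finally have "(\<Sum>b\<in>Basis. (f b \<bullet> c) * (f b \<bullet> c')) = g c \<bullet> g c'" .
    then show "(\<Sum>b\<in>Basis. (f b \<bullet> c) * (f b \<bullet> c')) = c \<bullet> c'"
      using g(1) by (simp add: orthogonal_transformation_def)
  qed
  also have "\<dots> = (\<Sum>c\<in>Basis. ?dd c c)"
    by (intro sum.cong refl) (simp add: inner_Basis if_distrib[of "\<lambda>t. t * _"] cong: if_cong)
  finally show ?thesis by (simp add: laplacian_eq[OF p])
qed

lemma harmonic_orthogonal:
  fixes f :: "'a::euclidean_space \<Rightarrow> 'a"
  assumes f: "orthogonal_transformation f" and p: "p \<in> harmonic_polynomials l"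
  shows "(\<lambda>x. p (f x)) \<in> harmonic_polynomials l"
  using homogeneous_orthogonal[OF f, of p l] p laplacian_orthogonal[OF f, of p]
  by (auto simp: harmonic_polynomials_def homogeneous_polynomial)

section \<open>The inner product on the sphere\<close>

definition sphere_inner :: "('a::euclidean_space \<Rightarrow> real) \<Rightarrow> ('a \<Rightarrow> real) \<Rightarrow> real" where
  "sphere_inner p q = (\<integral>x. p x * q x \<partial>sphere_measure)"

lemma sphere_inner_cong:
  assumes "\<And>x. x \<in> sphere 0 1 \<Longrightarrow> p x = p' x" "\<And>x. x \<in> sphere 0 1 \<Longrightarrow> q x = q' x"
  shows "sphere_inner p q = sphere_inner p' q'"
  unfolding sphere_inner_def using assms by (intro integral_sphere_cong) simp

lemma sphere_inner_commute: "sphere_inner p q = sphere_inner q p"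
  by (simp add: sphere_inner_def mult.commute)

lemma sphere_inner_sum:
  assumes "\<And>i. i \<in> I \<Longrightarrow> continuous_on (sphere 0 1) (p i)" "continuous_on (sphere 0 1) q"
  shows "sphere_inner (\<lambda>x. \<Sum>i\<in>I. c i * p i x) q = (\<Sum>i\<in>I. c i * sphere_inner (p i) q)"
proof -
  have "sphere_inner (\<lambda>x. \<Sum>i\<in>I. c i * p i x) q = (\<integral>x. (\<Sum>i\<in>I. c i * (p i x * q x)) \<partial>sphere_measure)"
    unfolding sphere_inner_def by (simp add: sum_distrib_right mult.assoc)
  also have "\<dots> = (\<Sum>i\<in>I. \<integral>x. c i * (p i x * q x) \<partial>sphere_measure)"
    using assms by (intro Bochner_Integration.integral_sum integrable_sphere continuous_intros) auto
  finally show ?thesis by (simp add: sphere_inner_def)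
qed

lemma sphere_inner_sum_right:
  assumes "\<And>i. i \<in> I \<Longrightarrow> continuous_on (sphere 0 1) (p i)" "continuous_on (sphere 0 1) q"
  shows "sphere_inner q (\<lambda>x. \<Sum>i\<in>I. c i * p i x) = (\<Sum>i\<in>I. c i * sphere_inner q (p i))"
  using sphere_inner_sum[OF assms] by (simp add: sphere_inner_commute[of q])

lemma rot_deriv_skew_inner:
  assumes "real_polynomial_function p" "real_polynomial_function q" "b \<in> Basis" "c \<in> Basis"
  shows "sphere_inner (rot_deriv b c p) q = - sphere_inner p (rot_deriv b c q)"
  unfolding sphere_inner_def by (rule rot_deriv_skew[OF assms])

lemma casimir_sphere:
  fixes p :: "'a::euclidean_space \<Rightarrow> real"
  assumes p: "p \<in> harmonic_polynomials l" and x: "x \<in> sphere 0 1"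
  shows "(\<Sum>b\<in>Basis. \<Sum>c\<in>Basis. rot_deriv b c (rot_deriv b c p) x) = - 2 * sphere_eigenvalue TYPE('a) l * p x"
  using casimir[of p l x] p by (simp add: harmonic_polynomials_def)

text \<open>Green's formula on the sphere: integration by parts and \<open>casimir\<close>.\<close>

lemma sum_rot_deriv_inner:
  fixes p q :: "'a::euclidean_space \<Rightarrow> real"
  assumes p: "p \<in> harmonic_polynomials l" and q: "real_polynomial_function q"
  shows "(\<Sum>b\<in>Basis. \<Sum>c\<in>Basis. sphere_inner (rot_deriv b c p) (rot_deriv b c q)) = 2 * sphere_eigenvalue TYPE('a) l * sphere_inner p q"
proof -
  have pp: "real_polynomial_function p" using p homogeneous_polynomial by (auto simp: harmonic_polynomials_def)
  have "(\<Sum>b\<in>Basis. \<Sum>c\<in>Basis. sphere_inner (rot_deriv b c p) (rot_deriv b c q)) = (\<Sum>b\<in>Basis. \<Sum>c\<in>Basis. - sphere_inner (rot_deriv b c (rot_deriv b c p)) q)"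
    by (intro sum.cong refl) (subst rot_deriv_skew_inner; auto intro: rot_deriv_polynomial pp q)
  also have "\<dots> = - (\<integral>x. (\<Sum>b\<in>Basis. \<Sum>c\<in>Basis. rot_deriv b c (rot_deriv b c p) x * q x) \<partial>sphere_measure)"
    unfolding sphere_inner_def sum_negf
    by (subst Bochner_Integration.integral_sum)
       (auto simp: Bochner_Integration.integral_sum integrable_poly polyI rot_deriv_polynomial pp q)
  also have "\<dots> = - (\<integral>x. (- 2 * sphere_eigenvalue TYPE('a) l) * (p x * q x) \<partial>sphere_measure)"
    by (intro arg_cong[of _ _ uminus] integral_sphere_cong)
       (simp add: sum_distrib_right[symmetric] casimir_sphere[OF p])
  also have "\<dots> = 2 * sphere_eigenvalue TYPE('a) l * sphere_inner p q"
    by (simp add: sphere_inner_def)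
  finally show ?thesis .
qed

lemma span_imageE:
  fixes f :: "'b \<Rightarrow> real"
  assumes "f \<in> span (g ` K)" "finite K"
  obtains c where "\<And>x. f x = (\<Sum>k\<in>K. c k * g k x)"
proof -
  have "\<exists>c. \<forall>x. f x = (\<Sum>k\<in>K. c k * g k x)"
    using assms(1)
  proof (induction rule: span_induct_fun)
    case base
    show ?case by (intro exI[of _ "\<lambda>_. 0"]) simp
  next
    case (step a f' f)
    then obtain k0 c where k0: "k0 \<in> K" "f' = g k0" and c: "\<And>x. f x = (\<Sum>k\<in>K. c k * g k x)" by auto
    have "a * f' x + f x = (\<Sum>k\<in>K. (c k + (if k = k0 then a else 0)) * g k x)" for x
      using k0 assms(2) by (simp add: c distrib_right sum.distrib if_distrib[of "\<lambda>t. t * _"] cong: if_cong)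
    then show ?case by (intro exI[of _ "\<lambda>k. c k + (if k = k0 then a else 0)"] allI)
  qed
  with that show ?thesis by blast
qed

lemma homogeneous_subset_upto: "l \<le> n \<Longrightarrow> homogeneous_polynomials l \<subseteq> polynomials_upto n"
  unfolding homogeneous_polynomials_def polynomials_upto_def by (intro span_mono) auto

lemma upto_polynomial: "p \<in> polynomials_upto n \<Longrightarrow> real_polynomial_function p"
  unfolding polynomials_upto_def by (rule span_polynomial)

lemma harmonic_homogeneous: "p \<in> harmonic_polynomials l \<Longrightarrow> p \<in> homogeneous_polynomials l"
  by (simp add: harmonic_polynomials_def)

lemma harmonic_sum:
  assumes "\<And>i. i \<in> I \<Longrightarrow> p i \<in> harmonic_polynomials l" "finite I"
  shows "(\<lambda>x. \<Sum>i\<in>I. c i * p i x) \<in> harmonic_polynomials l"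
proof -
  have "laplacian (\<lambda>x. \<Sum>i\<in>I. c i * p i x) x = 0" for x
    using assms(2,1)
  proof (induction I)
    case empty
    then show ?case by (simp add: laplacian_eq real_polynomial_function.intros(2) dir_deriv_const)
  next
    case (insert i I)
    have "real_polynomial_function (p j)" if "j = i \<or> j \<in> I" for j
      by (rule homogeneous_polynomial, rule harmonic_homogeneous, rule insert.prems) (use that in auto)
    then have "real_polynomial_function (\<lambda>x. c i * p i x)" "real_polynomial_function (\<lambda>x. \<Sum>i\<in>I. c i * p i x)"
      using insert.hyps by (auto intro!: polyI)
    then show ?case using insert homogeneous_polynomial[OF harmonic_homogeneous[of "p i" l]]
      by (simp add: laplacian_add laplacian_cmult harmonic_polynomials_def)
  qed
  then show ?thesis using assms by (auto simp: harmonic_polynomials_def intro!: homogeneous_sum homogeneous_cmult)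
qed

section \<open>Spherical harmonics\<close>

text \<open>All degrees of the orthonormal bases are indexed together by pairs \<open>(l, k)\<close> of a degree and a
  position, and the functions are represented by harmonic polynomials on the whole space, which can
  be differentiated.\<close>

locale harmonic_basis =
  fixes Y :: "nat \<Rightarrow> nat \<Rightarrow> 'a::euclidean_space \<Rightarrow> real"
  assumes dim2: "DIM('a) \<ge> 2"
    and ob: "\<And>l. orthonormal_basis (spherical_harmonics l) (Y l)"
begin

definition h :: "nat \<Rightarrow> nat" where "h l = dim (spherical_harmonics l :: ('a \<Rightarrow> real) set)"

definition lam :: "nat \<Rightarrow> real" where "lam l = sphere_eigenvalue TYPE('a) l"

definition harm_rep :: "nat \<Rightarrow> nat \<Rightarrow> 'a \<Rightarrow> real" where
  "harm_rep l k = (SOME p. p \<in> harmonic_polynomials l \<and> Y l k = on_sphere p)"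

definition level :: "nat \<Rightarrow> (nat \<times> nat) set" where "level m = {m} \<times> {1..h m}"

text \<open>The index set of the orthonormal basis of the polynomials of degree at most \<open>n\<close> on the sphere,
  see \<open>upto_expand\<close>.\<close>

definition I :: "nat \<Rightarrow> (nat \<times> nat) set" where "I n = (\<Union>m\<le>n. level m)"

text \<open>The number of points of the harmonic ensemble, by \<open>dim_sphere_polynomials\<close>.\<close>

definition npts :: "nat \<Rightarrow> real" where "npts n = real (card (I n))"

definition e :: "nat \<times> nat \<Rightarrow> 'a \<Rightarrow> real" where "e i = harm_rep (fst i) (snd i)"

definition valid :: "nat \<times> nat \<Rightarrow> bool" where "valid i \<longleftrightarrow> snd i \<in> {1..h (fst i)}"

lemma harm_rep_props:
  assumes "k \<in> {1..h l}"
  shows "harm_rep l k \<in> harmonic_polynomials l" "Y l k = on_sphere (harm_rep l k)"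
proof -
  have "Y l k \<in> spherical_harmonics l" using ob[of l] assms by (auto simp: orthonormal_basis_def h_def)
  then have "\<exists>p. p \<in> harmonic_polynomials l \<and> Y l k = on_sphere p" by (auto simp: spherical_harmonics_eq)
  from someI_ex[OF this] show "harm_rep l k \<in> harmonic_polynomials l" "Y l k = on_sphere (harm_rep l k)"
    by (auto simp: harm_rep_def)
qed

lemma Y_sphere: "k \<in> {1..h l} \<Longrightarrow> x \<in> sphere 0 1 \<Longrightarrow> Y l k x = harm_rep l k x"
  by (simp add: harm_rep_props on_sphere_def)

lemma e_harmonic: "valid i \<Longrightarrow> e i \<in> harmonic_polynomials (fst i)"
  by (simp add: valid_def e_def harm_rep_props)

lemma e_poly: "valid i \<Longrightarrow> real_polynomial_function (e i)"
  using e_harmonic harmonic_homogeneous homogeneous_polynomial by blast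

lemma e_level_poly: "i \<in> level l \<Longrightarrow> real_polynomial_function (e i)"
  using e_poly[of i] by (auto simp: level_def valid_def)

lemma e_I_poly: "i \<in> I n \<Longrightarrow> real_polynomial_function (e i)"
  unfolding I_def using e_level_poly by blast

lemma finite_level [simp]: "finite (level m)" by (simp add: level_def)

lemma finite_I [simp]: "finite (I n)" by (simp add: I_def)

lemma card_level: "card (level m) = h m" by (simp add: level_def card_cartesian_product)

lemma sum_I: "(\<Sum>i\<in>I n. f i) = (\<Sum>m\<le>n. \<Sum>i\<in>level m. f i)"
  unfolding I_def by (rule sum.UNION_disjoint) (auto simp: level_def)

lemma sum_level: "(\<Sum>i\<in>level m. f i) = (\<Sum>k=1..h m. f (m, k))"
  unfolding level_def using sum.cartesian_product[of "\<lambda>m k. f (m, k)" "{1..h m}" "{m}"] by simp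

lemma mem_level: "i \<in> level m \<longleftrightarrow> valid i \<and> fst i = m"
  by (cases i) (auto simp: level_def valid_def)

lemma mem_I: "i \<in> I n \<longleftrightarrow> valid i \<and> fst i \<le> n"
  by (auto simp: I_def mem_level)

lemma card_I: "card (I n) = (\<Sum>m\<le>n. h m)"
  using sum_I[of "\<lambda>_. 1::nat" n] by (simp add: card_level)

lemma cont_e: "valid i \<Longrightarrow> continuous_on S (e i)"
  by (intro continuous_on_poly e_poly)

lemma lam_inj: "lam l = lam m \<Longrightarrow> l = m"
proof -
  have "l < m \<Longrightarrow> lam l < lam m" for l m
    unfolding lam_def sphere_eigenvalue_def using dim2
    by (intro mult_strict_mono') auto
  then show "lam l = lam m \<Longrightarrow> l = m" by (metis less_irrefl linorder_neqE_nat)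
qed

text \<open>By Green's formula both eigenvalues multiply the same inner product, and they differ.\<close>

lemma harmonic_orthogonal_degrees:
  assumes p: "p \<in> harmonic_polynomials l" and q: "(q :: 'a \<Rightarrow> real) \<in> harmonic_polynomials m" and "l \<noteq> m"
  shows "sphere_inner p q = 0"
proof -
  have "real_polynomial_function p" "real_polynomial_function q"
    using p q homogeneous_polynomial harmonic_homogeneous by blast+
  then have "2 * lam l * sphere_inner p q = 2 * lam m * sphere_inner q p"
    using sum_rot_deriv_inner[OF p, of q] sum_rot_deriv_inner[OF q, of p]
    by (simp add: lam_def sphere_inner_commute)
  then show ?thesis using lam_inj[of l m] \<open>l \<noteq> m\<close> by (auto simp: sphere_inner_commute[of q])
qed

lemma sphere_inner_e:
  assumes "valid i" "valid j" shows "sphere_inner (e i) (e j) = (if i = j then 1 else 0)"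
proof (cases "fst i = fst j")
  case True
  let ?l = "fst i"
  have k: "snd i \<in> {1..h ?l}" "snd j \<in> {1..h ?l}" using assms True by (auto simp: valid_def)
  have "sphere_inner (e i) (e j) = sphere_inner (Y ?l (snd i)) (Y ?l (snd j))"
    using k True by (intro sphere_inner_cong) (auto simp: e_def Y_sphere)
  also have "\<dots> = (if snd i = snd j then 1 else 0)"
    using ob[of ?l] k by (simp add: orthonormal_basis_def h_def sphere_inner_def)
  finally show ?thesis using True by (auto simp: prod_eq_iff)
next
  case False
  then show ?thesis using harmonic_orthogonal_degrees[OF e_harmonic e_harmonic] assms by auto
qed

lemma harmonic_expand:
  assumes "p \<in> harmonic_polynomials l"
  obtains c where "\<And>x. x \<in> sphere 0 1 \<Longrightarrow> p x = (\<Sum>i\<in>level l. c i * e i x)"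
proof -
  have "on_sphere p \<in> span (Y l ` {1..h l})"
    using ob[of l] assms by (auto simp: orthonormal_basis_def h_def spherical_harmonics_eq)
  then obtain c where c: "\<And>x. on_sphere p x = (\<Sum>k=1..h l. c k * Y l k x)"
    by (rule span_imageE) auto
  have "p x = (\<Sum>i\<in>level l. c (snd i) * e i x)" if x: "x \<in> sphere 0 1" for x
    using c[of x] x by (simp add: sum_level on_sphere_def e_def Y_sphere)
  then show ?thesis by (rule that)
qed

text \<open>Every homogeneous polynomial is a combination of harmonic terms, and these reduce to harmonics of
  lower or equal degree on the sphere.\<close>

lemma upto_expand_ex:
  assumes "p \<in> polynomials_upto n"
  shows "\<exists>c. \<forall>x\<in>sphere 0 1. p x = (\<Sum>i\<in>I n. c i * e i x)"
proof -
  let ?E = "\<lambda>p. \<exists>c. \<forall>x\<in>sphere 0 1. p x = (\<Sum>i\<in>I n. c i * e i x)"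
  have comb: "?E (\<lambda>x. a * f x + g x)" if "?E f" "?E g" for a f g
  proof -
    from that(1) obtain c where c: "\<forall>x\<in>sphere 0 1. f x = (\<Sum>i\<in>I n. c i * e i x)" ..
    from that(2) obtain c' where c': "\<forall>x\<in>sphere 0 1. g x = (\<Sum>i\<in>I n. c' i * e i x)" ..
    have "a * f x + g x = (\<Sum>i\<in>I n. (a * c i + c' i) * e i x)" if x: "x \<in> sphere 0 1" for x
      unfolding bspec[OF c x] bspec[OF c' x]
      by (simp only: sum.distrib distrib_right sum_distrib_left mult.assoc)
    then show ?thesis by (intro exI[of _ "\<lambda>i. a * c i + c' i"] ballI)
  qed
  have z: "?E (\<lambda>x. 0)" by (intro exI[of _ "\<lambda>_. 0"]) simp
  have harm: "?E q" if q: "q \<in> harmonic_polynomials m" and m: "m \<le> n" for q m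
  proof -
    obtain c where c: "\<And>x. x \<in> sphere 0 1 \<Longrightarrow> q x = (\<Sum>i\<in>level m. c i * e i x)"
      using harmonic_expand[OF q] by metis
    have "q x = (\<Sum>i\<in>I n. (if fst i = m then c i else 0) * e i x)" if "x \<in> sphere 0 1" for x
    proof -
      have "(\<Sum>i\<in>I n. (if fst i = m then c i else 0) * e i x) = (\<Sum>i\<in>level m. c i * e i x)"
        by (rule sum.mono_neutral_cong_right) (use m in \<open>auto simp: mem_I mem_level\<close>)
      then show ?thesis using c that by simp
    qed
    then show ?thesis by (intro exI[of _ "\<lambda>i. if fst i = m then c i else 0"] ballI)
  qed
  have hom: "?E q" if q: "q \<in> homogeneous_polynomials m" and m: "m \<le> n" for q m
    using homogeneous_subset_harmonic_terms[OF q]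
  proof (induction rule: span_induct_fun)
    case base
    show ?case by (rule z)
  next
    case (step a f g)
    then obtain j r m' where r: "f = (\<lambda>x. (x \<bullet> x) ^ j * r x)" "r \<in> harmonic_polynomials m'" "2 * j + m' = m"
      by (auto simp: harmonic_terms_def)
    have "?E r" using r m by (intro harm[of r m']) auto
    then have "?E f" unfolding r(1) by (auto simp: norm_eq_1)
    then show ?case using step by (intro comb)
  qed
  show ?thesis
    using assms unfolding polynomials_upto_def
  proof (induction rule: span_induct_fun)
    case base
    show ?case by (rule z)
  next
    case (step a f g)
    then obtain \<alpha> where "f = monomial \<alpha>" "(\<Sum>b\<in>Basis. \<alpha> b) \<le> n" by auto
    then have "?E f" by (intro hom[of f "\<Sum>b\<in>Basis. \<alpha> b"]) (auto simp: homogeneous_polynomials_def intro!: span_base)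
    then show ?case using step by (intro comb)
  qed
qed

lemma sphere_inner_combination:
  assumes "finite A" "\<And>i. i \<in> A \<Longrightarrow> valid i" "valid j"
  shows "sphere_inner (\<lambda>x. \<Sum>i\<in>A. c i * e i x) (e j) = (if j \<in> A then c j else 0)"
proof -
  have "sphere_inner (\<lambda>x. \<Sum>i\<in>A. c i * e i x) (e j) = (\<Sum>i\<in>A. c i * sphere_inner (e i) (e j))"
    using assms by (intro sphere_inner_sum cont_e) auto
  also have "\<dots> = (\<Sum>i\<in>A. if i = j then c i else 0)"
    using assms by (intro sum.cong) (auto simp: sphere_inner_e)
  finally show ?thesis using assms by simp
qed

lemma upto_expand:
  assumes p: "p \<in> polynomials_upto n" and x: "x \<in> sphere 0 1"
  shows "p x = (\<Sum>i\<in>I n. sphere_inner p (e i) * e i x)"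
proof -
  obtain c where c: "\<And>x. x \<in> sphere 0 1 \<Longrightarrow> p x = (\<Sum>i\<in>I n. c i * e i x)"
    using upto_expand_ex[OF p] by auto
  have "sphere_inner p (e i) = c i" if "i \<in> I n" for i
  proof -
    have "sphere_inner p (e i) = sphere_inner (\<lambda>x. \<Sum>i\<in>I n. c i * e i x) (e i)"
      by (intro sphere_inner_cong c refl)
    then show ?thesis using that by (subst (asm) sphere_inner_combination) (auto simp: mem_I)
  qed
  then show ?thesis using c[OF x] by simp
qed

lemma upto_orthogonal:
  assumes p: "p \<in> polynomials_upto n" and j: "valid j" "fst j > n"
  shows "sphere_inner p (e j) = 0"
proof -
  have "sphere_inner p (e j) = sphere_inner (\<lambda>x. \<Sum>i\<in>I n. sphere_inner p (e i) * e i x) (e j)"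
    by (intro sphere_inner_cong upto_expand[OF p] refl)
  then show ?thesis using j by (subst (asm) sphere_inner_combination) (auto simp: mem_I)
qed

lemma parseval:
  assumes p: "p \<in> polynomials_upto n"
  shows "sphere_inner p p = (\<Sum>i\<in>I n. (sphere_inner p (e i))\<^sup>2)"
proof -
  have "sphere_inner p p = sphere_inner p (\<lambda>x. \<Sum>i\<in>I n. sphere_inner p (e i) * e i x)"
    by (intro sphere_inner_cong upto_expand[OF p] refl)
  also have "\<dots> = (\<Sum>i\<in>I n. (sphere_inner p (e i))\<^sup>2)"
    by (subst sphere_inner_sum_right)
       (simp_all add: power2_eq_square continuous_on_poly e_I_poly upto_polynomial[OF p])
  finally show ?thesis .
qed

text \<open>Substituting \<open>- x\<close> multiplies the integrand by \<open>-1\<close>.\<close>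

lemma sphere_inner_parity:
  assumes p: "p \<in> homogeneous_polynomials l" and j: "valid j" "odd (l + fst j)"
  shows "sphere_inner p (e j) = 0"
proof -
  have o: "orthogonal_transformation (\<lambda>x::'a. - x)" by (simp add: orthogonal_transformation_neg)
  have eh: "e j \<in> homogeneous_polynomials (fst j)" using e_harmonic[OF j(1)] by (rule harmonic_homogeneous)
  have "p (- x) * e j (- x) = - (p x * e j x)" for x
  proof -
    have "p (- x) * e j (- x) = (- 1) ^ (l + fst j) * (p x * e j x)"
      using homogeneous_scaleR[OF p, of "-1" x] homogeneous_scaleR[OF eh, of "-1" x]
      by (simp add: power_add)
    then show ?thesis using j by simp
  qed
  moreover have "(\<integral>x. p (- x) * e j (- x) \<partial>sphere_measure) = sphere_inner p (e j)"
    unfolding sphere_inner_def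
    by (rule integral_orthogonal[OF o]) (intro continuous_intros cont_e j continuous_on_poly homogeneous_polynomial[OF p])
  ultimately show ?thesis by (simp add: sphere_inner_def)
qed

lemma npts_nonneg [simp]: "npts n \<ge> 0" by (simp add: npts_def)

lemma dim_sphere_polynomials: "dim (sphere_polynomials n :: ('a \<Rightarrow> real) set) = card (I n)"
proof -
  define B where "B i = on_sphere (e i)" for i
  have Bx: "B i x = (if x \<in> sphere 0 1 then e i x else 0)" for i x by (simp add: B_def on_sphere_def)
  have ortho: "sphere_inner (B i) (B j) = (if i = j then 1 else 0)" if "i \<in> I n" "j \<in> I n" for i j
    using sphere_inner_e[of i j] that sphere_inner_cong[of "B i" "e i" "B j" "e j"]
    by (auto simp: mem_I Bx)
  have inj: "inj_on B (I n)"
    by (rule inj_onI) (metis ortho zero_neq_one)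
  show ?thesis
  proof (rule dim_unique)
    show "B ` I n \<subseteq> sphere_polynomials n"
    proof
      fix u assume "u \<in> B ` I n"
      then obtain i where i: "valid i" "fst i \<le> n" "u = on_sphere (e i)" by (auto simp: B_def mem_I)
      have "e i \<in> polynomials_upto n"
        using homogeneous_subset_upto[OF i(2)] harmonic_homogeneous[OF e_harmonic[OF i(1)]] by blast
      then show "u \<in> sphere_polynomials n" by (simp add: sphere_polynomials_def i(3))
    qed
    show "sphere_polynomials n \<subseteq> span (B ` I n)"
    proof
      fix f :: "'a \<Rightarrow> real" assume "f \<in> sphere_polynomials n"
      then obtain p where p: "p \<in> polynomials_upto n" "f = on_sphere p" by (auto simp: sphere_polynomials_def)
      have "f = (\<lambda>x. \<Sum>i\<in>I n. sphere_inner p (e i) * B i x)"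
        using upto_expand[OF p(1)] by (auto simp: p(2) Bx on_sphere_def)
      also have "\<dots> \<in> span (B ` I n)" by (intro span_sumI span_cmultI span_base) auto
      finally show "f \<in> span (B ` I n)" .
    qed
    show "independent (B ` I n)"
    proof (rule independent_if_scalars_zero)
      fix f u assume 0: "(\<Sum>u\<in>B ` I n. f u *\<^sub>R u) = 0" and "u \<in> B ` I n"
      then obtain j where j: "j \<in> I n" "u = B j" by auto
      have "(\<Sum>i\<in>I n. f (B i) *\<^sub>R B i) = 0" using 0 inj by (simp add: sum.reindex)
      note fz = fun_cong[OF this]
      have "(\<Sum>i\<in>A. f (B i) *\<^sub>R B i) x = (\<Sum>i\<in>A. f (B i) * B i x)" for A x
        by (induction A rule: infinite_finite_induct) auto
      then have Bsum: "(\<Sum>i\<in>I n. f (B i) * B i x) = 0" for x using fz[of x] by simp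
      have "(\<Sum>i\<in>I n. f (B i) * e i x) = 0" if "x \<in> sphere 0 1" for x
        unfolding Bsum[of x, symmetric] using that by (intro sum.cong refl) (simp add: Bx)
      then have "sphere_inner (\<lambda>x. \<Sum>i\<in>I n. f (B i) * e i x) (e j) = sphere_inner (\<lambda>x. 0) (e j)"
        by (intro sphere_inner_cong) auto
      then have "f (B j) = 0"
        using j by (subst (asm) sphere_inner_combination) (auto simp: mem_I sphere_inner_def)
      then show "f u = 0" using j by simp
    qed simp
    show "card (B ` I n) = card (I n)" using inj by (rule card_image)
  qed
qed

section \<open>The addition theorem\<close>

text \<open>The function \<open>F = \<Sum>\<^sub>i e\<^sub>i(x) e\<^sub>i\<close> satisfies \<open>F(x) = \<parallel>F\<parallel>\<^sup>2 = S(x)\<close>. Composed with a reflection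
  that takes \<open>z\<close> to \<open>x\<close> it is a harmonic \<open>G\<close> of the same degree and norm with
  \<open>G(z) = S(x)\<close>. Expanding \<open>G\<close> in the basis, Cauchy--Schwarz at \<open>z\<close> gives
  \<open>S(x)\<^sup>2 \<le> S(x) S(z)\<close>.\<close>

lemma addition_le:
  assumes x: "x \<in> sphere 0 1" and z: "z \<in> sphere 0 1"
  shows "(\<Sum>i\<in>level l. (e i x)\<^sup>2) \<le> (\<Sum>i\<in>level l. (e i z)\<^sup>2)"
proof -
  let ?S = "\<lambda>x. \<Sum>i\<in>level l. (e i x)\<^sup>2"
  define f where "f = reflection (z - x)"
  have f: "orthogonal_transformation f" "f z = x"
    using orthogonal_reflection reflection_transitive[OF z x] by (auto simp: f_def)
  define F where "F w = (\<Sum>i\<in>level l. e i x * e i w)" for w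
  have F: "F \<in> harmonic_polynomials l" unfolding F_def
    using e_harmonic by (intro harmonic_sum) (auto simp: mem_level)
  define G where "G w = F (f w)" for w
  have G: "G \<in> harmonic_polynomials l" unfolding G_def by (rule harmonic_orthogonal[OF f(1) F])
  obtain c where c: "\<And>w. w \<in> sphere 0 1 \<Longrightarrow> G w = (\<Sum>i\<in>level l. c i * e i w)"
    using harmonic_expand[OF G] by metis
  have sq: "sphere_inner (\<lambda>w. \<Sum>i\<in>level l. c i * e i w) (\<lambda>w. \<Sum>i\<in>level l. c i * e i w) = (\<Sum>i\<in>level l. (c i)\<^sup>2)" for c
  proof (subst sphere_inner_sum_right)
    show "continuous_on (sphere 0 1) (\<lambda>w. \<Sum>i\<in>level l. c i * e i w)"
      by (intro continuous_intros cont_e) (simp add: mem_level)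
    have "sphere_inner (\<lambda>w. \<Sum>i\<in>level l. c i * e i w) (e i) = c i" if "i \<in> level l" for i
      using that by (subst sphere_inner_combination) (auto simp: mem_level)
    then show "(\<Sum>i\<in>level l. c i * sphere_inner (\<lambda>w. \<Sum>i\<in>level l. c i * e i w) (e i)) = (\<Sum>i\<in>level l. (c i)\<^sup>2)"
      by (simp add: power2_eq_square)
  qed (simp add: continuous_on_poly e_level_poly)
  have pF: "real_polynomial_function F" using F homogeneous_polynomial harmonic_homogeneous by blast
  have "(\<Sum>i\<in>level l. (c i)\<^sup>2) = sphere_inner G G"
    unfolding sq[symmetric] by (intro sphere_inner_cong) (auto simp: c)
  also have "\<dots> = sphere_inner F F"
    unfolding sphere_inner_def G_def
    by (rule integral_orthogonal[OF f(1)]) (intro continuous_intros continuous_on_poly pF)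
  also have "\<dots> = ?S x" unfolding F_def by (rule sq)
  finally have cS: "(\<Sum>i\<in>level l. (c i)\<^sup>2) = ?S x" .
  have "?S x = G z" by (simp add: G_def F_def f power2_eq_square)
  then have "(?S x)\<^sup>2 = (\<Sum>i\<in>level l. c i * e i z)\<^sup>2" using c[OF z] by simp
  also have "\<dots> \<le> ?S x * ?S z" unfolding cS[symmetric] by (rule Cauchy_Schwarz_ineq_sum)
  finally have "?S x * ?S x \<le> ?S x * ?S z" by (simp add: power2_eq_square)
  moreover have "?S x \<ge> 0" "?S z \<ge> 0" by (auto intro: sum_nonneg)
  ultimately show ?thesis by (cases "?S x = 0") (auto simp: mult_le_cancel_left)
qed

text \<open>The sum is constant on the sphere, so it equals its integral.\<close>

lemma addition_theorem:
  assumes x: "x \<in> sphere 0 1"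
  shows "(\<Sum>i\<in>level l. (e i x)\<^sup>2) = real (h l)"
proof -
  let ?S = "\<lambda>x. \<Sum>i\<in>level l. (e i x)\<^sup>2"
  have "(\<integral>z. ?S z \<partial>sphere_measure) = (\<integral>z. (\<lambda>_::'a. ?S x) z \<partial>sphere_measure)"
    by (intro integral_sphere_cong antisym addition_le x)
  also have "\<dots> = ?S x" by (simp add: sphere.prob_space)
  also have "(\<integral>z. ?S z \<partial>sphere_measure) = (\<Sum>i\<in>level l. sphere_inner (e i) (e i))"
    unfolding sphere_inner_def power2_eq_square
    by (intro Bochner_Integration.integral_sum integrable_sphere continuous_intros cont_e) (auto simp: mem_level)
  also have "\<dots> = real (h l)" by (simp add: sphere_inner_e mem_level card_level)
  finally show ?thesis by simp
qed

lemma addition_theorem_I: "x \<in> sphere 0 1 \<Longrightarrow> (\<Sum>i\<in>I n. (e i x)\<^sup>2) = npts n"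
  by (simp add: npts_def sum_I addition_theorem card_I)

text \<open>Half the derivative of the constant in the addition theorem.\<close>

lemma level_rot_deriv_0:
  assumes x: "x \<in> sphere 0 1" and bc: "b \<in> Basis" "c \<in> Basis"
  shows "(\<Sum>i\<in>level l. e i x * rot_deriv b c (e i) x) = 0"
proof -
  have p: "real_polynomial_function (\<lambda>x. e i x * e i x)" if "i \<in> level l" for i
    using that by (intro polyI e_poly) (auto simp: mem_level)
  have "rot_deriv b c (\<lambda>x. \<Sum>i\<in>level l. e i x * e i x) x = rot_deriv b c (\<lambda>x. real (h l)) x"
  proof (intro rot_deriv_tangential x bc polyI finite_level e_level_poly)
    show "(\<Sum>i\<in>level l. e i z * e i z) = real (h l)" if "z \<in> sphere 0 1" for z
      using addition_theorem[OF that] by (simp add: power2_eq_square)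
  qed
  moreover have "rot_deriv b c (\<lambda>x. real (h l)) x = 0" by (simp add: rot_deriv_def dir_deriv_const)
  moreover have "rot_deriv b c (\<lambda>x. \<Sum>i\<in>level l. e i x * e i x) x = 2 * (\<Sum>i\<in>level l. e i x * rot_deriv b c (e i) x)"
    by (subst rot_deriv_sum[OF finite_level p])
       (simp_all add: rot_deriv_mult e_level_poly sum_distrib_left mult.commute)
  ultimately show ?thesis by simp
qed

text \<open>Differentiating \<open>level_rot_deriv_0\<close> once more expresses the squares of the first derivatives by
  second derivatives, which sum up to multiples of the \<open>e i\<close> by \<open>casimir\<close>.\<close>

lemma level_rot_deriv_square:
  assumes x: "x \<in> sphere 0 1"
  shows "(\<Sum>b\<in>Basis. \<Sum>c\<in>Basis. \<Sum>i\<in>level l. (rot_deriv b c (e i) x)\<^sup>2) = 2 * lam l * real (h l)"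
proof -
  have p: "real_polynomial_function (\<lambda>x. e i x * rot_deriv b c (e i) x)" if "i \<in> level l" for i b c
    using that by (intro polyI e_poly rot_deriv_polynomial) (auto simp: mem_level)
  have 1: "(\<Sum>i\<in>level l. (rot_deriv b c (e i) x)\<^sup>2) = - (\<Sum>i\<in>level l. e i x * rot_deriv b c (rot_deriv b c (e i)) x)"
    if bc: "b \<in> Basis" "c \<in> Basis" for b c
  proof -
    have "rot_deriv b c (\<lambda>x. \<Sum>i\<in>level l. e i x * rot_deriv b c (e i) x) x = rot_deriv b c (\<lambda>x. 0) x"
      by (intro rot_deriv_tangential x bc polyI finite_level p level_rot_deriv_0[OF _ bc])
    moreover have "rot_deriv b c (\<lambda>x. 0) x = 0" by (simp add: rot_deriv_def dir_deriv_const)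
    moreover have "rot_deriv b c (\<lambda>x. \<Sum>i\<in>level l. e i x * rot_deriv b c (e i) x) x =
      (\<Sum>i\<in>level l. (rot_deriv b c (e i) x)\<^sup>2) + (\<Sum>i\<in>level l. e i x * rot_deriv b c (rot_deriv b c (e i)) x)"
      by (subst rot_deriv_sum[OF finite_level p])
         (simp_all add: rot_deriv_mult e_level_poly rot_deriv_polynomial sum.distrib power2_eq_square)
    ultimately show ?thesis by simp
  qed
  have "(\<Sum>b\<in>Basis. \<Sum>c\<in>Basis. \<Sum>i\<in>level l. (rot_deriv b c (e i) x)\<^sup>2)
     = - (\<Sum>b\<in>Basis. \<Sum>c\<in>Basis. \<Sum>i\<in>level l. e i x * rot_deriv b c (rot_deriv b c (e i)) x)"
    by (simp add: 1 sum_negf)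
  also have "(\<Sum>b\<in>Basis. \<Sum>c\<in>Basis. \<Sum>i\<in>level l. e i x * rot_deriv b c (rot_deriv b c (e i)) x)
    = (\<Sum>b\<in>Basis. \<Sum>i\<in>level l. \<Sum>c\<in>Basis. e i x * rot_deriv b c (rot_deriv b c (e i)) x)"
    by (intro sum.cong refl sum.swap)
  also have "\<dots> = (\<Sum>i\<in>level l. \<Sum>b\<in>Basis. \<Sum>c\<in>Basis. e i x * rot_deriv b c (rot_deriv b c (e i)) x)"
    by (rule sum.swap)
  also have "\<dots> = (\<Sum>i\<in>level l. e i x * (- 2 * lam l * e i x))"
  proof (intro sum.cong refl)
    fix i assume "i \<in> level l"
    then have "e i \<in> harmonic_polynomials l" using e_harmonic[of i] by (auto simp: mem_level)
    from casimir_sphere[OF this x]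
    show "(\<Sum>b\<in>Basis. \<Sum>c\<in>Basis. e i x * rot_deriv b c (rot_deriv b c (e i)) x) = e i x * (- 2 * lam l * e i x)"
      by (simp flip: sum_distrib_left add: lam_def)
  qed
  also have "\<dots> = - 2 * lam l * (\<Sum>i\<in>level l. (e i x)\<^sup>2)"
    by (simp add: sum_distrib_left power2_eq_square algebra_simps)
  finally show ?thesis using addition_theorem[OF x] by simp
qed

section \<open>Coupling coefficients\<close>

text \<open>The matrix of multiplication by \<open>f\<close> in the basis \<open>e\<close>.\<close>

definition mult_coeff :: "('a \<Rightarrow> real) \<Rightarrow> nat \<times> nat \<Rightarrow> nat \<times> nat \<Rightarrow> real" where
  "mult_coeff f i j = sphere_inner (\<lambda>x. f x * e i x) (e j)"

text \<open>The strength with which multiplication by harmonics of degree \<open>l\<close> couples \<open>e i\<close> and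
  \<open>e j\<close>. Summing over a whole basis makes it accessible to the addition theorem.\<close>

definition coupling :: "nat \<Rightarrow> nat \<times> nat \<Rightarrow> nat \<times> nat \<Rightarrow> real" where
  "coupling l i j = (\<Sum>k\<in>level l. (mult_coeff (e k) i j)\<^sup>2)"

lemma coupling_nonneg: "coupling l i j \<ge> 0"
  by (simp add: coupling_def sum_nonneg)

lemma coupling_commute: "coupling l i j = coupling l j i"
  by (simp add: coupling_def mult_coeff_def sphere_inner_def mult_ac)

lemma e_upto: "valid i \<Longrightarrow> e i \<in> polynomials_upto (fst i)"
  using homogeneous_subset_upto[of "fst i" "fst i"] harmonic_homogeneous[OF e_harmonic, of i] by auto

lemma product_upto:
  assumes "k \<in> level l" "valid i" shows "(\<lambda>x. e k x * e i x) \<in> polynomials_upto (l + fst i)"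
  using polynomials_upto_mult[OF e_upto e_upto, of k i] assms by (simp add: mem_level)

lemma coupling_0:
  assumes "valid i" "valid j" "fst j > l + fst i"
  shows "coupling l i j = 0"
  unfolding coupling_def mult_coeff_def using upto_orthogonal[OF product_upto] assms by (simp add: mem_level)

lemma coupling_parity:
  assumes "valid i" "valid j" "odd (l + fst i + fst j)"
  shows "coupling l i j = 0"
proof -
  have "mult_coeff (e k) i j = 0" if "k \<in> level l" for k
    unfolding mult_coeff_def using homogeneous_mult[OF harmonic_homogeneous[OF e_harmonic] harmonic_homogeneous[OF e_harmonic], of k i] that assms
    by (intro sphere_inner_parity[where l="l + fst i"]) (auto simp: mem_level)
  then show ?thesis by (simp add: coupling_def)
qed

lemma upto_mono: "m \<le> n \<Longrightarrow> polynomials_upto m \<subseteq> polynomials_upto n"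
  unfolding polynomials_upto_def by (intro span_mono) auto

text \<open>Parseval for the products \<open>e k * e i\<close>, whose squares sum up to \<open>h l * (e i)\<^sup>2\<close>.\<close>

lemma coupling_mass:
  assumes i: "valid i" and n: "l + fst i \<le> n"
  shows "(\<Sum>j\<in>I n. coupling l i j) = real (h l)"
proof -
  have up: "(\<lambda>x. e k x * e i x) \<in> polynomials_upto n" if "k \<in> level l" for k
    using product_upto[OF that i] upto_mono[OF n] by auto
  have "(\<Sum>j\<in>I n. coupling l i j) = (\<Sum>k\<in>level l. \<Sum>j\<in>I n. (mult_coeff (e k) i j)\<^sup>2)"
    unfolding coupling_def by (rule sum.swap)
  also have "\<dots> = (\<Sum>k\<in>level l. sphere_inner (\<lambda>x. e k x * e i x) (\<lambda>x. e k x * e i x))"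
    unfolding mult_coeff_def by (intro sum.cong refl parseval[symmetric] up)
  also have "\<dots> = (\<integral>x. (\<Sum>k\<in>level l. (e k x * e i x) * (e k x * e i x)) \<partial>sphere_measure)"
    unfolding sphere_inner_def
    by (intro Bochner_Integration.integral_sum[symmetric] integrable_sphere continuous_intros cont_e) (use i in \<open>auto simp: mem_level\<close>)
  also have "\<dots> = (\<integral>x. real (h l) * (e i x * e i x) \<partial>sphere_measure)"
  proof (intro integral_sphere_cong)
    fix x :: 'a assume x: "x \<in> sphere 0 1"
    have "(\<Sum>k\<in>level l. (e k x * e i x) * (e k x * e i x)) = (\<Sum>k\<in>level l. (e k x)\<^sup>2) * (e i x * e i x)"
      unfolding sum_distrib_right by (intro sum.cong refl) (simp add: power2_eq_square)
    then show "(\<Sum>k\<in>level l. (e k x * e i x) * (e k x * e i x)) = real (h l) * (e i x * e i x)"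
      by (simp add: addition_theorem[OF x])
  qed
  also have "\<dots> = real (h l)" using sphere_inner_e[OF i i] by (simp add: sphere_inner_def)
  finally show ?thesis .
qed

text \<open>The Dirichlet energy of a polynomial (doubled) is diagonal in the basis of harmonics.\<close>

lemma rot_energy_expand:
  assumes p: "p \<in> polynomials_upto n"
  shows "(\<Sum>b\<in>Basis. \<Sum>c\<in>Basis. sphere_inner (rot_deriv b c p) (rot_deriv b c p))
    = 2 * (\<Sum>j\<in>I n. lam (fst j) * (sphere_inner p (e j))\<^sup>2)"
proof -
  have pp: "real_polynomial_function p" using p by (rule upto_polynomial)
  have "sphere_inner (rot_deriv b c p) (rot_deriv b c p) = (\<Sum>j\<in>I n. sphere_inner p (e j) * sphere_inner (rot_deriv b c (e j)) (rot_deriv b c p))"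
    if bc: "b \<in> Basis" "c \<in> Basis" for b c
  proof -
    have "sphere_inner (rot_deriv b c p) (rot_deriv b c p) = sphere_inner (\<lambda>x. \<Sum>j\<in>I n. sphere_inner p (e j) * rot_deriv b c (e j) x) (rot_deriv b c p)"
    proof (intro sphere_inner_cong refl)
      fix x :: 'a assume x: "x \<in> sphere 0 1"
      have P: "real_polynomial_function (\<lambda>x. sphere_inner p (e j) * e j x)" if "j \<in> I n" for j
        using that by (intro polyI e_I_poly)
      have "rot_deriv b c p x = rot_deriv b c (\<lambda>x. \<Sum>j\<in>I n. sphere_inner p (e j) * e j x) x"
        by (intro rot_deriv_tangential pp x bc upto_expand p polyI finite_I e_I_poly)
      also have "\<dots> = (\<Sum>j\<in>I n. sphere_inner p (e j) * rot_deriv b c (e j) x)"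
        using P by (subst rot_deriv_sum) (auto simp: rot_deriv_cmult e_poly mem_I)
      finally show "rot_deriv b c p x = (\<Sum>j\<in>I n. sphere_inner p (e j) * rot_deriv b c (e j) x)" .
    qed
    also have "\<dots> = (\<Sum>j\<in>I n. sphere_inner p (e j) * sphere_inner (rot_deriv b c (e j)) (rot_deriv b c p))"
      by (intro sphere_inner_sum continuous_on_poly rot_deriv_polynomial e_poly pp) (auto simp: mem_I)
    finally show ?thesis .
  qed
  then have "(\<Sum>b\<in>Basis. \<Sum>c\<in>Basis. sphere_inner (rot_deriv b c p) (rot_deriv b c p)) =
     (\<Sum>b\<in>Basis. \<Sum>c\<in>Basis. \<Sum>j\<in>I n. sphere_inner p (e j) * sphere_inner (rot_deriv b c (e j)) (rot_deriv b c p))"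
    by simp
  also have "\<dots> = (\<Sum>b\<in>Basis. \<Sum>j\<in>I n. \<Sum>c\<in>Basis. sphere_inner p (e j) * sphere_inner (rot_deriv b c (e j)) (rot_deriv b c p))"
    by (intro sum.cong refl sum.swap)
  also have "\<dots> = (\<Sum>j\<in>I n. \<Sum>b\<in>Basis. \<Sum>c\<in>Basis. sphere_inner p (e j) * sphere_inner (rot_deriv b c (e j)) (rot_deriv b c p))"
    by (rule sum.swap)
  also have "\<dots> = (\<Sum>j\<in>I n. sphere_inner p (e j) * (2 * lam (fst j) * sphere_inner (e j) p))"
    using sum_rot_deriv_inner[OF e_harmonic pp]
    by (intro sum.cong refl) (simp add: mem_I lam_def flip: sum_distrib_left)
  finally show ?thesis
    by (simp add: sphere_inner_commute[of _ p] sum_distrib_left power2_eq_square algebra_simps)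
qed

text \<open>The left-hand side is the total Dirichlet energy of the products \<open>e k * e i\<close>. In the product rule
  the mixed terms cancel after summation over \<open>k\<close> by \<open>level_rot_deriv_0\<close>, and the other two give
  \<open>h l * lam l\<close> and \<open>h l * lam (fst i)\<close>.\<close>

lemma coupling_energy:
  assumes i: "valid i" and n: "l + fst i \<le> n"
  shows "(\<Sum>j\<in>I n. lam (fst j) * coupling l i j) = real (h l) * (lam l + lam (fst i))"
proof -
  let ?D = "\<lambda>b c k. rot_deriv b c (\<lambda>x. e k x * e i x)"
  let ?A = "\<lambda>b c x. (\<Sum>k\<in>level l. (rot_deriv b c (e k) x)\<^sup>2) * (e i x)\<^sup>2"
  let ?B = "\<lambda>b c x. real (h l) * (rot_deriv b c (e i) x)\<^sup>2"
  have up: "(\<lambda>x. e k x * e i x) \<in> polynomials_upto n" if "k \<in> level l" for k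
    using product_upto[OF that i] upto_mono[OF n] by auto
  have pi: "real_polynomial_function (e i)" by (rule e_poly[OF i])
  have pk: "real_polynomial_function (e k)" if "k \<in> level l" for k using that by (intro e_poly) (simp add: mem_level)
  have "2 * (\<Sum>j\<in>I n. lam (fst j) * coupling l i j)
      = 2 * (\<Sum>j\<in>I n. \<Sum>k\<in>level l. lam (fst j) * (mult_coeff (e k) i j)\<^sup>2)"
    unfolding coupling_def by (simp add: sum_distrib_left)
  also have "\<dots> = (\<Sum>k\<in>level l. 2 * (\<Sum>j\<in>I n. lam (fst j) * (mult_coeff (e k) i j)\<^sup>2))"
    by (subst sum.swap) (simp add: sum_distrib_left)
  also have "\<dots> = (\<Sum>k\<in>level l. \<Sum>b\<in>Basis. \<Sum>c\<in>Basis. sphere_inner (?D b c k) (?D b c k))"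
    unfolding mult_coeff_def by (intro sum.cong refl rot_energy_expand[symmetric] up)
  also have "\<dots> = (\<Sum>b\<in>Basis. \<Sum>k\<in>level l. \<Sum>c\<in>Basis. sphere_inner (?D b c k) (?D b c k))"
    by (rule sum.swap)
  also have "\<dots> = (\<Sum>b\<in>Basis. \<Sum>c\<in>Basis. \<Sum>k\<in>level l. sphere_inner (?D b c k) (?D b c k))"
    by (intro sum.cong refl sum.swap)
  also have "\<dots> = (\<Sum>b\<in>Basis. \<Sum>c\<in>Basis. \<integral>x. ?A b c x + ?B b c x \<partial>sphere_measure)"
  proof (intro sum.cong refl)
    fix b c :: 'a assume bc: "b \<in> Basis" "c \<in> Basis"
    have "(\<Sum>k\<in>level l. sphere_inner (?D b c k) (?D b c k))
      = (\<integral>x. (\<Sum>k\<in>level l. ?D b c k x * ?D b c k x) \<partial>sphere_measure)"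
      unfolding sphere_inner_def
      by (intro Bochner_Integration.integral_sum[symmetric] integrable_poly polyI rot_deriv_polynomial pk pi)
    also have "\<dots> = (\<integral>x. ?A b c x + ?B b c x \<partial>sphere_measure)"
    proof (intro integral_sphere_cong)
      fix x :: 'a assume x: "x \<in> sphere 0 1"
      have "(\<Sum>k\<in>level l. ?D b c k x * ?D b c k x)
        = (\<Sum>k\<in>level l. (rot_deriv b c (e k) x)\<^sup>2 * (e i x)\<^sup>2 + 2 * e i x * rot_deriv b c (e i) x * (e k x * rot_deriv b c (e k) x) + (e k x)\<^sup>2 * (rot_deriv b c (e i) x)\<^sup>2)"
        by (intro sum.cong refl) (simp add: rot_deriv_mult pk pi power2_eq_square algebra_simps)
      also have "\<dots> = ?A b c x + 2 * e i x * rot_deriv b c (e i) x * (\<Sum>k\<in>level l. e k x * rot_deriv b c (e k) x) + (\<Sum>k\<in>level l. (e k x)\<^sup>2) * (rot_deriv b c (e i) x)\<^sup>2"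
        by (simp add: sum.distrib sum_distrib_left sum_distrib_right)
      finally show "(\<Sum>k\<in>level l. ?D b c k x * ?D b c k x) = ?A b c x + ?B b c x"
        by (simp add: addition_theorem[OF x] level_rot_deriv_0[OF x bc])
    qed
    finally show "(\<Sum>k\<in>level l. sphere_inner (?D b c k) (?D b c k))
      = (\<integral>x. ?A b c x + ?B b c x \<partial>sphere_measure)" .
  qed
  also have "\<dots> = (\<Sum>b\<in>Basis. \<Sum>c\<in>Basis. (\<integral>x. ?A b c x \<partial>sphere_measure) + real (h l) * sphere_inner (rot_deriv b c (e i)) (rot_deriv b c (e i)))"
  proof (intro sum.cong refl)
    fix b c :: 'a
    have "(\<integral>x. ?A b c x + ?B b c x \<partial>sphere_measure)
       = (\<integral>x. ?A b c x \<partial>sphere_measure) + (\<integral>x. ?B b c x \<partial>sphere_measure)"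
      by (intro Bochner_Integration.integral_add integrable_poly polyI rot_deriv_polynomial pk pi real_polynomial_function_power) auto
    then show "(\<integral>x. ?A b c x + ?B b c x \<partial>sphere_measure)
       = (\<integral>x. ?A b c x \<partial>sphere_measure) + real (h l) * sphere_inner (rot_deriv b c (e i)) (rot_deriv b c (e i))"
      by (simp add: sphere_inner_def power2_eq_square)
  qed
  also have "\<dots> = (\<integral>x. (\<Sum>b\<in>Basis. \<Sum>c\<in>Basis. ?A b c x) \<partial>sphere_measure) + real (h l) * (\<Sum>b\<in>Basis. \<Sum>c\<in>Basis. sphere_inner (rot_deriv b c (e i)) (rot_deriv b c (e i)))"
  proof -
    have P: "real_polynomial_function (\<lambda>x. ?A b c x)" for b c
      by (intro polyI rot_deriv_polynomial pk pi real_polynomial_function_power) auto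
    have "(\<Sum>b\<in>Basis. \<Sum>c\<in>Basis. \<integral>x. ?A b c x \<partial>sphere_measure)
      = (\<integral>x. (\<Sum>b\<in>Basis. \<Sum>c\<in>Basis. ?A b c x) \<partial>sphere_measure)"
      by (subst Bochner_Integration.integral_sum)
         (auto intro!: integrable_poly polyI P Bochner_Integration.integral_sum[symmetric] sum.cong)
    then show ?thesis by (simp add: sum.distrib sum_distrib_left)
  qed
  also have "(\<integral>x. (\<Sum>b\<in>Basis. \<Sum>c\<in>Basis. ?A b c x) \<partial>sphere_measure)
     = (\<integral>x. 2 * lam l * real (h l) * (e i x * e i x) \<partial>sphere_measure)"
    by (intro integral_sphere_cong)
       (simp add: level_rot_deriv_square power2_eq_square[of "e i _"] flip: sum_distrib_right)
  also have "\<dots> = 2 * lam l * real (h l)"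
    using sphere_inner_e[OF i i] by (simp add: sphere_inner_def)
  also have "(\<Sum>b\<in>Basis. \<Sum>c\<in>Basis. sphere_inner (rot_deriv b c (e i)) (rot_deriv b c (e i))) = 2 * lam (fst i)"
    using sum_rot_deriv_inner[OF e_harmonic[OF i] pi] sphere_inner_e[OF i i] by (simp add: lam_def)
  finally show ?thesis by (simp add: algebra_simps)
qed

text \<open>On average, multiplication by a harmonic of degree \<open>l\<close> raises the eigenvalue by exactly
  \<open>lam l\<close>, whatever it was before.\<close>

lemma coupling_drift:
  assumes i: "valid i" and n: "l + fst i \<le> n"
  shows "(\<Sum>j\<in>I n. (lam (fst j) - lam (fst i)) * coupling l i j) = real (h l) * lam l"
  using coupling_mass[OF assms] coupling_energy[OF assms]
  by (simp add: left_diff_distrib sum_subtractf algebra_simps flip: sum_distrib_left)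

end

context harmonic_basis begin

section \<open>Leakage of multiplication operators\<close>

text \<open>The part of multiplication by degree \<open>l\<close> that leads out of the polynomials of degree at most
  \<open>L\<close>; degrees above \<open>L + l\<close> are not reached. It will turn out to be the total variance of the linear
  statistics of degree \<open>l\<close> of the harmonic ensemble.\<close>

definition leakage :: "nat \<Rightarrow> nat \<Rightarrow> real" where
  "leakage l L = (\<Sum>i\<in>I L. \<Sum>j\<in>I (L + l) - I L. coupling l i j)"

lemma I_mono: "m \<le> n \<Longrightarrow> I m \<subseteq> I n"
  by (auto simp: mem_I)

lemma leakage_nonneg: "leakage l L \<ge> 0"
  unfolding leakage_def by (intro sum_nonneg coupling_nonneg)

text \<open>Only basis functions whose degree is within \<open>l\<close> of \<open>L\<close> can be moved beyond \<open>L\<close>, and each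
  of them has total coupling \<open>h l\<close>.\<close>

lemma leakage_upper: "leakage l L \<le> real (h l) * real (\<Sum>m\<in>{m. m \<le> L \<and> L < m + l}. h m)"
proof -
  have "(\<Sum>j\<in>I (L + l) - I L. coupling l i j) \<le> (if L < fst i + l then real (h l) else 0)" if i: "i \<in> I L" for i
  proof (cases "L < fst i + l")
    case True
    have "(\<Sum>j\<in>I (L + l) - I L. coupling l i j) \<le> (\<Sum>j\<in>I (L + l). coupling l i j)"
      by (intro sum_mono2) (auto simp: coupling_nonneg)
    also have "\<dots> = real (h l)" using i by (intro coupling_mass) (auto simp: mem_I)
    finally show ?thesis using True by simp
  next
    case False
    then have "(\<Sum>j\<in>I (L + l) - I L. coupling l i j) = 0"
      using i by (intro sum.neutral ballI coupling_0) (auto simp: mem_I)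
    then show ?thesis using False by simp
  qed
  then have "leakage l L \<le> (\<Sum>i\<in>I L. if L < fst i + l then real (h l) else 0)"
    unfolding leakage_def by (intro sum_mono)
  also have "\<dots> = (\<Sum>m\<le>L. \<Sum>i\<in>level m. if L < m + l then real (h l) else 0)"
    unfolding sum_I by (intro sum.cong refl) (auto simp: mem_level)
  also have "\<dots> = (\<Sum>m\<le>L. if L < m + l then real (h l) * real (h m) else 0)"
    by (intro sum.cong refl) (simp add: card_level)
  also have "\<dots> = (\<Sum>m\<in>{m. m \<le> L \<and> L < m + l}. real (h l) * real (h m))"
    by (simp add: sum.If_cases) (intro sum.cong, auto)
  finally show ?thesis by (simp add: sum_distrib_left)
qed

lemma lam_diff: "lam m - lam n = (real m - real n) * (real m + real n + real DIM('a) - 2)"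
  by (simp add: lam_def sphere_eigenvalue_def algebra_simps)

text \<open>Summed over all \<open>i \<in> I L\<close>, the drift identity has only terms with \<open>j\<close> above \<open>L\<close>, because
  those with both indices in \<open>I L\<close> are antisymmetric. A coupled pair across \<open>L\<close> differs by at most
  \<open>l\<close> in degree, which bounds the difference of the eigenvalues.\<close>

lemma leakage_lower:
  "real (h l) * lam l * npts L \<le> leakage l L * (real l * (2 * real L + real l + real DIM('a) - 2))"
proof -
  let ?R = "I (L + l) - I L"
  let ?f = "\<lambda>i j. (lam (fst j) - lam (fst i)) * coupling l i j"
  let ?B = "real l * (2 * real L + real l + real DIM('a) - 2)"
  \<comment> \<open>Exchanging \<open>i\<close> and \<open>j\<close> changes the sign and keeps the set of pairs.\<close>
  have anti: "(\<Sum>i\<in>I L. \<Sum>j\<in>I L. ?f i j) = 0"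
  proof -
    have "(\<Sum>i\<in>I L. \<Sum>j\<in>I L. ?f i j) = (\<Sum>i\<in>I L. \<Sum>j\<in>I L. ?f j i)" by (rule sum.swap)
    also have "\<dots> = - (\<Sum>i\<in>I L. \<Sum>j\<in>I L. ?f i j)"
      by (simp add: coupling_commute[of l] sum_negf[symmetric] algebra_simps)
    finally show ?thesis by simp
  qed
  have "real (h l) * lam l * npts L = (\<Sum>i\<in>I L. \<Sum>j\<in>I (L + l). ?f i j)"
    by (subst sum.cong[OF refl coupling_drift]) (auto simp: mem_I npts_def)
  also have "\<dots> = (\<Sum>i\<in>I L. (\<Sum>j\<in>?R. ?f i j) + (\<Sum>j\<in>I L. ?f i j))"
    by (intro sum.cong refl sum.subset_diff I_mono) auto
  also have "\<dots> = (\<Sum>i\<in>I L. \<Sum>j\<in>?R. ?f i j)" by (simp only: sum.distrib anti)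
  also have "\<dots> \<le> (\<Sum>i\<in>I L. \<Sum>j\<in>?R. ?B * coupling l i j)"
  proof (intro sum_mono)
    fix i j assume i: "i \<in> I L" and j: "j \<in> ?R"
    have v: "valid i" "valid j" "fst i \<le> L" "fst j > L" using i j by (auto simp: mem_I)
    show "?f i j \<le> ?B * coupling l i j"
    proof (cases "fst j > l + fst i")
      case True
      then show ?thesis using coupling_0[OF v(1,2)] by simp
    next
      case False
      have "lam (fst j) - lam (fst i) \<le> ?B"
        unfolding lam_diff using v False dim2 by (intro mult_mono) auto
      then show ?thesis by (intro mult_right_mono coupling_nonneg)
    qed
  qed
  also have "\<dots> = leakage l L * ?B"
    by (simp add: leakage_def sum_distrib_right sum_distrib_left mult.commute)
  finally show ?thesis .
qed

section \<open>Dimensions\<close>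

text \<open>Multiplication by linear functions moves degrees by exactly one: higher changes are excluded by the
  degree, no change by parity. The mass and drift identities are then two linear equations for the
  two neighbouring couplings, and they determine the dimensions recursively.\<close>

definition flow :: "nat \<Rightarrow> nat \<Rightarrow> real" where
  "flow m n = (\<Sum>i\<in>level m. \<Sum>j\<in>level n. coupling 1 i j)"

lemma flow_commute: "flow m n = flow n m"
  unfolding flow_def by (subst sum.swap) (simp add: coupling_commute)

lemma flow_0:
  assumes "n \<noteq> Suc m" "m \<noteq> Suc n" shows "flow m n = 0"
  unfolding flow_def
proof (intro sum.neutral ballI)
  fix i j assume i: "i \<in> level m" and j: "j \<in> level n"
  consider "n > Suc m" | "m > Suc n" | "n = m" using assms by linarith
  then show "coupling 1 i j = 0"
  proof cases
    case 1
    then show ?thesis using i j by (intro coupling_0) (auto simp: mem_level)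
  next
    case 2
    then show ?thesis using i j by (subst coupling_commute, intro coupling_0) (auto simp: mem_level)
  next
    case 3
    then show ?thesis using i j by (intro coupling_parity) (auto simp: mem_level)
  qed
qed

lemma flow_mass: "(\<Sum>n\<le>Suc m. flow m n) = real (h 1) * real (h m)"
proof -
  have "(\<Sum>n\<le>Suc m. flow m n) = (\<Sum>i\<in>level m. \<Sum>j\<in>I (Suc m). coupling 1 i j)"
    unfolding flow_def sum_I by (rule sum.swap)
  also have "\<dots> = (\<Sum>i\<in>level m. real (h 1))"
    by (intro sum.cong refl coupling_mass) (auto simp: mem_level)
  finally show ?thesis by (simp add: card_level)
qed

lemma flow_drift: "(\<Sum>n\<le>Suc m. (lam n - lam m) * flow m n) = real (h 1) * lam 1 * real (h m)"
proof -
  have "(\<Sum>n\<le>Suc m. (lam n - lam m) * flow m n) = (\<Sum>n\<le>Suc m. \<Sum>i\<in>level m. \<Sum>j\<in>level n. (lam (fst j) - lam (fst i)) * coupling 1 i j)"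
    unfolding flow_def sum_distrib_left by (intro sum.cong refl) (simp add: mem_level)
  also have "\<dots> = (\<Sum>i\<in>level m. \<Sum>j\<in>I (Suc m). (lam (fst j) - lam (fst i)) * coupling 1 i j)"
    unfolding sum_I by (rule sum.swap)
  also have "\<dots> = (\<Sum>i\<in>level m. real (h 1) * lam 1)"
    by (intro sum.cong refl coupling_drift) (auto simp: mem_level)
  finally show ?thesis by (simp add: card_level)
qed

lemma flow_rec:
  "real (Suc m) * flow (Suc m) (Suc (Suc m)) = (real m + real DIM('a) - 1) * flow m (Suc m)"
  and flow_h: "flow (Suc m) (Suc (Suc m)) + flow m (Suc m) = real (h 1) * real (h (Suc m))"
proof -
  let ?A = "flow (Suc m) (Suc (Suc m))" and ?B = "flow m (Suc m)"
  have split: "(\<Sum>n\<le>Suc (Suc m). g n * flow (Suc m) n) = g (Suc (Suc m)) * ?A + g m * ?B" for g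
  proof -
    have "(\<Sum>n\<le>Suc (Suc m). g n * flow (Suc m) n) = (\<Sum>n\<in>{Suc (Suc m), m}. g n * flow (Suc m) n)"
      by (rule sum.mono_neutral_right) (auto simp: flow_0)
    then show ?thesis by (simp add: flow_commute[of "Suc m" m])
  qed
  show 1: "?A + ?B = real (h 1) * real (h (Suc m))"
    using split[of "\<lambda>_. 1"] flow_mass[of "Suc m"] by simp
  have L: "lam 1 = real DIM('a) - 1" by (simp add: lam_def sphere_eigenvalue_def)
  have "(lam (Suc (Suc m)) - lam (Suc m)) * ?A + (lam m - lam (Suc m)) * ?B = lam 1 * (?A + ?B)"
    using split[of "\<lambda>n. lam n - lam (Suc m)"] flow_drift[of "Suc m"] 1 by (simp add: mult_ac)
  then have "(2 * real m + 1 + real DIM('a) + 1 - 1) * ?A - (2 * real m + real DIM('a) - 1) * ?B = (real DIM('a) - 1) * (?A + ?B)"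
    unfolding lam_diff L by (simp add: algebra_simps)
  then show "real (Suc m) * ?A = (real m + real DIM('a) - 1) * ?B"
    by (simp add: algebra_simps)
qed

lemma flow_binomial:
  assumes d: "DIM('a) = Suc (Suc d)"
  shows "flow m (Suc m) = flow 0 1 * real ((m + d) choose m)"
proof (induction m)
  case 0
  then show ?case by simp
next
  case (Suc m)
  have "real (Suc m) * flow (Suc m) (Suc (Suc m)) = real (Suc (m + d)) * (flow 0 1 * real ((m + d) choose m))"
  proof -
    have "real m + real DIM('a) - 1 = real (Suc (m + d))" by (simp add: d)
    then show ?thesis using flow_rec[of m] Suc by (simp only:)
  qed
  also have "\<dots> = flow 0 1 * real (Suc (m + d) * ((m + d) choose m))"
    by (simp only: of_nat_mult mult_ac)
  also have "Suc (m + d) * ((m + d) choose m) = (Suc (m + d) choose Suc m) * Suc m"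
    by (rule Suc_times_binomial_eq)
  also have "flow 0 1 * real ((Suc (m + d) choose Suc m) * Suc m) = real (Suc m) * (flow 0 1 * real ((Suc m + d) choose Suc m))"
    by (simp only: of_nat_mult mult_ac add_Suc)
  finally show ?case by (simp del: of_nat_Suc)
qed

lemma h_pos:
  fixes p :: "'a \<Rightarrow> real"
  assumes p: "p \<in> harmonic_polynomials l" and x: "x \<in> sphere 0 1" "p x \<noteq> 0"
  shows "h l > 0"
proof (rule ccontr)
  assume "\<not> h l > 0"
  then have "level l = {}" by (simp add: level_def)
  moreover obtain c where "p x = (\<Sum>i\<in>level l. c i * e i x)" using harmonic_expand[OF p] x(1) by metis
  ultimately show False using x by simp
qed

lemma const_harmonic: "(\<lambda>x::'a. c) \<in> harmonic_polynomials 0"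
  by (simp add: harmonic_polynomials_def homogeneous_const laplacian_eq real_polynomial_function.intros(2) dir_deriv_const)

lemma h0_pos: "h 0 > 0"
proof -
  obtain b :: 'a where b: "b \<in> Basis" using SOME_Basis by blast
  show ?thesis by (rule h_pos[OF const_harmonic[of 1], of b]) (use b in auto)
qed

lemma npts_pos: "npts L > 0"
proof -
  have "h 0 \<le> (\<Sum>m\<le>L. h m)" by (intro member_le_sum) auto
  then have "0 < (\<Sum>m\<le>L. h m)" using h0_pos by linarith
  then show ?thesis unfolding npts_def card_I of_nat_0_less_iff .
qed

lemma h1_pos: "h 1 > 0"
proof -
  obtain b :: 'a where b: "b \<in> Basis" using SOME_Basis by blast
  have "(\<lambda>x. x \<bullet> b) \<in> harmonic_polynomials 1"
    using homogeneous_inner[OF b]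
    by (simp add: harmonic_polynomials_def laplacian_eq real_polynomial_function_inner dir_deriv_inner dir_deriv_const)
  then show ?thesis by (rule h_pos[of _ _ b]) (use b in auto)
qed

text \<open>The sum of the two neighbouring flows of degree \<open>Suc m\<close>, each a binomial coefficient times the
  initial value \<open>flow 0 1\<close> of the recursion.\<close>

lemma h_binomial:
  assumes d: "DIM('a) = Suc (Suc d)"
  shows "h (Suc m) = h 0 * (((m + d) choose m) + ((Suc m + d) choose Suc m))"
proof -
  have "flow 0 1 = real (h 1) * real (h 0)"
    using flow_mass[of 0] flow_0[of 0 0] by (simp add: atMost_Suc)
  then have "real (h 1) * real (h (Suc m)) = real (h 1) * (real (h 0) * (real ((m + d) choose m) + real ((Suc m + d) choose Suc m)))"
    using flow_h[of m] flow_binomial[OF d, of m] flow_binomial[OF d, of "Suc m"]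
    by (simp add: algebra_simps)
  then have "real (h (Suc m)) = real (h 0) * (real ((m + d) choose m) + real ((Suc m + d) choose Suc m))"
    using h1_pos by simp
  then have "real (h (Suc m)) = real (h 0 * (((m + d) choose m) + ((Suc m + d) choose Suc m)))"
    by simp
  then show ?thesis by (simp only: of_nat_eq_iff)
qed

lemma h_bounds:
  assumes d: "DIM('a) = Suc (Suc d)"
  obtains c C where "c > 0" "C > 0" "\<And>m. c * real (Suc m) ^ d \<le> real (h m)" "\<And>m. real (h m) \<le> C * real (Suc m) ^ d"
proof
  define c where "c = real (h 0) / (1 + real d) ^ d"
  define C where "C = real (h 0) * (2 * (1 + real d) ^ d)"
  have h0: "real (h 0) \<ge> 1" using h0_pos by simp
  show "c > 0" "C > 0" using h0_pos by (auto simp: c_def C_def)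
  have up: "real ((m + d) choose m) \<le> (1 + real d) ^ d * real (Suc m) ^ d" for m
  proof -
    have "(m + d) choose m = (m + d) choose d" by (simp add: binomial_symmetric[of d "m + d"])
    also have "\<dots> \<le> (m + d) ^ d" by (rule binomial_le_pow) simp
    finally have "real ((m + d) choose m) \<le> real ((m + d) ^ d)" by (simp only: of_nat_le_iff)
    also have "real ((m + d) ^ d) = real (m + d) ^ d" by (rule of_nat_power)
    also have "\<dots> \<le> ((1 + real d) * real (Suc m)) ^ d"
      by (intro power_mono) (auto simp: algebra_simps)
    finally show ?thesis by (simp add: power_mult_distrib)
  qed
  have lo: "real (Suc m) ^ d \<le> (1 + real d) ^ d * real ((m + d) choose m)" for m
  proof (cases "d = 0")
    case False
    have "(real (m + d) / real d) ^ d \<le> real ((m + d) choose d)"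
      by (rule binomial_ge_n_over_k_pow_k) simp
    then have "real (m + d) ^ d \<le> real d ^ d * real ((m + d) choose d)"
      using False by (simp add: power_divide field_simps)
    also have "\<dots> \<le> (1 + real d) ^ d * real ((m + d) choose d)"
      by (intro mult_right_mono power_mono) auto
    also have "(m + d) choose d = (m + d) choose m" by (simp add: binomial_symmetric[of d "m + d"])
    finally have "real (m + d) ^ d \<le> (1 + real d) ^ d * real ((m + d) choose m)" .
    moreover have "real (Suc m) ^ d \<le> real (m + d) ^ d" using False by (intro power_mono) auto
    ultimately show ?thesis by (rule order_trans[rotated])
  qed simp
  show "c * real (Suc m) ^ d \<le> real (h m)" for m
  proof -
    have "real (h 0) * real ((m + d) choose m) \<le> real (h m)"
    proof (cases m)
      case (Suc n)
      show ?thesis unfolding Suc h_binomial[OF d] by (simp add: algebra_simps)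
    qed simp
    then have le: "real (h 0) * real ((m + d) choose m) * (1 + real d) ^ d \<le> real (h m) * (1 + real d) ^ d"
      by (rule mult_right_mono) simp
    have "c * real (Suc m) ^ d * (1 + real d) ^ d = real (h 0) * real (Suc m) ^ d"
      by (simp add: c_def)
    also have "\<dots> \<le> real (h 0) * ((1 + real d) ^ d * real ((m + d) choose m))"
      by (intro mult_left_mono lo) auto
    also have "\<dots> = real (h 0) * real ((m + d) choose m) * (1 + real d) ^ d" by (simp only: mult_ac)
    also note le
    finally show ?thesis by (rule mult_right_le_imp_le) simp
  qed
  show "real (h m) \<le> C * real (Suc m) ^ d" for m
  proof (cases m)
    case 0
    have "real (h 0) * 1 \<le> real (h 0) * (2 * (1 + real d) ^ d)"
    proof (rule mult_left_mono)
      have "1 \<le> (1 + real d) ^ d" by (rule one_le_power) simp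
      then show "1 \<le> 2 * (1 + real d) ^ d" by linarith
    qed simp
    then show ?thesis by (simp add: 0 C_def)
  next
    case (Suc n)
    have "real ((n + d) choose n) \<le> (1 + real d) ^ d * real (Suc m) ^ d"
      using up[of n] by (rule order_trans) (auto intro!: mult_left_mono power_mono simp: Suc)
    with up[of m] have "real ((n + d) choose n) + real ((Suc n + d) choose Suc n) \<le> 2 * (1 + real d) ^ d * real (Suc m) ^ d"
      by (simp add: Suc)
    from mult_left_mono[OF this, of "real (h 0)"] show ?thesis
      unfolding Suc h_binomial[OF d] C_def by (simp add: mult_ac)
  qed
qed

end

section \<open>Second moments of linear statistics\<close>

lemma sphere_point_process_finite:
  assumes "sphere_point_process M X" "\<omega> \<in> space M"
  shows "finite (X \<omega>)" "X \<omega> \<subseteq> sphere 0 1"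
  using assms by (auto simp: sphere_point_process_def)

lemma sphere_point_process_card_measurable:
  assumes "sphere_point_process M X" "A \<in> sets sphere_measure"
  shows "(\<lambda>\<omega>. real (card (X \<omega> \<inter> A))) \<in> borel_measurable M"
  using assms by (auto simp: sphere_point_process_def intro: measurable_compose)

lemma linear_statistic_measurable:
  fixes g :: "'a::euclidean_space \<Rightarrow> ennreal"
  assumes X: "sphere_point_process M X" and g: "g \<in> borel_measurable sphere_measure"
  shows "(\<lambda>\<omega>. \<Sum>x\<in>X \<omega>. g x) \<in> borel_measurable M"
  using g
proof (induction rule: borel_measurable_induct)
  case (cong f g)
  have "(\<Sum>x\<in>X \<omega>. f x) = (\<Sum>x\<in>X \<omega>. g x)" if "\<omega> \<in> space M" for \<omega>
    using sphere_point_process_finite[OF X that] cong(3) by (intro sum.cong) (auto simp: space_sphere_measure)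
  then show ?case using cong(4) by (simp cong: measurable_cong)
next
  case (set A)
  have "(\<Sum>x\<in>X \<omega>. indicator A x) = ennreal (real (card (X \<omega> \<inter> A)))" if "\<omega> \<in> space M" for \<omega>
    using sphere_point_process_finite[OF X that]
    by (simp add: ennreal_of_nat_eq_real_of_nat indicator_def of_bool_def sum.If_cases)
  moreover have "(\<lambda>\<omega>. ennreal (real (card (X \<omega> \<inter> A)))) \<in> borel_measurable M"
    using sphere_point_process_card_measurable[OF X set] by measurable
  ultimately show ?case by (simp cong: measurable_cong)
next
  case (mult u c)
  then show ?case by (simp flip: sum_distrib_left)
next
  case (add u v)
  then show ?case by (simp add: sum.distrib)
next
  case (seq U)
  have "(\<Sum>x\<in>X \<omega>. (SUP i. U i) x) = (SUP i. \<Sum>x\<in>X \<omega>. U i x)" if "\<omega> \<in> space M" for \<omega>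
  proof -
    have "incseq (\<lambda>i. U i x)" for x using seq.hyps(3) by (auto simp: incseq_def le_fun_def)
    then have "(\<Sum>x\<in>X \<omega>. SUP i. U i x) = (SUP i. \<Sum>x\<in>X \<omega>. U i x)"
      by (intro ennreal_SUP_sum[symmetric])
    then show ?thesis by (simp only: SUP_apply)
  qed
  moreover have "(\<lambda>\<omega>. SUP i. \<Sum>x\<in>X \<omega>. U i x) \<in> borel_measurable M"
    using seq.IH by measurable
  ultimately show ?case by (simp cong: measurable_cong)
qed

lemma permutes_1: "{p. p permutes {..<Suc 0}} = {id}"
  by (auto simp: lessThan_Suc)

lemma kernel_det_2:
  "kernel_det K 2 x = K (x 0) (x 0) * K (x 1) (x 1) - K (x 0) (x 1) * K (x 1) (x 0)"
proof -
  have "{p. p permutes {..<2::nat}} = {id, Transposition.transpose 0 1}"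
  proof -
    have "{..<2::nat} = {0, 1}" by auto
    then show ?thesis using permutes_doubleton_iff[of _ "0::nat" 1] by auto
  qed
  moreover have "id \<noteq> Transposition.transpose (0::nat) 1" by (metis id_apply transpose_apply_first zero_neq_one)
  ultimately show ?thesis
    by (simp add: kernel_det_def sign_swap_id numeral_2_eq_2 lessThan_Suc mult_ac)
qed

lemma kernel_det_1: "kernel_det K 1 x = K (x 0) (x 0)"
  by (simp add: kernel_det_def permutes_1)

interpretation sphere_product: product_sigma_finite "\<lambda>_::nat. sphere_measure :: 'a::euclidean_space measure"
  by standard

interpretation sphere_pair: pair_sigma_finite "sphere_measure :: 'a::euclidean_space measure" "sphere_measure :: 'a::euclidean_space measure"
  ..

lemma measurable_uncurried:
  assumes "case_prod r \<in> borel_measurable (N1 \<Otimes>\<^sub>M N2)" "f \<in> measurable N N1" "g \<in> measurable N N2"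
  shows "(\<lambda>x. r (f x) (g x)) \<in> borel_measurable N"
  using measurable_compose[OF measurable_Pair[OF assms(2,3)] assms(1)] by simp

lemma first_intensity:
  fixes X :: "'w \<Rightarrow> 'a::euclidean_space set"
  assumes J: "joint_intensities M X \<rho>" and A: "A \<in> sets sphere_measure"
    and \<rho>: "\<And>x. x \<in> sphere 0 1 \<Longrightarrow> ennreal (\<rho> 1 (\<lambda>i\<in>{0}. x)) = r x" "r \<in> borel_measurable sphere_measure"
  shows "(\<integral>\<^sup>+\<omega>. of_nat (card (X \<omega> \<inter> A)) \<partial>M) = (\<integral>\<^sup>+x. indicator A x * r x \<partial>sphere_measure)"
proof -
  let ?P = "PiM {..<1::nat} (\<lambda>_. sphere_measure :: 'a measure)"
  note [measurable] = A \<rho>(2)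
  define B where "B = {x \<in> space ?P. x 0 \<in> A}"
  have l1: "{..<1::nat} = {0}" by auto
  have B: "B \<in> sets ?P" unfolding B_def l1 by measurable
  have Asub: "A \<subseteq> sphere 0 1" using sets.sets_into_space[OF A] by (simp add: space_sphere_measure)
  have card: "card {x \<in> {..<1} \<rightarrow>\<^sub>E X \<omega>. inj_on x {..<1} \<and> x \<in> B} = card (X \<omega> \<inter> A)" for \<omega>
  proof (rule bij_betw_same_card)
    show "bij_betw (\<lambda>x. x 0) {x \<in> {..<1} \<rightarrow>\<^sub>E X \<omega>. inj_on x {..<1} \<and> x \<in> B} (X \<omega> \<inter> A)"
      by (rule bij_betwI[where g="\<lambda>a. \<lambda>i\<in>{0}. a"])
         (use Asub in \<open>auto simp: l1 B_def space_PiM space_sphere_measure PiE_iff extensional_def fun_eq_iff inj_on_def\<close>)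
  qed
  have "(\<integral>\<^sup>+\<omega>. of_nat (card (X \<omega> \<inter> A)) \<partial>M) = (\<integral>\<^sup>+x\<in>B. ennreal (\<rho> 1 x) \<partial>?P)"
    using J[unfolded joint_intensities_def, rule_format, of 1 B] B unfolding card by simp
  also have "\<dots> = (\<integral>\<^sup>+x. indicator A (x 0) * r (x 0) \<partial>?P)"
  proof (rule nn_integral_cong)
    fix x assume x: "x \<in> space ?P"
    then have s: "x 0 \<in> sphere 0 1"
      unfolding l1 space_PiM space_sphere_measure by (rule PiE_mem) simp
    have "x = (\<lambda>i\<in>{0}. x 0)" using x by (auto simp: space_PiM PiE_iff extensional_def fun_eq_iff l1)
    then have "ennreal (\<rho> 1 x) = r (x 0)" using \<rho>(1)[OF s] by argo
    then show "ennreal (\<rho> 1 x) * indicator B x = indicator A (x 0) * r (x 0)"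
      using x by (simp add: B_def indicator_def)
  qed
  also have "\<dots> = (\<integral>\<^sup>+x. indicator A x * r x \<partial>sphere_measure)"
    unfolding l1 by (rule sphere_product.product_nn_integral_singleton) measurable
  finally show ?thesis .
qed

lemma second_intensity:
  fixes X :: "'w \<Rightarrow> 'a::euclidean_space set"
  assumes J: "joint_intensities M X \<rho>" and A: "A \<in> sets sphere_measure" and A': "A' \<in> sets sphere_measure"
    and \<rho>: "\<And>x. x \<in> space (PiM {..<2} (\<lambda>_. sphere_measure)) \<Longrightarrow> ennreal (\<rho> 2 x) = r (x 0) (x 1)"
    and r: "case_prod r \<in> borel_measurable (sphere_measure \<Otimes>\<^sub>M sphere_measure)"
  shows "(\<integral>\<^sup>+\<omega>. of_nat (card {(x, y) \<in> X \<omega> \<times> X \<omega>. x \<noteq> y \<and> x \<in> A \<and> y \<in> A'}) \<partial>M) =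
    (\<integral>\<^sup>+x. \<integral>\<^sup>+y. indicator A x * indicator A' y * r x y \<partial>sphere_measure \<partial>sphere_measure)"
proof -
  let ?P = "PiM {..<2::nat} (\<lambda>_. sphere_measure :: 'a measure)"
  note [measurable] = A A' and [measurable (raw)] = measurable_uncurried[OF r]
  define B where "B = {x \<in> space ?P. x 0 \<in> A \<and> x 1 \<in> A'}"
  have l2: "{..<2::nat} = {0, 1}" by auto
  have B: "B \<in> sets ?P" unfolding B_def l2 by measurable
  have Asub: "A \<subseteq> sphere 0 1" "A' \<subseteq> sphere 0 1"
    using sets.sets_into_space[OF A] sets.sets_into_space[OF A'] by (auto simp: space_sphere_measure)
  have card: "card {x \<in> {..<2} \<rightarrow>\<^sub>E X \<omega>. inj_on x {..<2} \<and> x \<in> B} = card {(x, y) \<in> X \<omega> \<times> X \<omega>. x \<noteq> y \<and> x \<in> A \<and> y \<in> A'}" for \<omega>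
  proof (rule bij_betw_same_card)
    show "bij_betw (\<lambda>x. (x 0, x 1)) {x \<in> {..<2} \<rightarrow>\<^sub>E X \<omega>. inj_on x {..<2} \<and> x \<in> B} {(x, y) \<in> X \<omega> \<times> X \<omega>. x \<noteq> y \<and> x \<in> A \<and> y \<in> A'}"
      by (rule bij_betwI[where g="\<lambda>a. \<lambda>i\<in>{0,1}. if i = 0 then fst a else snd a"])
         (use Asub in \<open>auto simp: l2 B_def space_PiM space_sphere_measure PiE_iff extensional_def fun_eq_iff\<close>)
  qed
  have "(\<integral>\<^sup>+\<omega>. of_nat (card {(x, y) \<in> X \<omega> \<times> X \<omega>. x \<noteq> y \<and> x \<in> A \<and> y \<in> A'}) \<partial>M) = (\<integral>\<^sup>+x\<in>B. ennreal (\<rho> 2 x) \<partial>?P)"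
    using J[unfolded joint_intensities_def, rule_format, of 2 B] B unfolding card by simp
  also have "\<dots> = (\<integral>\<^sup>+x. indicator A (x 0) * indicator A' (x 1) * r (x 0) (x 1) \<partial>?P)"
    by (intro nn_integral_cong) (simp add: \<rho> B_def indicator_def)
  also have "\<dots> = (\<integral>\<^sup>+z. indicator A (fst z) * indicator A' (snd z) * r (fst z) (snd z) \<partial>(sphere_measure \<Otimes>\<^sub>M sphere_measure))"
    unfolding l2 by (rule sphere_product.product_nn_integral_pair) measurable
  also have "\<dots> = (\<integral>\<^sup>+x. \<integral>\<^sup>+y. indicator A x * indicator A' y * r x y \<partial>sphere_measure \<partial>sphere_measure)"
    by (subst sphere.nn_integral_fst[symmetric]) (simp_all, measurable)
  finally show ?thesis .
qed

lemma real_linear_statistic_measurable: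
  fixes f :: "'a::euclidean_space \<Rightarrow> real"
  assumes X: "sphere_point_process M X" and f: "continuous_on (sphere 0 1) f"
  shows "(\<lambda>\<omega>. \<Sum>x\<in>X \<omega>. f x) \<in> borel_measurable M"
proof -
  note [measurable] = borel_measurable_sphere[OF f]
  have "(\<lambda>x. ennreal (max 0 (f x))) \<in> borel_measurable sphere_measure"
    "(\<lambda>x. ennreal (max 0 (- f x))) \<in> borel_measurable sphere_measure"
    by measurable
  note [measurable] = this[THEN linear_statistic_measurable[OF X]]
  have eq: "(\<lambda>\<omega>. \<Sum>x\<in>X \<omega>. f x) = (\<lambda>\<omega>. enn2real (\<Sum>x\<in>X \<omega>. ennreal (max 0 (f x))) - enn2real (\<Sum>x\<in>X \<omega>. ennreal (max 0 (- f x))))"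
  proof
    fix \<omega>
    have "(\<Sum>x\<in>X \<omega>. f x) = (\<Sum>x\<in>X \<omega>. max 0 (f x)) - (\<Sum>x\<in>X \<omega>. max 0 (- f x))"
      unfolding sum_subtractf[symmetric] by (intro sum.cong) auto
    moreover have "(\<Sum>x\<in>X \<omega>. ennreal (max 0 (g x))) = ennreal (\<Sum>x\<in>X \<omega>. max 0 (g x))" for g :: "'a \<Rightarrow> real"
      by (rule sum_ennreal) simp
    moreover have "0 \<le> (\<Sum>x\<in>X \<omega>. max 0 (g x))" for g :: "'a \<Rightarrow> real"
      by (intro sum_nonneg) simp
    ultimately show "(\<Sum>x\<in>X \<omega>. f x) = enn2real (\<Sum>x\<in>X \<omega>. ennreal (max 0 (f x))) - enn2real (\<Sum>x\<in>X \<omega>. ennreal (max 0 (- f x)))"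
      by (simp del: ennreal_max_0)
  qed
  show ?thesis unfolding eq by measurable
qed

text \<open>A point process for which only the first two joint intensities are known, as densities
  \<open>r1\<close> and \<open>r2\<close>, through the expected numbers of points in sets and of pairs of distinct points in
  rectangles. Second moments of linear statistics depend on nothing else.\<close>

locale pair_intensities =
  fixes M :: "'w measure" and X :: "'w \<Rightarrow> 'a::euclidean_space set"
    and r1 :: "'a \<Rightarrow> ennreal" and r2 :: "'a \<Rightarrow> 'a \<Rightarrow> ennreal"
  assumes process: "sphere_point_process M X"
    and r1: "r1 \<in> borel_measurable sphere_measure"
    and r2: "case_prod r2 \<in> borel_measurable (sphere_measure \<Otimes>\<^sub>M sphere_measure)"
    and r2_sym: "\<And>x y. r2 x y = r2 y x"
    and one: "\<And>A. A \<in> sets sphere_measure \<Longrightarrow>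
      (\<integral>\<^sup>+\<omega>. of_nat (card (X \<omega> \<inter> A)) \<partial>M) = (\<integral>\<^sup>+x. indicator A x * r1 x \<partial>sphere_measure)"
    and two: "\<And>A A'. A \<in> sets sphere_measure \<Longrightarrow> A' \<in> sets sphere_measure \<Longrightarrow>
      (\<integral>\<^sup>+\<omega>. of_nat (card {(x, y) \<in> X \<omega> \<times> X \<omega>. x \<noteq> y \<and> x \<in> A \<and> y \<in> A'}) \<partial>M) =
      (\<integral>\<^sup>+x. \<integral>\<^sup>+y. indicator A x * indicator A' y * r2 x y \<partial>sphere_measure \<partial>sphere_measure)"
begin

lemmas [measurable] = r1
lemmas [measurable (raw)] = measurable_uncurried[OF r2]

text \<open>The function against which \<open>g\<close> is integrated in the expectation of the product of the linear
  statistics of \<open>g\<close> and \<open>k\<close>: the first summand accounts for pairs of equal points, the second for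
  pairs of distinct points.\<close>

definition weight :: "('a \<Rightarrow> ennreal) \<Rightarrow> 'a \<Rightarrow> ennreal" where
  "weight k x = k x * r1 x + (\<integral>\<^sup>+y. k y * r2 x y \<partial>sphere_measure)"

lemma weight_measurable [measurable]:
  assumes [measurable]: "k \<in> borel_measurable sphere_measure"
  shows "weight k \<in> borel_measurable sphere_measure"
  unfolding weight_def[abs_def] by measurable

definition has_pair_moment :: "('a \<Rightarrow> ennreal) \<Rightarrow> ('a \<Rightarrow> ennreal) \<Rightarrow> bool" where
  "has_pair_moment g k \<longleftrightarrow>
     (\<integral>\<^sup>+\<omega>. (\<Sum>x\<in>X \<omega>. g x) * (\<Sum>x\<in>X \<omega>. k x) \<partial>M) = (\<integral>\<^sup>+x. g x * weight k x \<partial>sphere_measure)"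

lemma sum_indicator_points:
  assumes "\<omega> \<in> space M"
  shows "(\<Sum>x\<in>X \<omega>. indicator A x) = (of_nat (card (X \<omega> \<inter> A)) :: ennreal)"
  using sphere_point_process_finite[OF process assms]
  by (simp add: indicator_def of_bool_def sum.If_cases)

lemma card_pairs:
  assumes "finite S"
  shows "card (S \<inter> A) * card (S \<inter> A') = card (S \<inter> (A \<inter> A')) + card {(x, y) \<in> S \<times> S. x \<noteq> y \<and> x \<in> A \<and> y \<in> A'}"
proof -
  let ?P = "{(x, y) \<in> S \<times> S. x \<noteq> y \<and> x \<in> A \<and> y \<in> A'}" and ?D = "(\<lambda>x. (x, x)) ` (S \<inter> (A \<inter> A'))"
  have "(S \<inter> A) \<times> (S \<inter> A') = ?D \<union> ?P" by auto
  moreover have "card (?D \<union> ?P) = card ?D + card ?P"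
    using assms by (intro card_Un_disjoint) (auto intro: finite_subset[of _ "S \<times> S"])
  moreover have "card ?D = card (S \<inter> (A \<inter> A'))" by (intro card_image inj_onI) auto
  ultimately show ?thesis by (simp add: card_cartesian_product[symmetric])
qed

lemma has_pair_moment_indicator:
  assumes A[measurable]: "A \<in> sets sphere_measure" and A'[measurable]: "A' \<in> sets sphere_measure"
  shows "has_pair_moment (indicator A) (indicator A')"
proof -
  let ?a = "\<lambda>\<omega>. of_nat (card (X \<omega> \<inter> (A \<inter> A'))) :: ennreal"
  let ?p = "\<lambda>\<omega>. of_nat (card {(x, y) \<in> X \<omega> \<times> X \<omega>. x \<noteq> y \<and> x \<in> A \<and> y \<in> A'}) :: ennreal"
  note [measurable] = sphere_point_process_card_measurable[OF process A]
    sphere_point_process_card_measurable[OF process A'] sphere_point_process_card_measurable[OF process sets.Int[OF A A']]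
  have a: "?a \<in> borel_measurable M"
    unfolding ennreal_of_nat_eq_real_of_nat by measurable
  have p: "?p \<in> borel_measurable M"
  proof -
    have "?p \<omega> = ennreal (real (card (X \<omega> \<inter> A)) * real (card (X \<omega> \<inter> A')) - real (card (X \<omega> \<inter> (A \<inter> A'))))"
      if "\<omega> \<in> space M" for \<omega>
      using card_pairs[OF sphere_point_process_finite(1)[OF process that], of A A']
      unfolding ennreal_of_nat_eq_real_of_nat
      by (simp flip: of_nat_mult)
    then show ?thesis by (simp cong: measurable_cong)
  qed
  have "(\<integral>\<^sup>+\<omega>. (\<Sum>x\<in>X \<omega>. indicator A x) * (\<Sum>x\<in>X \<omega>. indicator A' x) \<partial>M) = (\<integral>\<^sup>+\<omega>. ?a \<omega> + ?p \<omega> \<partial>M)"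
    using card_pairs[OF sphere_point_process_finite(1)[OF process], of _ A A']
    by (intro nn_integral_cong) (simp add: sum_indicator_points flip: of_nat_mult of_nat_add)
  also have "\<dots> = (\<integral>\<^sup>+\<omega>. ?a \<omega> \<partial>M) + (\<integral>\<^sup>+\<omega>. ?p \<omega> \<partial>M)"
    by (rule nn_integral_add[OF a p])
  also have "\<dots> = (\<integral>\<^sup>+x. indicator (A \<inter> A') x * r1 x \<partial>sphere_measure) +
      (\<integral>\<^sup>+x. \<integral>\<^sup>+y. indicator A x * indicator A' y * r2 x y \<partial>sphere_measure \<partial>sphere_measure)"
    unfolding one[OF sets.Int[OF A A']] two[OF A A'] ..
  also have "\<dots> = (\<integral>\<^sup>+x. indicator (A \<inter> A') x * r1 x + (\<integral>\<^sup>+y. indicator A x * indicator A' y * r2 x y \<partial>sphere_measure) \<partial>sphere_measure)"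
    by (rule nn_integral_add[symmetric]) measurable
  also have "\<dots> = (\<integral>\<^sup>+x. indicator A x * weight (indicator A') x \<partial>sphere_measure)"
  proof (rule nn_integral_cong)
    fix x :: 'a
    have "(\<integral>\<^sup>+y. indicator A x * indicator A' y * r2 x y \<partial>sphere_measure) = indicator A x * (\<integral>\<^sup>+y. indicator A' y * r2 x y \<partial>sphere_measure)"
      if "x \<in> space sphere_measure"
      unfolding mult.assoc using that by (intro nn_integral_cmult) measurable
    moreover assume "x \<in> space sphere_measure"
    ultimately show "indicator (A \<inter> A') x * r1 x + (\<integral>\<^sup>+y. indicator A x * indicator A' y * r2 x y \<partial>sphere_measure) = indicator A x * weight (indicator A') x"
      by (simp add: weight_def distrib_left indicator_inter_arith mult.assoc)
  qed
  finally show ?thesis by (simp add: has_pair_moment_def)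
qed

text \<open>For fixed \<open>k\<close> both sides are additive and continuous under monotone limits in \<open>g\<close>. The
  symmetry of the moment then allows the same extension in the other argument.\<close>

lemma has_pair_moment_extend:
  assumes k[measurable]: "k \<in> borel_measurable sphere_measure"
    and ind: "\<And>A. A \<in> sets sphere_measure \<Longrightarrow> has_pair_moment (indicator A) k"
    and g: "g \<in> borel_measurable sphere_measure"
  shows "has_pair_moment g k"
  using g
proof (induction rule: borel_measurable_induct)
  case (cong f g)
  have "(\<Sum>x\<in>X \<omega>. f x) = (\<Sum>x\<in>X \<omega>. g x)" if "\<omega> \<in> space M" for \<omega>
    using sphere_point_process_finite[OF process that] cong.hyps(3) by (intro sum.cong) (auto simp: space_sphere_measure)
  then have "(\<integral>\<^sup>+\<omega>. (\<Sum>x\<in>X \<omega>. f x) * (\<Sum>x\<in>X \<omega>. k x) \<partial>M) = (\<integral>\<^sup>+\<omega>. (\<Sum>x\<in>X \<omega>. g x) * (\<Sum>x\<in>X \<omega>. k x) \<partial>M)"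
    by (intro nn_integral_cong) simp
  moreover have "(\<integral>\<^sup>+x. f x * weight k x \<partial>sphere_measure) = (\<integral>\<^sup>+x. g x * weight k x \<partial>sphere_measure)"
    using cong.hyps(3) by (intro nn_integral_cong) simp
  ultimately show ?case using cong.IH by (simp add: has_pair_moment_def)
next
  case (set A)
  then show ?case by (rule ind)
next
  case (mult u c)
  note [measurable] = mult.hyps(2) linear_statistic_measurable[OF process mult.hyps(2)] linear_statistic_measurable[OF process k]
  have "(\<integral>\<^sup>+\<omega>. (\<Sum>x\<in>X \<omega>. c * u x) * (\<Sum>x\<in>X \<omega>. k x) \<partial>M) = c * (\<integral>\<^sup>+\<omega>. (\<Sum>x\<in>X \<omega>. u x) * (\<Sum>x\<in>X \<omega>. k x) \<partial>M)"
    unfolding sum_distrib_left[symmetric] mult.assoc by (rule nn_integral_cmult) measurable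
  moreover have "(\<integral>\<^sup>+x. c * u x * weight k x \<partial>sphere_measure) = c * (\<integral>\<^sup>+x. u x * weight k x \<partial>sphere_measure)"
    unfolding mult.assoc by (rule nn_integral_cmult) measurable
  ultimately show ?case using mult.IH by (simp add: has_pair_moment_def)
next
  case (add u v)
  note m = add.hyps(1,3)
  note [measurable] = m linear_statistic_measurable[OF process m(1)] linear_statistic_measurable[OF process m(2)] linear_statistic_measurable[OF process k]
  have "(\<integral>\<^sup>+\<omega>. (\<Sum>x\<in>X \<omega>. v x + u x) * (\<Sum>x\<in>X \<omega>. k x) \<partial>M) = (\<integral>\<^sup>+\<omega>. (\<Sum>x\<in>X \<omega>. v x) * (\<Sum>x\<in>X \<omega>. k x) \<partial>M) + (\<integral>\<^sup>+\<omega>. (\<Sum>x\<in>X \<omega>. u x) * (\<Sum>x\<in>X \<omega>. k x) \<partial>M)"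
    unfolding sum.distrib distrib_right by (rule nn_integral_add) measurable
  moreover have "(\<integral>\<^sup>+x. (v x + u x) * weight k x \<partial>sphere_measure) = (\<integral>\<^sup>+x. v x * weight k x \<partial>sphere_measure) + (\<integral>\<^sup>+x. u x * weight k x \<partial>sphere_measure)"
    unfolding distrib_right by (rule nn_integral_add) measurable
  ultimately show ?case using add.IH by (simp add: has_pair_moment_def)
next
  case (seq U)
  note m[measurable] = seq.hyps(1)
  note [measurable] = linear_statistic_measurable[OF process m] linear_statistic_measurable[OF process k]
  have inc: "incseq (\<lambda>i. U i x)" for x using seq.hyps(3) by (auto simp: incseq_def le_fun_def)
  have "(\<integral>\<^sup>+\<omega>. (\<Sum>x\<in>X \<omega>. (SUP i. U i) x) * (\<Sum>x\<in>X \<omega>. k x) \<partial>M) = (\<integral>\<^sup>+\<omega>. (SUP i. (\<Sum>x\<in>X \<omega>. U i x) * (\<Sum>x\<in>X \<omega>. k x)) \<partial>M)"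
  proof (rule nn_integral_cong)
    fix \<omega>
    have "(\<Sum>x\<in>X \<omega>. (SUP i. U i) x) = (SUP i. \<Sum>x\<in>X \<omega>. U i x)"
      unfolding SUP_apply using inc by (intro ennreal_SUP_sum[symmetric])
    then show "(\<Sum>x\<in>X \<omega>. (SUP i. U i) x) * (\<Sum>x\<in>X \<omega>. k x) = (SUP i. (\<Sum>x\<in>X \<omega>. U i x) * (\<Sum>x\<in>X \<omega>. k x))"
      by (simp add: SUP_mult_right_ennreal)
  qed
  also have "\<dots> = (SUP i. \<integral>\<^sup>+\<omega>. (\<Sum>x\<in>X \<omega>. U i x) * (\<Sum>x\<in>X \<omega>. k x) \<partial>M)"
    using inc by (intro nn_integral_monotone_convergence_SUP)
      (auto simp: incseq_def le_fun_def intro!: mult_right_mono sum_mono)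
  also have "\<dots> = (SUP i. \<integral>\<^sup>+x. U i x * weight k x \<partial>sphere_measure)"
    using seq.IH by (simp add: has_pair_moment_def)
  also have "\<dots> = (\<integral>\<^sup>+x. (SUP i. U i x * weight k x) \<partial>sphere_measure)"
    using inc by (intro nn_integral_monotone_convergence_SUP[symmetric])
      (auto simp: incseq_def le_fun_def intro!: mult_right_mono)
  also have "\<dots> = (\<integral>\<^sup>+x. (SUP i. U i) x * weight k x \<partial>sphere_measure)"
    by (intro nn_integral_cong) (simp add: SUP_mult_right_ennreal SUP_apply image_comp)
  finally show ?case by (simp add: has_pair_moment_def)
qed

lemma has_pair_moment_commute:
  assumes [measurable]: "g \<in> borel_measurable sphere_measure" "k \<in> borel_measurable sphere_measure"
    and "has_pair_moment g k"
  shows "has_pair_moment k g"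
proof -
  have expand: "(\<integral>\<^sup>+x. g x * weight k x \<partial>sphere_measure) = (\<integral>\<^sup>+x. g x * k x * r1 x \<partial>sphere_measure)
      + (\<integral>\<^sup>+x. \<integral>\<^sup>+y. g x * k y * r2 x y \<partial>sphere_measure \<partial>sphere_measure)"
    if [measurable]: "g \<in> borel_measurable sphere_measure" "k \<in> borel_measurable sphere_measure" for g k
  proof -
    have "(\<integral>\<^sup>+x. g x * weight k x \<partial>sphere_measure) = (\<integral>\<^sup>+x. g x * k x * r1 x + (\<integral>\<^sup>+y. g x * k y * r2 x y \<partial>sphere_measure) \<partial>sphere_measure)"
    proof (rule nn_integral_cong)
      fix x :: 'a assume [measurable]: "x \<in> space sphere_measure"
      have "(\<integral>\<^sup>+y. g x * k y * r2 x y \<partial>sphere_measure) = g x * (\<integral>\<^sup>+y. k y * r2 x y \<partial>sphere_measure)"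
        unfolding mult.assoc by (intro nn_integral_cmult) measurable
      then show "g x * weight k x = g x * k x * r1 x + (\<integral>\<^sup>+y. g x * k y * r2 x y \<partial>sphere_measure)"
        by (simp add: weight_def distrib_left mult.assoc)
    qed
    also have "\<dots> = (\<integral>\<^sup>+x. g x * k x * r1 x \<partial>sphere_measure) + (\<integral>\<^sup>+x. \<integral>\<^sup>+y. g x * k y * r2 x y \<partial>sphere_measure \<partial>sphere_measure)"
      by (rule nn_integral_add) measurable
    finally show ?thesis .
  qed
  have "(\<integral>\<^sup>+x. \<integral>\<^sup>+y. g x * k y * r2 x y \<partial>sphere_measure \<partial>sphere_measure) = (\<integral>\<^sup>+y. \<integral>\<^sup>+x. g x * k y * r2 x y \<partial>sphere_measure \<partial>sphere_measure)"
    by (rule sphere_pair.Fubini'[symmetric]) measurable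
  also have "\<dots> = (\<integral>\<^sup>+y. \<integral>\<^sup>+x. k y * g x * r2 y x \<partial>sphere_measure \<partial>sphere_measure)"
    by (intro nn_integral_cong) (simp add: r2_sym[of _ "_"] mult.commute[of "g _"])
  finally have s: "(\<integral>\<^sup>+x. \<integral>\<^sup>+y. g x * k y * r2 x y \<partial>sphere_measure \<partial>sphere_measure) = (\<integral>\<^sup>+x. \<integral>\<^sup>+y. k x * g y * r2 x y \<partial>sphere_measure \<partial>sphere_measure)" .
  have "(\<integral>\<^sup>+x. g x * weight k x \<partial>sphere_measure) = (\<integral>\<^sup>+x. k x * weight g x \<partial>sphere_measure)"
    unfolding expand[OF assms(1,2)] expand[OF assms(2,1)] s by (simp only: mult.commute[of "g _" "k _"])
  then show ?thesis using assms(3) unfolding has_pair_moment_def by (simp add: mult.commute)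
qed

lemma pair_moment:
  assumes g: "g \<in> borel_measurable sphere_measure" and k: "k \<in> borel_measurable sphere_measure"
  shows "(\<integral>\<^sup>+\<omega>. (\<Sum>x\<in>X \<omega>. g x) * (\<Sum>x\<in>X \<omega>. k x) \<partial>M) = (\<integral>\<^sup>+x. g x * weight k x \<partial>sphere_measure)"
proof -
  have i: "indicator A \<in> borel_measurable sphere_measure" if "A \<in> sets sphere_measure" for A :: "'a set"
    using that by measurable
  have "has_pair_moment g (indicator A)" if A: "A \<in> sets sphere_measure" for A
    by (rule has_pair_moment_extend[OF i[OF A] _ g]) (rule has_pair_moment_indicator[OF _ A])
  then have "has_pair_moment (indicator A) g" if "A \<in> sets sphere_measure" for A
    using has_pair_moment_commute[OF g i] that by blast
  then have "has_pair_moment k g" by (rule has_pair_moment_extend[OF g _ k])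
  from has_pair_moment_commute[OF k g this] show ?thesis by (simp add: has_pair_moment_def)
qed

end

section \<open>The harmonic ensemble\<close>

context harmonic_basis begin

definition kern :: "nat \<Rightarrow> 'a \<Rightarrow> 'a \<Rightarrow> real" where
  "kern L x y = (\<Sum>i\<in>I L. e i x * e i y)"

text \<open>The coefficient of \<open>e i\<close> in \<open>K x\<close> is \<open>e i x\<close>, by the reproducing property applied to
  \<open>e i\<close>.\<close>

lemma reproducing_kernel_eq:
  assumes K: "reproducing_kernel (sphere_polynomials L) K" and x: "x \<in> sphere 0 1" and y: "y \<in> sphere 0 1"
  shows "K x y = kern L x y"
proof -
  obtain p where p: "p \<in> polynomials_upto L" "K x = on_sphere p"
    using K x unfolding reproducing_kernel_def sphere_polynomials_def by blast
  have "sphere_inner p (e i) = e i x" if i: "i \<in> I L" for i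
  proof -
    have "e i \<in> polynomials_upto L"
      using i e_upto[of i] upto_mono[of "fst i" L] by (auto simp: mem_I)
    then have "on_sphere (e i) \<in> sphere_polynomials L" by (auto simp: sphere_polynomials_def)
    then have "on_sphere (e i) x = (\<integral>y. on_sphere (e i) y * K x y \<partial>sphere_measure)"
      using K x unfolding reproducing_kernel_def by blast
    also have "\<dots> = sphere_inner p (e i)"
      unfolding sphere_inner_def by (intro integral_sphere_cong) (simp add: p on_sphere_def)
    finally show ?thesis using x by (simp add: on_sphere_def)
  qed
  then have "p y = kern L x y" using upto_expand[OF p(1) y] by (simp add: kern_def)
  then show ?thesis using y by (simp add: p on_sphere_def)
qed

lemma kern_sym: "kern L x y = kern L y x"
  by (simp add: kern_def mult.commute)

lemma kern_diag: "x \<in> sphere 0 1 \<Longrightarrow> kern L x x = npts L"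
  using addition_theorem_I[of x L] by (simp add: kern_def power2_eq_square)

lemma kern_le:
  assumes "x \<in> sphere 0 1" "y \<in> sphere 0 1"
  shows "(kern L x y)\<^sup>2 \<le> (npts L)\<^sup>2"
  using Cauchy_Schwarz_ineq_sum[of "\<lambda>i. e i x" "\<lambda>i. e i y" "I L"] addition_theorem_I[OF assms(1), of L] addition_theorem_I[OF assms(2), of L]
  by (simp add: kern_def power2_eq_square)

lemma e_measurable: "i \<in> I L \<Longrightarrow> e i \<in> borel_measurable sphere_measure"
  by (intro borel_measurable_sphere continuous_on_poly e_I_poly)

lemma kern_measurable:
  "case_prod (kern L) \<in> borel_measurable (sphere_measure \<Otimes>\<^sub>M sphere_measure)"
proof -
  have "(\<lambda>z. e i (fst z) * e i (snd z)) \<in> borel_measurable (sphere_measure \<Otimes>\<^sub>M sphere_measure)" if "i \<in> I L" for i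
    using measurable_compose[OF measurable_fst e_measurable[OF that]] measurable_compose[OF measurable_snd e_measurable[OF that]]
    by (rule borel_measurable_times)
  then show ?thesis unfolding kern_def[abs_def] case_prod_beta' by (rule borel_measurable_sum)
qed

text \<open>The second intensity of the ensemble: the diagonal of the kernel is the constant number of points,
  by the addition theorem.\<close>

definition pair_density :: "nat \<Rightarrow> 'a \<Rightarrow> 'a \<Rightarrow> ennreal" where
  "pair_density L x y = ennreal ((npts L)\<^sup>2 - (kern L x y)\<^sup>2)"

text \<open>The determinants of sizes one and two, evaluated with the kernel in terms of the basis.\<close>

lemma harmonic_ensemble_pair_intensities:
  assumes "harmonic_ensemble L M (X :: 'w \<Rightarrow> 'a set)"
  shows "pair_intensities M X (\<lambda>_. ennreal (npts L)) (pair_density L)"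
proof -
  obtain K where X: "sphere_point_process M X" and K: "reproducing_kernel (sphere_polynomials L) K"
    and J: "joint_intensities M X (kernel_det K)"
    using assms by (auto simp: harmonic_ensemble_def)
  have m: "case_prod (pair_density L) \<in> borel_measurable (sphere_measure \<Otimes>\<^sub>M sphere_measure)"
    unfolding pair_density_def[abs_def] case_prod_beta'
    using kern_measurable[of L, unfolded case_prod_beta'] by measurable
  show ?thesis
  proof
    show "sphere_point_process M X" by (rule X)
    show "pair_density L x y = pair_density L y x" for x y by (simp add: pair_density_def kern_sym)
    show "case_prod (pair_density L) \<in> borel_measurable (sphere_measure \<Otimes>\<^sub>M sphere_measure)" by (rule m)
    show "(\<integral>\<^sup>+\<omega>. of_nat (card (X \<omega> \<inter> A)) \<partial>M) = (\<integral>\<^sup>+x. indicator A x * ennreal (npts L) \<partial>sphere_measure)"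
      if "A \<in> sets sphere_measure" for A
    proof (rule first_intensity[OF J that])
      show "ennreal (kernel_det K 1 (\<lambda>i\<in>{0}. x)) = ennreal (npts L)" if "x \<in> sphere 0 1" for x
        unfolding kernel_det_1 using that by (simp add: reproducing_kernel_eq[OF K] kern_diag)
    qed simp
    show "(\<integral>\<^sup>+\<omega>. of_nat (card {(x, y) \<in> X \<omega> \<times> X \<omega>. x \<noteq> y \<and> x \<in> A \<and> y \<in> A'}) \<partial>M) =
        (\<integral>\<^sup>+x. \<integral>\<^sup>+y. indicator A x * indicator A' y * pair_density L x y \<partial>sphere_measure \<partial>sphere_measure)"
      if "A \<in> sets sphere_measure" "A' \<in> sets sphere_measure" for A A'
    proof (rule second_intensity[OF J that _ m])
      fix x assume x: "x \<in> space (PiM {..<2::nat} (\<lambda>_. sphere_measure :: 'a measure))"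
      have "x 0 \<in> sphere 0 1" "x 1 \<in> sphere 0 1"
        by (rule PiE_mem[OF x[unfolded space_PiM space_sphere_measure]], simp)+
      then show "ennreal (kernel_det K 2 x) = pair_density L (x 0) (x 1)"
        unfolding kernel_det_2 pair_density_def
        by (simp add: reproducing_kernel_eq[OF K] kern_diag kern_sym[of L "x (Suc 0)" "x 0"] power2_eq_square del: mem_sphere_0)
    qed
  qed simp
qed

lemma continuous_e: "i \<in> I L \<Longrightarrow> continuous_on (sphere 0 1) (e i)"
  by (intro continuous_on_poly e_I_poly)

lemma integral_mult_kern_square:
  assumes f: "continuous_on (sphere 0 1) f"
  shows "(\<integral>y. f y * (kern L x y)\<^sup>2 \<partial>sphere_measure) = (\<Sum>i\<in>I L. \<Sum>j\<in>I L. mult_coeff f i j * (e i x * e j x))"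
proof -
  have "(\<integral>y. f y * (kern L x y)\<^sup>2 \<partial>sphere_measure) = (\<integral>y. (\<Sum>i\<in>I L. \<Sum>j\<in>I L. e i x * e j x * (f y * e i y * e j y)) \<partial>sphere_measure)"
    by (intro integral_sphere_cong)
       (simp add: kern_def power2_eq_square sum_product sum_distrib_left mult_ac)
  also have "\<dots> = (\<Sum>i\<in>I L. \<integral>y. (\<Sum>j\<in>I L. e i x * e j x * (f y * e i y * e j y)) \<partial>sphere_measure)"
    by (intro Bochner_Integration.integral_sum integrable_sphere continuous_intros f continuous_e)
  also have "\<dots> = (\<Sum>i\<in>I L. \<Sum>j\<in>I L. \<integral>y. e i x * e j x * (f y * e i y * e j y) \<partial>sphere_measure)"
    by (intro sum.cong refl Bochner_Integration.integral_sum integrable_sphere continuous_intros f continuous_e)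
  finally show ?thesis by (simp add: mult_coeff_def sphere_inner_def mult.commute)
qed

text \<open>The expectation of the product of the linear statistics of \<open>f\<close> and \<open>g\<close>. The square of the
  kernel expands into products of basis functions, which turns its double integral into a sum over
  matrix coefficients of the multiplication operators.\<close>

definition ensemble_moment :: "nat \<Rightarrow> ('a \<Rightarrow> real) \<Rightarrow> ('a \<Rightarrow> real) \<Rightarrow> real" where
  "ensemble_moment L f g = npts L * sphere_inner f g
     + (npts L)\<^sup>2 * (\<integral>x. f x \<partial>sphere_measure) * (\<integral>x. g x \<partial>sphere_measure)
     - (\<Sum>i\<in>I L. \<Sum>j\<in>I L. mult_coeff f i j * mult_coeff g i j)"

lemma ensemble_moment_diff:
  assumes f: "continuous_on (sphere 0 1) f" and g: "continuous_on (sphere 0 1) g"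
  shows "ensemble_moment L (\<lambda>x. f x - g x) (\<lambda>x. f x - g x) =
    ensemble_moment L f f + ensemble_moment L g g - 2 * ensemble_moment L f g"
proof -
  have inner: "sphere_inner (\<lambda>x. f x - g x) k = sphere_inner f k - sphere_inner g k"
    if "continuous_on (sphere 0 1) f" "continuous_on (sphere 0 1) g" "continuous_on (sphere 0 1) k" for f g k :: "'a \<Rightarrow> real"
    unfolding sphere_inner_def left_diff_distrib using that
    by (intro Bochner_Integration.integral_diff integrable_sphere continuous_intros)
  have mean: "(\<integral>x. f x - g x \<partial>sphere_measure) = (\<integral>x. f x \<partial>sphere_measure) - (\<integral>x. g x \<partial>sphere_measure)"
    using f g by (intro Bochner_Integration.integral_diff integrable_sphere)
  have mc: "mult_coeff (\<lambda>x. f x - g x) i j = mult_coeff f i j - mult_coeff g i j" if "i \<in> I L" "j \<in> I L" for i j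
    unfolding mult_coeff_def left_diff_distrib
    by (intro inner continuous_intros f g continuous_e[OF that(1)] continuous_e[OF that(2)])
  have "(\<Sum>i\<in>I L. \<Sum>j\<in>I L. mult_coeff (\<lambda>x. f x - g x) i j * mult_coeff (\<lambda>x. f x - g x) i j)
    = (\<Sum>i\<in>I L. \<Sum>j\<in>I L. mult_coeff f i j * mult_coeff f i j + mult_coeff g i j * mult_coeff g i j - 2 * (mult_coeff f i j * mult_coeff g i j))"
    by (intro sum.cong refl) (simp only: mc, simp add: algebra_simps)
  then have sums: "(\<Sum>i\<in>I L. \<Sum>j\<in>I L. mult_coeff (\<lambda>x. f x - g x) i j * mult_coeff (\<lambda>x. f x - g x) i j)
    = (\<Sum>i\<in>I L. \<Sum>j\<in>I L. mult_coeff f i j * mult_coeff f i j) + (\<Sum>i\<in>I L. \<Sum>j\<in>I L. mult_coeff g i j * mult_coeff g i j)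
      - 2 * (\<Sum>i\<in>I L. \<Sum>j\<in>I L. mult_coeff f i j * mult_coeff g i j)"
    by (simp only: sum.distrib sum_subtractf sum_distrib_left[symmetric])
  have sq: "sphere_inner (\<lambda>x. f x - g x) (\<lambda>x. f x - g x) = sphere_inner f f + sphere_inner g g - 2 * sphere_inner f g"
  proof -
    have fg: "continuous_on (sphere 0 1) (\<lambda>x. f x - g x)" by (intro continuous_intros f g)
    show ?thesis
      unfolding inner[OF f g fg] sphere_inner_commute[of f "\<lambda>x. f x - g x"] sphere_inner_commute[of g "\<lambda>x. f x - g x"]
        inner[OF f g f] inner[OF f g g] sphere_inner_commute[of g f] by simp
  qed
  show ?thesis
    unfolding ensemble_moment_def mean sums sq by (simp add: algebra_simps)
qed

lemma ennreal_integral_sphere: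
  assumes "continuous_on (sphere 0 1) f" "\<And>x. x \<in> sphere 0 1 \<Longrightarrow> f x \<ge> 0"
  shows "(\<integral>\<^sup>+x. ennreal (f x) \<partial>sphere_measure) = ennreal (\<integral>x. f x \<partial>sphere_measure)"
  using assms by (intro nn_integral_eq_integral integrable_sphere AE_I2) (auto simp: space_sphere_measure)

lemma second_moment_nonneg:
  assumes H: "harmonic_ensemble L M (X :: 'w \<Rightarrow> 'a set)"
    and g: "continuous_on (sphere 0 1) g" "\<And>x. x \<in> sphere 0 1 \<Longrightarrow> g x \<ge> 0"
    and k: "continuous_on (sphere 0 1) k" "\<And>x. x \<in> sphere 0 1 \<Longrightarrow> k x \<ge> 0"
  shows "(\<integral>\<^sup>+\<omega>. ennreal ((\<Sum>x\<in>X \<omega>. g x) * (\<Sum>x\<in>X \<omega>. k x)) \<partial>M) = ennreal (ensemble_moment L g k)"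
    and "ensemble_moment L g k \<ge> 0"
proof -
  interpret pair_intensities M X "\<lambda>_. ennreal (npts L)" "pair_density L"
    by (rule harmonic_ensemble_pair_intensities[OF H])
  define R where "R x = npts L * k x + (\<integral>y. k y * ((npts L)\<^sup>2 - (kern L x y)\<^sup>2) \<partial>sphere_measure)" for x
  have ck: "continuous_on (sphere 0 1) (kern L x)" for x
    unfolding kern_def by (intro continuous_intros continuous_e)
  have nn: "k y * ((npts L)\<^sup>2 - (kern L x y)\<^sup>2) \<ge> 0" if "x \<in> sphere 0 1" "y \<in> sphere 0 1" for x y
    using k(2)[OF that(2)] kern_le[OF that, of L] by simp
  have nn2: "(\<integral>y. k y * ((npts L)\<^sup>2 - (kern L x y)\<^sup>2) \<partial>sphere_measure) \<ge> 0" if "x \<in> sphere 0 1" for x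
    using nn[OF that] by (intro Bochner_Integration.integral_nonneg_AE AE_I2) (auto simp: space_sphere_measure)
  have Rnn: "R x \<ge> 0" if "x \<in> sphere 0 1" for x
    unfolding R_def using k(2) nn2 that by (intro add_nonneg_nonneg mult_nonneg_nonneg) auto
  have w: "weight (\<lambda>x. ennreal (k x)) x = ennreal (R x)" if x: "x \<in> sphere 0 1" for x
  proof -
    have "(\<integral>\<^sup>+y. ennreal (k y) * pair_density L x y \<partial>sphere_measure) = (\<integral>\<^sup>+y. ennreal (k y * ((npts L)\<^sup>2 - (kern L x y)\<^sup>2)) \<partial>sphere_measure)"
      using kern_le[OF x, of _ L] k(2)
      by (intro nn_integral_cong) (simp add: pair_density_def ennreal_mult space_sphere_measure)
    also have "\<dots> = ennreal (\<integral>y. k y * ((npts L)\<^sup>2 - (kern L x y)\<^sup>2) \<partial>sphere_measure)"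
      using nn[OF x] by (intro ennreal_integral_sphere continuous_intros k ck)
    finally show ?thesis
      using nn2[OF x] k(2)[OF x] by (simp add: weight_def R_def ennreal_mult mult.commute)
  qed
  have R: "R x = npts L * k x + (npts L)\<^sup>2 * (\<integral>y. k y \<partial>sphere_measure) - (\<Sum>i\<in>I L. \<Sum>j\<in>I L. mult_coeff k i j * (e i x * e j x))" for x
  proof -
    have "(\<integral>y. k y * ((npts L)\<^sup>2 - (kern L x y)\<^sup>2) \<partial>sphere_measure) = (\<integral>y. k y * (npts L)\<^sup>2 \<partial>sphere_measure) - (\<integral>y. k y * (kern L x y)\<^sup>2 \<partial>sphere_measure)"
      unfolding right_diff_distrib
      by (intro Bochner_Integration.integral_diff integrable_sphere continuous_intros k ck)
    then show ?thesis by (simp add: R_def integral_mult_kern_square[OF k(1)])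
  qed
  have cR: "continuous_on (sphere 0 1) R"
    unfolding R by (intro continuous_intros k continuous_e)
  have gR: "(\<integral>x. g x * R x \<partial>sphere_measure) = ensemble_moment L g k"
  proof -
    have "(\<integral>x. g x * R x \<partial>sphere_measure) = (\<integral>x. npts L * (g x * k x) + (npts L)\<^sup>2 * (\<integral>y. k y \<partial>sphere_measure) * g x - (\<Sum>i\<in>I L. \<Sum>j\<in>I L. mult_coeff k i j * (g x * e i x * e j x)) \<partial>sphere_measure)"
      unfolding R by (intro integral_sphere_cong) (simp add: algebra_simps sum_distrib_left)
    also have "\<dots> = npts L * sphere_inner g k + (npts L)\<^sup>2 * (\<integral>y. k y \<partial>sphere_measure) * (\<integral>x. g x \<partial>sphere_measure)
        - (\<integral>x. (\<Sum>i\<in>I L. \<Sum>j\<in>I L. mult_coeff k i j * (g x * e i x * e j x)) \<partial>sphere_measure)"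
    proof -
      have "integrable sphere_measure (\<lambda>x. npts L * (g x * k x))" "integrable sphere_measure (\<lambda>x. (npts L)\<^sup>2 * (\<integral>y. k y \<partial>sphere_measure) * g x)"
        "integrable sphere_measure (\<lambda>x. \<Sum>i\<in>I L. \<Sum>j\<in>I L. mult_coeff k i j * (g x * e i x * e j x))"
        by (intro integrable_sphere continuous_intros g k continuous_e)+
      then show ?thesis by (simp add: sphere_inner_def)
    qed
    also have "(\<integral>x. (\<Sum>i\<in>I L. \<Sum>j\<in>I L. mult_coeff k i j * (g x * e i x * e j x)) \<partial>sphere_measure) = (\<Sum>i\<in>I L. \<Sum>j\<in>I L. mult_coeff k i j * mult_coeff g i j)"
    proof -
      have "(\<integral>x. (\<Sum>i\<in>I L. \<Sum>j\<in>I L. mult_coeff k i j * (g x * e i x * e j x)) \<partial>sphere_measure) = (\<Sum>i\<in>I L. \<integral>x. (\<Sum>j\<in>I L. mult_coeff k i j * (g x * e i x * e j x)) \<partial>sphere_measure)"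
        by (intro Bochner_Integration.integral_sum integrable_sphere continuous_intros g continuous_e)
      also have "\<dots> = (\<Sum>i\<in>I L. \<Sum>j\<in>I L. \<integral>x. mult_coeff k i j * (g x * e i x * e j x) \<partial>sphere_measure)"
        by (intro sum.cong refl Bochner_Integration.integral_sum integrable_sphere continuous_intros g continuous_e)
      finally show ?thesis by (simp add: mult_coeff_def sphere_inner_def)
    qed
    finally show ?thesis by (simp add: ensemble_moment_def mult_ac)
  qed
  show "ensemble_moment L g k \<ge> 0"
    unfolding gR[symmetric] using g(2) Rnn
    by (intro Bochner_Integration.integral_nonneg_AE AE_I2) (auto simp: space_sphere_measure)
  have "ennreal ((\<Sum>x\<in>X \<omega>. g x) * (\<Sum>x\<in>X \<omega>. k x)) = (\<Sum>x\<in>X \<omega>. ennreal (g x)) * (\<Sum>x\<in>X \<omega>. ennreal (k x))"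
    if "\<omega> \<in> space M" for \<omega>
  proof -
    have nonneg: "g x \<ge> 0" "k x \<ge> 0" if "x \<in> X \<omega>" for x
      using sphere_point_process_finite(2)[OF process \<open>\<omega> \<in> space M\<close>] that g(2) k(2) by auto
    then show ?thesis by (simp add: sum_ennreal ennreal_mult sum_nonneg)
  qed
  then have "(\<integral>\<^sup>+\<omega>. ennreal ((\<Sum>x\<in>X \<omega>. g x) * (\<Sum>x\<in>X \<omega>. k x)) \<partial>M) = (\<integral>\<^sup>+\<omega>. (\<Sum>x\<in>X \<omega>. ennreal (g x)) * (\<Sum>x\<in>X \<omega>. ennreal (k x)) \<partial>M)"
    by (rule nn_integral_cong)
  also have "\<dots> = (\<integral>\<^sup>+x. ennreal (g x) * weight (\<lambda>x. ennreal (k x)) x \<partial>sphere_measure)"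
    by (rule pair_moment) (use borel_measurable_sphere[OF g(1)] borel_measurable_sphere[OF k(1)] in measurable)
  also have "\<dots> = (\<integral>\<^sup>+x. ennreal (g x * R x) \<partial>sphere_measure)"
    using g(2) Rnn by (intro nn_integral_cong) (simp add: w ennreal_mult space_sphere_measure)
  also have "\<dots> = ennreal (ensemble_moment L g k)"
    unfolding gR[symmetric] using g(2) Rnn by (intro ennreal_integral_sphere continuous_intros g cR) auto
  finally show "(\<integral>\<^sup>+\<omega>. ennreal ((\<Sum>x\<in>X \<omega>. g x) * (\<Sum>x\<in>X \<omega>. k x)) \<partial>M) = ennreal (ensemble_moment L g k)" .
qed

text \<open>The moment formula is known for nonnegative functions. For \<open>f = g - k\<close> with the positive and
  negative parts \<open>g\<close> and \<open>k\<close>, the square of the statistic of \<open>f\<close> plus twice the product of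
  those of \<open>g\<close> and \<open>k\<close> is a sum of two squares, so no subtraction of possibly infinite integrals
  occurs.\<close>

lemma second_moment:
  assumes H: "harmonic_ensemble L M (X :: 'w \<Rightarrow> 'a set)" and f: "continuous_on (sphere 0 1) f"
  shows "(\<integral>\<^sup>+\<omega>. ennreal ((\<Sum>x\<in>X \<omega>. f x)\<^sup>2) \<partial>M) = ennreal (ensemble_moment L f f)"
    and "ensemble_moment L f f \<ge> 0"
proof -
  have X: "sphere_point_process M X" using H by (simp add: harmonic_ensemble_def)
  define g k where "g x = max 0 (f x)" and "k x = max 0 (- f x)" for x
  have g: "continuous_on (sphere 0 1) g" "\<And>x. x \<in> sphere 0 1 \<Longrightarrow> g x \<ge> 0"
    and k: "continuous_on (sphere 0 1) k" "\<And>x. x \<in> sphere 0 1 \<Longrightarrow> k x \<ge> 0"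
    unfolding g_def k_def by (auto intro!: continuous_intros f)
  have fgk: "f = (\<lambda>x. g x - k x)" by (auto simp: g_def k_def)
  let ?F = "\<lambda>\<omega>. \<Sum>x\<in>X \<omega>. f x" and ?G = "\<lambda>\<omega>. \<Sum>x\<in>X \<omega>. g x" and ?K = "\<lambda>\<omega>. \<Sum>x\<in>X \<omega>. k x"
  note [measurable] = real_linear_statistic_measurable[OF X f] real_linear_statistic_measurable[OF X g(1)]
    real_linear_statistic_measurable[OF X k(1)]
  note gg = second_moment_nonneg[OF H g g] and kk = second_moment_nonneg[OF H k k] and gk = second_moment_nonneg[OF H g k]
  have int: "(\<integral>\<^sup>+\<omega>. ennreal (?G \<omega> * ?G \<omega>) \<partial>M) = ennreal (ensemble_moment L g g)"
    "(\<integral>\<^sup>+\<omega>. ennreal (?K \<omega> * ?K \<omega>) \<partial>M) = ennreal (ensemble_moment L k k)"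
    "(\<integral>\<^sup>+\<omega>. ennreal (?G \<omega> * ?K \<omega>) \<partial>M) = ennreal (ensemble_moment L g k)"
    by (rule gg(1) kk(1) gk(1); assumption)+
  have pointwise: "ennreal ((?F \<omega>)\<^sup>2) + 2 * ennreal (?G \<omega> * ?K \<omega>) = ennreal (?G \<omega> * ?G \<omega>) + ennreal (?K \<omega> * ?K \<omega>)" for \<omega>
  proof -
    have F: "?F \<omega> = ?G \<omega> - ?K \<omega>" by (simp add: fgk sum_subtractf)
    have "?G \<omega> \<ge> 0" "?K \<omega> \<ge> 0" by (auto simp: g_def k_def intro!: sum_nonneg)
    moreover have "(?G \<omega> - ?K \<omega>)\<^sup>2 + 2 * (?G \<omega> * ?K \<omega>) = ?G \<omega> * ?G \<omega> + ?K \<omega> * ?K \<omega>"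
      by (simp add: power2_eq_square algebra_simps)
    then have "ennreal ((?G \<omega> - ?K \<omega>)\<^sup>2 + 2 * (?G \<omega> * ?K \<omega>)) = ennreal (?G \<omega> * ?G \<omega> + ?K \<omega> * ?K \<omega>)"
      by (rule arg_cong)
    ultimately show ?thesis unfolding F by (simp add: ennreal_mult del: power2_diff)
  qed
  let ?V = "\<integral>\<^sup>+\<omega>. ennreal ((?F \<omega>)\<^sup>2) \<partial>M"
  have "?V + 2 * ennreal (ensemble_moment L g k) = (\<integral>\<^sup>+\<omega>. ennreal ((?F \<omega>)\<^sup>2) + 2 * ennreal (?G \<omega> * ?K \<omega>) \<partial>M)"
    by (simp add: nn_integral_add nn_integral_cmult int)
  also have "\<dots> = ennreal (ensemble_moment L g g) + ennreal (ensemble_moment L k k)"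
    unfolding pointwise int[symmetric] by (rule nn_integral_add) measurable
  finally have eq: "?V + 2 * ennreal (ensemble_moment L g k) = ennreal (ensemble_moment L g g + ensemble_moment L k k)"
    using gg(2) kk(2) by simp
  then have "?V \<noteq> \<top>" using ennreal_add_eq_top[of ?V "2 * ennreal (ensemble_moment L g k)"] by (metis ennreal_neq_top)
  then obtain V where V: "?V = ennreal V" "V \<ge> 0" by (cases ?V) auto
  have "ennreal (V + 2 * ensemble_moment L g k) = ennreal (ensemble_moment L g g + ensemble_moment L k k)"
    using eq V gk(2) by (simp add: ennreal_mult)
  then have "V + 2 * ensemble_moment L g k = ensemble_moment L g g + ensemble_moment L k k"
    using V(2) gg(2) kk(2) gk(2) by (intro ennreal_inj[THEN iffD1]) auto
  then have "V = ensemble_moment L f f"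
    unfolding fgk ensemble_moment_diff[OF g(1) k(1)] by simp
  with V show "?V = ennreal (ensemble_moment L f f)" "ensemble_moment L f f \<ge> 0" by simp_all
qed

lemma integral_e:
  assumes "valid i" "fst i > 0"
  shows "(\<integral>x. e i x \<partial>sphere_measure) = 0"
proof -
  have "(\<lambda>x. 1) \<in> polynomials_upto 0"
    using homogeneous_const[of 1] homogeneous_subset_upto[of 0 0] by auto
  from upto_orthogonal[OF this assms] show ?thesis by (simp add: sphere_inner_def)
qed

text \<open>For mean-zero \<open>e k\<close> the moment is the full sum of squared matrix coefficients, from rows in
  \<open>I L\<close>, minus the part with columns in \<open>I L\<close>. By \<open>coupling_mass\<close> the full sum over columns is
  \<open>h l\<close>, and what remains are the columns outside.\<close>

lemma expected_energy:
  assumes H: "harmonic_ensemble L M (X :: 'w \<Rightarrow> 'a set)" and l: "l > 0"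
  shows "(\<Sum>k\<in>level l. \<integral>\<^sup>+\<omega>. ennreal ((\<Sum>x\<in>X \<omega>. e k x)\<^sup>2) \<partial>M) = ennreal (leakage l L)"
proof -
  have moment: "ensemble_moment L (e k) (e k) = npts L - (\<Sum>i\<in>I L. \<Sum>j\<in>I L. (mult_coeff (e k) i j)\<^sup>2)"
    if k: "k \<in> level l" for k
    using integral_e[of k] sphere_inner_e[of k k] k l by (simp add: ensemble_moment_def mem_level power2_eq_square)
  have "(\<Sum>k\<in>level l. \<integral>\<^sup>+\<omega>. ennreal ((\<Sum>x\<in>X \<omega>. e k x)\<^sup>2) \<partial>M) = (\<Sum>k\<in>level l. ennreal (ensemble_moment L (e k) (e k)))"
    by (intro sum.cong refl second_moment(1)[OF H] continuous_on_poly e_level_poly)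
  also have "\<dots> = ennreal (\<Sum>k\<in>level l. ensemble_moment L (e k) (e k))"
    by (intro sum_ennreal second_moment(2)[OF H] continuous_on_poly e_level_poly)
  also have "(\<Sum>k\<in>level l. ensemble_moment L (e k) (e k)) = leakage l L"
  proof -
    have "(\<Sum>k\<in>level l. \<Sum>i\<in>I L. \<Sum>j\<in>I L. (mult_coeff (e k) i j)\<^sup>2) = (\<Sum>i\<in>I L. \<Sum>k\<in>level l. \<Sum>j\<in>I L. (mult_coeff (e k) i j)\<^sup>2)"
      by (rule sum.swap)
    also have "\<dots> = (\<Sum>i\<in>I L. \<Sum>j\<in>I L. coupling l i j)"
      unfolding coupling_def by (intro sum.cong refl sum.swap)
    finally have s: "(\<Sum>k\<in>level l. \<Sum>i\<in>I L. \<Sum>j\<in>I L. (mult_coeff (e k) i j)\<^sup>2) = (\<Sum>i\<in>I L. \<Sum>j\<in>I L. coupling l i j)" .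
    have "leakage l L = (\<Sum>i\<in>I L. real (h l) - (\<Sum>j\<in>I L. coupling l i j))"
      unfolding leakage_def
    proof (intro sum.cong refl)
      fix i assume i: "i \<in> I L"
      have "(\<Sum>j\<in>I (L + l). coupling l i j) = (\<Sum>j\<in>I (L + l) - I L. coupling l i j) + (\<Sum>j\<in>I L. coupling l i j)"
        by (intro sum.subset_diff I_mono) auto
      moreover have "(\<Sum>j\<in>I (L + l). coupling l i j) = real (h l)"
        using i by (intro coupling_mass) (auto simp: mem_I)
      ultimately show "(\<Sum>j\<in>I (L + l) - I L. coupling l i j) = real (h l) - (\<Sum>j\<in>I L. coupling l i j)" by simp
    qed
    then show ?thesis by (simp add: moment sum_subtractf s card_level mult.commute npts_def)
  qed
  finally show ?thesis .
qed

end

section \<open>Completeness and pointwise expansions\<close>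

lemma polynomial_upto:
  fixes p :: "'a::euclidean_space \<Rightarrow> real"
  assumes "real_polynomial_function p"
  shows "\<exists>n. p \<in> polynomials_upto n"
  using assms
proof (induction p rule: real_polynomial_function.induct)
  case (linear f)
  interpret bounded_linear f by (rule linear)
  have "f = (\<lambda>x. \<Sum>b\<in>Basis. f b * (x \<bullet> b))"
  proof
    fix x
    have "f x = f (\<Sum>b\<in>Basis. (x \<bullet> b) *\<^sub>R b)" by (simp add: euclidean_representation)
    then show "f x = (\<Sum>b\<in>Basis. f b * (x \<bullet> b))" by (simp add: sum scaleR mult.commute)
  qed
  also have "\<dots> \<in> homogeneous_polynomials 1"
    by (intro homogeneous_sum homogeneous_cmult homogeneous_inner)
  finally show ?case using homogeneous_subset_upto[of 1 1] by blast
next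
  case (const c)
  then show ?case using homogeneous_const[of c] homogeneous_subset_upto[of 0 0] by blast
next
  case (add f g)
  then obtain m n where "f \<in> polynomials_upto m" "g \<in> polynomials_upto n" by blast
  moreover have "polynomials_upto m \<subseteq> polynomials_upto (max m n)" "polynomials_upto n \<subseteq> (polynomials_upto (max m n) :: ('a \<Rightarrow> real) set)"
    unfolding polynomials_upto_def by (intro span_mono; auto)+
  ultimately have "f \<in> polynomials_upto (max m n)" "g \<in> polynomials_upto (max m n)" by blast+
  then have "(\<lambda>x. f x + g x) \<in> polynomials_upto (max m n)"
    unfolding polynomials_upto_def by (rule span_addI)
  then show ?case by blast
next
  case (mult f g)
  then show ?case using polynomials_upto_mult by blast
qed

context harmonic_basis begin

text \<open>By Stone--Weierstrass \<open>u\<close> is a uniform limit of polynomials, which are combinations of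
  harmonics on the sphere and thus orthogonal to \<open>u\<close>; so \<open>u\<close> has norm zero.\<close>

lemma harmonics_complete:
  fixes u :: "'a \<Rightarrow> real"
  assumes u: "continuous_on (sphere 0 1) u" and 0: "\<And>i. valid i \<Longrightarrow> sphere_inner u (e i) = 0"
    and x: "x \<in> sphere 0 1"
  shows "u x = 0"
proof -
  have up: "sphere_inner u p = 0" if p: "real_polynomial_function p" for p
  proof -
    obtain n where n: "p \<in> polynomials_upto n" using polynomial_upto[OF p] by blast
    have "sphere_inner u p = sphere_inner u (\<lambda>x. \<Sum>i\<in>I n. sphere_inner p (e i) * e i x)"
      by (intro sphere_inner_cong upto_expand[OF n] refl)
    also have "\<dots> = (\<Sum>i\<in>I n. sphere_inner p (e i) * sphere_inner u (e i))"
      by (intro sphere_inner_sum_right u continuous_on_poly e_I_poly)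
    also have "\<dots> = 0" by (intro sum.neutral) (simp add: 0 mem_I)
    finally show ?thesis .
  qed
  have abs_int: "integrable sphere_measure (\<lambda>x. \<bar>u x\<bar>)" by (intro integrable_sphere continuous_intros u)
  define A where "A = (\<integral>x. \<bar>u x\<bar> \<partial>sphere_measure)"
  have A: "A \<ge> 0" unfolding A_def by simp
  have "sphere_inner u u \<le> \<epsilon>" if \<epsilon>: "\<epsilon> > 0" for \<epsilon>
  proof -
    \<comment> \<open>Adding 1 avoids division by zero if \<open>u\<close> vanishes.\<close>
    have \<delta>: "\<epsilon> / (A + 1) > 0" using A \<epsilon> by simp
    obtain p where p: "real_polynomial_function p" "\<And>x. x \<in> sphere 0 1 \<Longrightarrow> \<bar>u x - p x\<bar> < \<epsilon> / (A + 1)"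
      using Stone_Weierstrass_real_polynomial_function[OF compact_sphere u \<delta>] by metis
    have "sphere_inner u u = sphere_inner u u - sphere_inner u p" by (simp add: up p)
    also have "\<dots> = (\<integral>x. u x * u x - u x * p x \<partial>sphere_measure)"
      unfolding sphere_inner_def
      by (intro Bochner_Integration.integral_diff[symmetric] integrable_sphere continuous_intros u continuous_on_poly p)
    also have "\<dots> \<le> (\<integral>x. \<epsilon> / (A + 1) * \<bar>u x\<bar> \<partial>sphere_measure)"
    proof (intro integral_mono integrable_sphere continuous_intros u continuous_on_poly p)
      fix x :: 'a assume "x \<in> space sphere_measure"
      then have px: "\<bar>u x - p x\<bar> \<le> \<epsilon> / (A + 1)" using p(2)[of x] by (simp add: space_sphere_measure)
      have "u x * u x - u x * p x = u x * (u x - p x)" by (simp add: algebra_simps)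
      also have "\<dots> \<le> \<bar>u x\<bar> * \<bar>u x - p x\<bar>" by (metis abs_ge_self abs_mult)
      also have "\<dots> \<le> \<bar>u x\<bar> * (\<epsilon> / (A + 1))" by (intro mult_left_mono px) simp
      finally show "u x * u x - u x * p x \<le> \<epsilon> / (A + 1) * \<bar>u x\<bar>" by (simp add: mult.commute)
    qed
    also have "\<dots> = \<epsilon> * (A / (A + 1))" by (simp add: A_def[symmetric])
    also have "\<dots> \<le> \<epsilon> * 1" using A \<epsilon> by (intro mult_left_mono) auto
    finally show ?thesis by simp
  qed
  then have "sphere_inner u u \<le> 0" by (rule field_le_epsilon[of _ 0, simplified])
  moreover have "sphere_inner u u \<ge> 0" by (simp add: sphere_inner_def)
  ultimately have "sphere_inner u u = 0" by (rule antisym)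
  then have "(\<integral>x. (u x)\<^sup>2 \<partial>sphere_measure) = 0" by (simp add: sphere_inner_def power2_eq_square)
  then show ?thesis by (rule sphere_integral_square_zero[OF u _ x])
qed

definition level_part :: "('a \<Rightarrow> real) \<Rightarrow> nat \<Rightarrow> 'a \<Rightarrow> real" where
  "level_part f l x = (\<Sum>i\<in>level l. sphere_inner f (e i) * e i x)"

definition level_energy :: "('a \<Rightarrow> real) \<Rightarrow> nat \<Rightarrow> real" where
  "level_energy f l = (\<Sum>i\<in>level l. (sphere_inner f (e i))\<^sup>2)"

lemma level_energy_nonneg: "level_energy f l \<ge> 0"
  by (simp add: level_energy_def sum_nonneg)

text \<open>Cauchy--Schwarz bounds the square of the left-hand side by the product of \<open>level_energy f l\<close> and
  \<open>h l\<close>; the weight \<open>w\<close> distributes over the two factors.\<close>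

lemma level_part_bound:
  assumes "x \<in> sphere 0 1" "w > 0"
  shows "\<bar>level_part f l x\<bar> \<le> level_energy f l / w + w * real (h l)"
proof -
  define a b where "a = level_energy f l" and "b = real (h l)"
  have ab: "a \<ge> 0" "b \<ge> 0" by (auto simp: a_def b_def level_energy_nonneg)
  have "(level_part f l x)\<^sup>2 \<le> a * b"
    using Cauchy_Schwarz_ineq_sum[of "\<lambda>i. sphere_inner f (e i)" "\<lambda>i. e i x" "level l"] addition_theorem[OF assms(1), of l]
    by (simp add: level_part_def level_energy_def a_def b_def)
  also have "\<dots> = (a / w) * (w * b)" using assms(2) by simp
  also have "\<dots> \<le> (a / w + w * b)\<^sup>2"
    using ab assms(2) by (simp add: power2_eq_square algebra_simps)
  finally have "\<bar>level_part f l x\<bar> \<le> \<bar>a / w + w * b\<bar>" by (rule abs_le_square_iff[THEN iffD2])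
  then show ?thesis using ab assms(2) by (simp add: a_def b_def)
qed

text \<open>The series converges uniformly by the Weierstrass test. Its limit is continuous and has the same
  coefficients as \<open>f\<close>, so it is \<open>f\<close> by completeness.\<close>

lemma expansion_sums:
  assumes f: "continuous_on (sphere 0 1) f"
    and w: "\<And>l. w l > 0" and s1: "summable (\<lambda>l. level_energy f l / w l)" and s2: "summable (\<lambda>l. w l * real (h l))"
    and x: "x \<in> sphere 0 1"
  shows "(\<lambda>n. \<Sum>l<n. level_part f l x) \<longlonglongrightarrow> f x"
proof -
  \<comment> \<open>The majorant of \<open>level_part_bound\<close>.\<close>
  define m where "m l = level_energy f l / w l + w l * real (h l)" for l
  have sm: "summable m" unfolding m_def by (rule summable_add[OF s1 s2])
  have bound: "\<bar>level_part f l x\<bar> \<le> m l" if "x \<in> sphere 0 1" for l x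
    unfolding m_def by (rule level_part_bound[OF that w])
  have m0: "m l \<ge> 0" for l using w[of l] by (auto simp: m_def level_energy_nonneg intro!: add_nonneg_nonneg divide_nonneg_pos)
  define g where "g x = (\<Sum>l. level_part f l x)" for x
  have ul: "uniform_limit (sphere 0 1) (\<lambda>n x. \<Sum>l<n. level_part f l x) g sequentially"
    unfolding g_def by (rule Weierstrass_m_test[OF _ sm]) (use bound in auto)
  have cpart: "continuous_on (sphere 0 1) (\<lambda>x. \<Sum>l<n. level_part f l x)" for n
    unfolding level_part_def by (intro continuous_intros continuous_on_poly e_level_poly)
  have cg: "continuous_on (sphere 0 1) g"
    by (rule uniform_limit_theorem[OF _ ul]) (auto intro!: always_eventually cpart)
  have lim: "(\<lambda>n. \<Sum>l<n. level_part f l x) \<longlonglongrightarrow> g x" if "x \<in> sphere 0 1" for x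
    by (rule tendsto_uniform_limitI[OF ul that])
  have inner_g: "sphere_inner g (e j) = sphere_inner f (e j)" if j: "valid j" for j
  proof -
    have "(\<lambda>n. \<integral>x. (\<Sum>l<n. level_part f l x) * e j x \<partial>sphere_measure) \<longlonglongrightarrow> (\<integral>x. g x * e j x \<partial>sphere_measure)"
    proof (rule integral_dominated_convergence[where w="\<lambda>x. suminf m * \<bar>e j x\<bar>"])
      show "(\<lambda>x. g x * e j x) \<in> borel_measurable sphere_measure"
        by (intro borel_measurable_sphere continuous_intros cg cont_e j)
      show "(\<lambda>x. (\<Sum>l<n. level_part f l x) * e j x) \<in> borel_measurable sphere_measure" for n
        by (intro borel_measurable_sphere continuous_on_mult cpart cont_e j)
      show "integrable sphere_measure (\<lambda>x. suminf m * \<bar>e j x\<bar>)"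
        by (intro integrable_sphere continuous_intros cont_e j)
      show "AE x in sphere_measure. (\<lambda>n. (\<Sum>l<n. level_part f l x) * e j x) \<longlonglongrightarrow> g x * e j x"
        by (intro AE_I2 tendsto_mult tendsto_const lim) (simp add: space_sphere_measure)
      show "AE x in sphere_measure. norm ((\<Sum>l<n. level_part f l x) * e j x) \<le> suminf m * \<bar>e j x\<bar>" for n
      proof (rule AE_I2)
        fix x :: 'a assume "x \<in> space sphere_measure"
        then have x: "x \<in> sphere 0 1" by (simp add: space_sphere_measure)
        have "\<bar>\<Sum>l<n. level_part f l x\<bar> \<le> (\<Sum>l<n. \<bar>level_part f l x\<bar>)" by (rule sum_abs)
        also have "\<dots> \<le> (\<Sum>l<n. m l)" by (intro sum_mono bound x)
        also have "\<dots> \<le> suminf m" by (intro sum_le_suminf sm) (auto simp: m0)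
        finally show "norm ((\<Sum>l<n. level_part f l x) * e j x) \<le> suminf m * \<bar>e j x\<bar>"
          by (simp add: abs_mult mult_right_mono)
      qed
    qed
    moreover have "(\<integral>x. (\<Sum>l<n. level_part f l x) * e j x \<partial>sphere_measure) = sphere_inner f (e j)" if n: "n > fst j" for n
    proof -
      have In: "{..<n} = {..n - 1}" using n by auto
      have "(\<integral>x. (\<Sum>l<n. level_part f l x) * e j x \<partial>sphere_measure) = sphere_inner (\<lambda>x. \<Sum>i\<in>I (n - 1). sphere_inner f (e i) * e i x) (e j)"
        by (simp add: sphere_inner_def level_part_def sum_I In)
      also have "\<dots> = sphere_inner f (e j)"
        using n j by (subst sphere_inner_combination) (auto simp: mem_I)
      finally show ?thesis .
    qed
    then have "(\<lambda>n. \<integral>x. (\<Sum>l<n. level_part f l x) * e j x \<partial>sphere_measure) \<longlonglongrightarrow> sphere_inner f (e j)"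
      by (intro tendsto_eventually eventually_mono[OF eventually_gt_at_top[of "fst j"]])
    ultimately show ?thesis unfolding sphere_inner_def[of g] by (rule LIMSEQ_unique)
  qed
  have "f x - g x = 0"
  proof (rule harmonics_complete[OF _ _ x])
    show "continuous_on (sphere 0 1) (\<lambda>x. f x - g x)" by (intro continuous_intros f cg)
    show "sphere_inner (\<lambda>x. f x - g x) (e i) = 0" if i: "valid i" for i
    proof -
      have "sphere_inner (\<lambda>x. f x - g x) (e i) = (\<integral>x. f x * e i x - g x * e i x \<partial>sphere_measure)"
        by (simp add: sphere_inner_def algebra_simps)
      also have "\<dots> = sphere_inner f (e i) - sphere_inner g (e i)"
        unfolding sphere_inner_def
        by (intro Bochner_Integration.integral_diff integrable_sphere continuous_intros f cg cont_e i)
      finally show ?thesis by (simp add: inner_g[OF i])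
    qed
  qed
  then show ?thesis using lim[OF x] by simp
qed

text \<open>Harmonics of degree 0 are constant. Applied to the constant 1, the expansion shows that their
  squares sum up to 1.\<close>

lemma level_part_0:
  assumes f: "continuous_on (sphere 0 1) f" and x: "x \<in> sphere 0 1"
  shows "level_part f 0 x = (\<integral>x. f x \<partial>sphere_measure)"
proof -
  have const: "e i y = e i x" if "i \<in> level 0" for i y
  proof -
    have "e i \<in> homogeneous_polynomials 0"
      using that harmonic_homogeneous[OF e_harmonic, of i] by (simp add: mem_level)
    from homogeneous_scaleR[OF this, of 0 y] homogeneous_scaleR[OF this, of 0 x] show ?thesis by simp
  qed
  have inner: "sphere_inner f (e i) = e i x * (\<integral>x. f x \<partial>sphere_measure)" if "i \<in> level 0" for i and f :: "'a \<Rightarrow> real"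
  proof -
    have "sphere_inner f (e i) = (\<integral>y. f y * e i x \<partial>sphere_measure)"
      unfolding sphere_inner_def by (intro integral_sphere_cong arg_cong2[of _ _ _ _ "(*)"] refl const[OF that])
    then show ?thesis by simp
  qed
  have "(\<lambda>x::'a. 1) \<in> polynomials_upto 0"
    using homogeneous_const[of 1] homogeneous_subset_upto[of 0 0] by auto
  from upto_expand[OF this x] have "1 = (\<Sum>i\<in>level 0. e i x * e i x)"
    by (simp add: sum_I inner sphere.prob_space)
  moreover have "level_part f 0 x = (\<Sum>i\<in>level 0. e i x * e i x) * (\<integral>x. f x \<partial>sphere_measure)"
    unfolding level_part_def sum_distrib_right by (intro sum.cong refl) (simp add: inner)
  ultimately show ?thesis by simp
qed

section \<open>The worst-case error\<close>

definition point_energy :: "nat \<Rightarrow> 'a set \<Rightarrow> real" where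
  "point_energy l P = (\<Sum>i\<in>level l. (\<Sum>x\<in>P. e i x)\<^sup>2)"

lemma point_energy_nonneg: "point_energy l P \<ge> 0"
  by (simp add: point_energy_def sum_nonneg)

lemma fourier_coeff_eq:
  assumes "k \<in> {1..h l}" shows "fourier_coeff Y f l k = sphere_inner f (e (l, k))"
  unfolding fourier_coeff_def sphere_inner_def
  using assms by (intro integral_sphere_cong) (simp add: Y_sphere e_def)

lemma sum_fourier_coeff:
  "(\<Sum>k = 1..dim (spherical_harmonics l :: ('a \<Rightarrow> real) set). c * \<bar>fourier_coeff Y f l k\<bar>\<^sup>2) = c * level_energy f l"
  unfolding level_energy_def sum_level h_def[symmetric] sum_distrib_left
  by (intro sum.cong refl) (simp add: fourier_coeff_eq)

lemma sobolev_norm_eq: "sobolev_norm Y w f = sqrt (\<Sum>l. 1 / w l * level_energy f l)"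
  unfolding sobolev_norm_def sum_fourier_coeff ..

lemma sobolev_space_iff:
  assumes "continuous_on (sphere 0 1) f"
  shows "f \<in> sobolev_space Y s \<longleftrightarrow> summable (\<lambda>l. (1 + lam l) powr s * level_energy f l)"
  unfolding sobolev_space_def sum_fourier_coeff lam_def
  using borel_measurable_sphere[OF assms] integrable_sphere[of "\<lambda>x. (f x)\<^sup>2"] assms
  by (auto intro!: continuous_intros)

lemma lam_ge: "lam l \<ge> (real l)\<^sup>2"
  using dim2 by (simp add: lam_def sphere_eigenvalue_def power2_eq_square mult_left_mono)

text \<open>The bound is attained by the representer of the error functional restricted to the degrees
  \<open>1, \<dots>, m\<close>, normalised in the Sobolev norm.\<close>

lemma wce_lower:
  assumes w: "\<And>l. w l > 0" and P: "finite P" "P \<subseteq> sphere 0 1"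
  shows "ennreal (\<Sum>l=1..m. w l * point_energy l P / (real (card P))\<^sup>2) \<le> (wce Y w s P)\<^sup>2"
proof -
  define n where "n = real (card P)"
  define b where "b i = (\<Sum>x\<in>P. e i x) / n" for i
  define J where "J = (\<Union>l\<in>{1..m}. level l)"
  have J: "finite J" "\<And>i. i \<in> J \<longleftrightarrow> valid i \<and> 1 \<le> fst i \<and> fst i \<le> m"
    by (auto simp: J_def mem_level)
  have sumJ: "(\<Sum>i\<in>J. g i) = (\<Sum>l=1..m. \<Sum>i\<in>level l. g i)" for g :: "_ \<Rightarrow> real"
    unfolding J_def by (rule sum.UNION_disjoint) (auto simp: level_def)
  define B where "B = (\<Sum>i\<in>J. w (fst i) * (b i)\<^sup>2)"
  have B: "(\<Sum>l=1..m. w l * point_energy l P / (real (card P))\<^sup>2) = B"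
    unfolding B_def sumJ point_energy_def n_def[symmetric]
    by (intro sum.cong refl) (simp add: b_def power_divide mem_level flip: sum_distrib_left sum_divide_distrib)
  have Bnn: "B \<ge> 0" unfolding B_def using w by (intro sum_nonneg) (simp add: less_imp_le)
  show ?thesis
  proof (cases "B = 0")
    case True
    then show ?thesis using B by simp
  next
    case False
    then have Bp: "B > 0" using Bnn by simp
    \<comment> \<open>Coefficients of the normalised representer; the error functional has coefficients \<open>b i\<close>.\<close>
    define c where "c i = w (fst i) * b i / sqrt B" for i
    define f where "f x = (\<Sum>i\<in>J. c i * e i x)" for x
    have cf: "continuous_on (sphere 0 1) f"
      unfolding f_def by (intro continuous_intros cont_e) (simp add: J)
    have fc: "sphere_inner f (e i) = (if i \<in> J then c i else 0)" if "valid i" for i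
      unfolding f_def using that J by (intro sphere_inner_combination) auto
    have en: "level_energy f l = (if l \<in> {1..m} then \<Sum>i\<in>level l. (c i)\<^sup>2 else 0)" for l
      unfolding level_energy_def by (auto simp: fc mem_level J intro!: sum.cong sum.neutral)
    have "f \<in> sobolev_space Y s"
      unfolding sobolev_space_iff[OF cf]
      by (rule summable_finite[of "{1..m}"]) (auto simp: en)
    moreover have "sobolev_norm Y w f = 1"
    proof -
      have "(\<Sum>l. 1 / w l * level_energy f l) = (\<Sum>l\<in>{1..m}. 1 / w l * level_energy f l)"
        by (rule suminf_finite) (auto simp: en)
      also have "\<dots> = (\<Sum>i\<in>J. 1 / w (fst i) * (c i)\<^sup>2)"
        unfolding sumJ by (intro sum.cong refl) (simp add: en sum_distrib_left mem_level)
      also have "\<dots> = (\<Sum>i\<in>J. w (fst i) * (b i)\<^sup>2 / B)"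
        using w Bp by (intro sum.cong refl) (simp add: c_def power_divide power_mult_distrib power2_eq_square field_simps less_imp_neq[symmetric])
      also have "\<dots> = 1" using Bp by (simp add: sum_divide_distrib[symmetric] B_def[symmetric])
      finally show ?thesis by (simp add: sobolev_norm_eq)
    qed
    moreover have "(\<Sum>x\<in>P. f x) / n - (\<integral>x. f x \<partial>sphere_measure) = sqrt B"
    proof -
      have "(\<integral>x. f x \<partial>sphere_measure) = (\<Sum>i\<in>J. c i * (\<integral>x. e i x \<partial>sphere_measure))"
        unfolding f_def
        by (subst Bochner_Integration.integral_sum) (auto intro!: integrable_sphere continuous_intros cont_e simp: J)
      also have "\<dots> = 0" by (intro sum.neutral) (auto simp: J integral_e)
      finally have "(\<integral>x. f x \<partial>sphere_measure) = 0" .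
      moreover have "(\<Sum>x\<in>P. f x) / n = (\<Sum>i\<in>J. c i * b i)"
        unfolding f_def b_def by (subst sum.swap) (simp add: sum_distrib_left sum_divide_distrib)
      moreover have "(\<Sum>i\<in>J. c i * b i) = B / sqrt B"
        unfolding B_def sum_divide_distrib by (intro sum.cong refl) (simp add: c_def B_def power2_eq_square)
      ultimately show ?thesis using Bp by (simp add: real_div_sqrt)
    qed
    ultimately have "ennreal (sqrt B) \<le> wce Y w s P"
      unfolding wce_def n_def using cf Bnn by (intro SUP_upper2[of f]) auto
    then have "(ennreal (sqrt B))\<^sup>2 \<le> (wce Y w s P)\<^sup>2" by (intro power_mono) auto
    then show ?thesis using Bnn B by (simp add: ennreal_power)
  qed
qed

text \<open>The error of \<open>f\<close> is the limit of its partial sums over degrees, by the pointwise expansion; for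
  these, Cauchy--Schwarz with weights \<open>w\<close> separates the norm of \<open>f\<close> from the energy of the points.
  The term of degree 0 cancels against the integral.\<close>

lemma wce_upper:
  assumes w: "\<And>l. w l > 0" and c: "c > 0" "\<And>l. c * (1 + (real l)\<^sup>2) powr - s \<le> w l"
    and sh: "summable (\<lambda>l. w l * real (h l))" and s: "s \<ge> 0"
    and P: "finite P" "P \<subseteq> sphere 0 1" "P \<noteq> {}"
  shows "(wce Y w s P)\<^sup>2 \<le> (\<Sum>l. ennreal (w (Suc l) * point_energy (Suc l) P / (real (card P))\<^sup>2))"
    (is "_ \<le> ?T")
proof (cases "?T = \<infinity>")
  case False
  define n where "n = real (card P)"
  have n: "n > 0" using P by (simp add: n_def card_gt_0_iff)
  obtain t where t: "?T = ennreal t" "t \<ge> 0" using False by (cases ?T) auto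
  have part: "(\<Sum>l<m. w (Suc l) * point_energy (Suc l) P / n\<^sup>2) \<le> t" for m
  proof -
    have nn: "0 \<le> w l * point_energy l P / n\<^sup>2" for l
      using w[of l] point_energy_nonneg by (simp add: less_imp_le)
    have "ennreal (\<Sum>l<m. w (Suc l) * point_energy (Suc l) P / n\<^sup>2) = (\<Sum>l<m. ennreal (w (Suc l) * point_energy (Suc l) P / n\<^sup>2))"
      by (rule sum_ennreal[symmetric]) (rule nn)
    also have "\<dots> \<le> ?T" unfolding n_def by (rule sum_le_suminf) auto
    finally show ?thesis using t by (simp add: ennreal_le_iff)
  qed
  have "ennreal \<bar>(\<Sum>x\<in>P. f x) / real (card P) - (\<integral>x. f x \<partial>sphere_measure)\<bar> \<le> ennreal (sqrt t)"
    if f: "f \<in> sobolev_space Y s" "continuous_on (sphere 0 1) f" "sobolev_norm Y w f \<le> 1" for f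
  proof -
    have s1: "summable (\<lambda>l. level_energy f l / w l)"
    proof (rule summable_comparison_test')
      show "summable (\<lambda>l. 1 / c * ((1 + lam l) powr s * level_energy f l))"
        using f(1) sobolev_space_iff[OF f(2)] by (intro summable_mult) simp
      fix l :: nat
      have "c \<le> c * ((1 + (real l)\<^sup>2) powr - s * (1 + lam l) powr s)"
      proof -
        have "(1 + (real l)\<^sup>2) powr s \<le> (1 + lam l) powr s"
          using lam_ge[of l] s by (intro powr_mono2) auto
        then have "1 \<le> (1 + (real l)\<^sup>2) powr - s * (1 + lam l) powr s"
        proof -
          have "1 = (1 + (real l)\<^sup>2) powr - s * (1 + (real l)\<^sup>2) powr s"
            by (simp add: powr_add[symmetric] add_pos_nonneg less_imp_neq[symmetric])
          also have "\<dots> \<le> (1 + (real l)\<^sup>2) powr - s * (1 + lam l) powr s"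
            using \<open>(1 + (real l)\<^sup>2) powr s \<le> (1 + lam l) powr s\<close> by (intro mult_left_mono) auto
          finally show ?thesis .
        qed
        from mult_left_mono[OF this less_imp_le[OF c(1)]] show ?thesis by simp
      qed
      also have "\<dots> = (c * (1 + (real l)\<^sup>2) powr - s) * (1 + lam l) powr s" by simp
      also have "\<dots> \<le> w l * (1 + lam l) powr s" by (intro mult_right_mono c(2)) simp
      finally have "1 / w l \<le> 1 / c * (1 + lam l) powr s"
        using w[of l] c(1) by (simp add: field_simps)
      from mult_right_mono[OF this level_energy_nonneg[of f l]]
      show "norm (level_energy f l / w l) \<le> 1 / c * ((1 + lam l) powr s * level_energy f l)"
        using w[of l] level_energy_nonneg[of f l] by (simp add: abs_mult)
    qed
    have norm1: "(\<Sum>l<m. level_energy f (Suc l) / w (Suc l)) \<le> 1" for m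
    proof -
      have nn: "0 \<le> level_energy f l / w l" for l using w[of l] level_energy_nonneg[of f l] by simp
      have "(\<Sum>l<m. level_energy f (Suc l) / w (Suc l)) = (\<Sum>l\<in>Suc ` {..<m}. level_energy f l / w l)"
        by (simp add: sum.reindex)
      also have "\<dots> \<le> (\<Sum>l. level_energy f l / w l)" by (intro sum_le_suminf s1 nn) auto
      also have "\<dots> \<le> 1" using f(3) by (simp add: sobolev_norm_eq)
      finally show ?thesis .
    qed
    define E where "E m = (\<Sum>l<m. (\<Sum>x\<in>P. level_part f (Suc l) x) / n)" for m
    have E_lim: "E \<longlonglongrightarrow> (\<Sum>x\<in>P. f x) / n - (\<integral>x. f x \<partial>sphere_measure)"
    proof -
      have "(\<lambda>m. (\<Sum>x\<in>P. \<Sum>l<Suc m. level_part f l x) / n) \<longlonglongrightarrow> (\<Sum>x\<in>P. f x) / n"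
        using P n by (intro tendsto_divide tendsto_sum tendsto_const LIMSEQ_Suc expansion_sums[OF f(2) w s1 sh]) auto
      moreover have "(\<Sum>x\<in>P. \<Sum>l<Suc m. level_part f l x) / n = E m + (\<integral>x. f x \<partial>sphere_measure)" for m
      proof -
        have "(\<Sum>x\<in>P. \<Sum>l<Suc m. level_part f l x) = (\<Sum>x\<in>P. level_part f 0 x) + (\<Sum>x\<in>P. \<Sum>l<m. level_part f (Suc l) x)"
          by (simp add: sum.lessThan_Suc_shift sum.distrib del: sum.lessThan_Suc)
        also have "(\<Sum>x\<in>P. level_part f 0 x) = n * (\<integral>x. f x \<partial>sphere_measure)"
          using P level_part_0[OF f(2)] by (simp add: n_def subset_iff)
        also have "(\<Sum>x\<in>P. \<Sum>l<m. level_part f (Suc l) x) = (\<Sum>l<m. \<Sum>x\<in>P. level_part f (Suc l) x)"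
          by (rule sum.swap)
        finally show ?thesis using n by (simp add: E_def add_divide_distrib sum_divide_distrib)
      qed
      ultimately have "(\<lambda>m. E m + (\<integral>x. f x \<partial>sphere_measure)) \<longlonglongrightarrow> (\<Sum>x\<in>P. f x) / n" by simp
      from tendsto_diff[OF this tendsto_const[of "\<integral>x. f x \<partial>sphere_measure"]] show ?thesis by simp
    qed
    have E_le: "\<bar>E m\<bar> \<le> sqrt t" for m
    proof -
      define a b where "a l = sqrt (level_energy f (Suc l) / w (Suc l))" and "b l = sqrt (w (Suc l) * point_energy (Suc l) P / n\<^sup>2)" for l
      have termwise: "\<bar>(\<Sum>x\<in>P. level_part f (Suc l) x) / n\<bar> \<le> a l * b l" for l
      proof -
        let ?S = "\<Sum>x\<in>P. level_part f (Suc l) x"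
        have "?S = (\<Sum>i\<in>level (Suc l). sphere_inner f (e i) * (\<Sum>x\<in>P. e i x))"
          unfolding level_part_def sum_distrib_left by (rule sum.swap)
        then have "?S\<^sup>2 \<le> level_energy f (Suc l) * point_energy (Suc l) P"
          unfolding level_energy_def point_energy_def by (simp only: Cauchy_Schwarz_ineq_sum)
        then have "(?S / n)\<^sup>2 \<le> level_energy f (Suc l) * point_energy (Suc l) P / n\<^sup>2"
          using n by (simp add: power_divide divide_right_mono)
        also have "\<dots> = (a l * b l)\<^sup>2"
          using w[of "Suc l"] level_energy_nonneg[of f "Suc l"] point_energy_nonneg[of "Suc l" P]
          by (simp add: a_def b_def power_mult_distrib less_imp_neq[symmetric])
        finally have "\<bar>?S / n\<bar> \<le> \<bar>a l * b l\<bar>" by (rule abs_le_square_iff[THEN iffD2])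
        moreover have "a l \<ge> 0" "b l \<ge> 0"
          using w[of "Suc l"] level_energy_nonneg[of f "Suc l"] point_energy_nonneg[of "Suc l" P] by (auto simp: a_def b_def)
        ultimately show ?thesis by simp
      qed
      have "\<bar>E m\<bar> \<le> (\<Sum>l<m. a l * b l)"
        unfolding E_def by (intro order_trans[OF sum_abs] sum_mono termwise)
      also have "\<dots> \<le> sqrt t"
      proof (rule real_le_rsqrt)
        have "(\<Sum>l<m. a l * b l)\<^sup>2 \<le> (\<Sum>l<m. (a l)\<^sup>2) * (\<Sum>l<m. (b l)\<^sup>2)" by (rule Cauchy_Schwarz_ineq_sum)
        also have "(\<Sum>l<m. (a l)\<^sup>2) = (\<Sum>l<m. level_energy f (Suc l) / w (Suc l))"
          using w level_energy_nonneg by (intro sum.cong refl) (simp add: a_def less_imp_le)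
        also have "(\<Sum>l<m. (b l)\<^sup>2) = (\<Sum>l<m. w (Suc l) * point_energy (Suc l) P / n\<^sup>2)"
          using w point_energy_nonneg by (intro sum.cong refl) (simp add: b_def less_imp_le)
        also have "(\<Sum>l<m. level_energy f (Suc l) / w (Suc l)) * (\<Sum>l<m. w (Suc l) * point_energy (Suc l) P / n\<^sup>2) \<le> 1 * t"
          using w point_energy_nonneg by (intro mult_mono norm1 part sum_nonneg) (auto simp: less_imp_le)
        finally show "(\<Sum>l<m. a l * b l)\<^sup>2 \<le> t" by simp
      qed
      finally show ?thesis .
    qed
    have "\<bar>(\<Sum>x\<in>P. f x) / n - (\<integral>x. f x \<partial>sphere_measure)\<bar> \<le> sqrt t"
      by (rule LIMSEQ_le_const2[OF tendsto_rabs[OF E_lim]]) (use E_le in auto)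
    then show ?thesis by (simp add: n_def ennreal_leI)
  qed
  then have "wce Y w s P \<le> ennreal (sqrt t)" unfolding wce_def by (intro SUP_least) auto
  then have "(wce Y w s P)\<^sup>2 \<le> (ennreal (sqrt t))\<^sup>2" by (intro power_mono) auto
  then show ?thesis using t by (simp add: ennreal_power)
qed simp

lemma expected_point_energy:
  assumes H: "harmonic_ensemble L M (X :: 'w \<Rightarrow> 'a set)" and l: "l > 0"
  shows "(\<lambda>\<omega>. point_energy l (X \<omega>)) \<in> borel_measurable M"
    and "(\<integral>\<^sup>+\<omega>. ennreal (point_energy l (X \<omega>)) \<partial>M) = ennreal (leakage l L)"
proof -
  have X: "sphere_point_process M X" using H by (simp add: harmonic_ensemble_def)
  have m: "(\<lambda>\<omega>. \<Sum>x\<in>X \<omega>. e i x) \<in> borel_measurable M" if "i \<in> level l" for i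
    by (intro real_linear_statistic_measurable[OF X] continuous_on_poly e_level_poly[OF that])
  show "(\<lambda>\<omega>. point_energy l (X \<omega>)) \<in> borel_measurable M"
    unfolding point_energy_def by (intro borel_measurable_sum borel_measurable_power m)
  have "(\<integral>\<^sup>+\<omega>. ennreal (point_energy l (X \<omega>)) \<partial>M) = (\<integral>\<^sup>+\<omega>. (\<Sum>i\<in>level l. ennreal ((\<Sum>x\<in>X \<omega>. e i x)\<^sup>2)) \<partial>M)"
    unfolding point_energy_def by (simp add: sum_ennreal)
  also have "\<dots> = (\<Sum>i\<in>level l. \<integral>\<^sup>+\<omega>. ennreal ((\<Sum>x\<in>X \<omega>. e i x)\<^sup>2) \<partial>M)"
    using m by (intro nn_integral_sum) measurable
  finally show "(\<integral>\<^sup>+\<omega>. ennreal (point_energy l (X \<omega>)) \<partial>M) = ennreal (leakage l L)"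
    using expected_energy[OF H l] by simp
qed

lemma mean_square_wce_lower:
  assumes H: "harmonic_ensemble L M (X :: 'w \<Rightarrow> 'a set)" and w: "\<And>l. w l > 0"
  shows "ennreal (\<Sum>l=1..m. w l * leakage l L / (npts L)\<^sup>2) \<le> mean_square_wce Y w s M X"
proof -
  have X: "sphere_point_process M X" using H by (simp add: harmonic_ensemble_def)
  have cN: "AE \<omega> in M. real (card (X \<omega>)) = npts L"
    using H by (simp add: harmonic_ensemble_def dim_sphere_polynomials npts_def)
  have "ennreal (\<Sum>l=1..m. w l * leakage l L / (npts L)\<^sup>2) = (\<Sum>l=1..m. ennreal (w l / (npts L)\<^sup>2) * ennreal (leakage l L))"
    using w leakage_nonneg
    by (subst sum_ennreal[symmetric]) (auto simp: ennreal_mult[symmetric] less_imp_le)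
  also have "\<dots> = (\<Sum>l=1..m. \<integral>\<^sup>+\<omega>. ennreal (w l / (npts L)\<^sup>2) * ennreal (point_energy l (X \<omega>)) \<partial>M)"
  proof (intro sum.cong refl)
    fix l assume "l \<in> {1..m}"
    then have l: "l > 0" by simp
    note [measurable] = expected_point_energy(1)[OF H l]
    show "ennreal (w l / (npts L)\<^sup>2) * ennreal (leakage l L) = (\<integral>\<^sup>+\<omega>. ennreal (w l / (npts L)\<^sup>2) * ennreal (point_energy l (X \<omega>)) \<partial>M)"
      unfolding expected_point_energy(2)[OF H l, symmetric] by (rule nn_integral_cmult[symmetric]) measurable
  qed
  also have "\<dots> = (\<integral>\<^sup>+\<omega>. (\<Sum>l=1..m. ennreal (w l / (npts L)\<^sup>2) * ennreal (point_energy l (X \<omega>))) \<partial>M)"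
  proof (intro nn_integral_sum[symmetric])
    fix l assume "l \<in> {1..m}"
    then have l: "l > 0" by simp
    note [measurable] = expected_point_energy(1)[OF H l]
    show "(\<lambda>\<omega>. ennreal (w l / (npts L)\<^sup>2) * ennreal (point_energy l (X \<omega>))) \<in> borel_measurable M" by measurable
  qed
  also have "\<dots> \<le> mean_square_wce Y w s M X"
    unfolding mean_square_wce_def
  proof (rule nn_integral_mono_AE)
    show "AE \<omega> in M. (\<Sum>l=1..m. ennreal (w l / (npts L)\<^sup>2) * ennreal (point_energy l (X \<omega>))) \<le> (wce Y w s (X \<omega>))\<^sup>2"
      using cN AE_space
    proof eventually_elim
      case (elim \<omega>)
      have "(\<Sum>l=1..m. ennreal (w l / (npts L)\<^sup>2) * ennreal (point_energy l (X \<omega>))) = ennreal (\<Sum>l=1..m. w l * point_energy l (X \<omega>) / (npts L)\<^sup>2)"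
        using w point_energy_nonneg
        by (subst sum_ennreal[symmetric]) (auto simp: ennreal_mult[symmetric] less_imp_le)
      also have "\<dots> \<le> (wce Y w s (X \<omega>))\<^sup>2"
        using wce_lower[OF w sphere_point_process_finite[OF X elim(2)]] elim(1) by simp
      finally show ?case .
    qed
  qed
  finally show ?thesis .
qed

lemma mean_square_wce_upper:
  assumes H: "harmonic_ensemble L M (X :: 'w \<Rightarrow> 'a set)"
    and w: "\<And>l. w l > 0" and c: "c > 0" "\<And>l. c * (1 + (real l)\<^sup>2) powr - s \<le> w l"
    and sh: "summable (\<lambda>l. w l * real (h l))" and s: "s \<ge> 0"
  shows "mean_square_wce Y w s M X \<le> (\<Sum>l. ennreal (w (Suc l) * leakage (Suc l) L / (npts L)\<^sup>2))"
proof -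
  have X: "sphere_point_process M X" using H by (simp add: harmonic_ensemble_def)
  have cN: "AE \<omega> in M. real (card (X \<omega>)) = npts L"
    using H by (simp add: harmonic_ensemble_def dim_sphere_polynomials npts_def)
  have "mean_square_wce Y w s M X \<le> (\<integral>\<^sup>+\<omega>. (\<Sum>l. ennreal (w (Suc l) / (npts L)\<^sup>2) * ennreal (point_energy (Suc l) (X \<omega>))) \<partial>M)"
    unfolding mean_square_wce_def
  proof (rule nn_integral_mono_AE)
    show "AE \<omega> in M. (wce Y w s (X \<omega>))\<^sup>2 \<le> (\<Sum>l. ennreal (w (Suc l) / (npts L)\<^sup>2) * ennreal (point_energy (Suc l) (X \<omega>)))"
      using cN AE_space
    proof eventually_elim
      case (elim \<omega>)
      have ne: "X \<omega> \<noteq> {}" using elim(1) npts_pos[of L] by (auto simp: npts_def)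
      have "(wce Y w s (X \<omega>))\<^sup>2 \<le> (\<Sum>l. ennreal (w (Suc l) * point_energy (Suc l) (X \<omega>) / (real (card (X \<omega>)))\<^sup>2))"
        by (rule wce_upper[OF w c sh s sphere_point_process_finite[OF X elim(2)] ne])
      also have "\<dots> = (\<Sum>l. ennreal (w (Suc l) / (npts L)\<^sup>2) * ennreal (point_energy (Suc l) (X \<omega>)))"
        using w point_energy_nonneg by (simp add: ennreal_mult[symmetric] less_imp_le elim(1))
      finally show ?case .
    qed
  qed
  also have "\<dots> = (\<Sum>l. \<integral>\<^sup>+\<omega>. ennreal (w (Suc l) / (npts L)\<^sup>2) * ennreal (point_energy (Suc l) (X \<omega>)) \<partial>M)"
  proof (rule nn_integral_suminf)
    fix l
    note [measurable] = expected_point_energy(1)[OF H zero_less_Suc[of l]]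
    show "(\<lambda>\<omega>. ennreal (w (Suc l) / (npts L)\<^sup>2) * ennreal (point_energy (Suc l) (X \<omega>))) \<in> borel_measurable M" by measurable
  qed
  also have "\<dots> = (\<Sum>l. ennreal (w (Suc l) * leakage (Suc l) L / (npts L)\<^sup>2))"
  proof (intro suminf_cong)
    fix l
    note [measurable] = expected_point_energy(1)[OF H zero_less_Suc[of l]]
    have "(\<integral>\<^sup>+\<omega>. ennreal (w (Suc l) / (npts L)\<^sup>2) * ennreal (point_energy (Suc l) (X \<omega>)) \<partial>M) = ennreal (w (Suc l) / (npts L)\<^sup>2) * ennreal (leakage (Suc l) L)"
      unfolding expected_point_energy(2)[OF H zero_less_Suc, symmetric] by (rule nn_integral_cmult) measurable
    then show "(\<integral>\<^sup>+\<omega>. ennreal (w (Suc l) / (npts L)\<^sup>2) * ennreal (point_energy (Suc l) (X \<omega>)) \<partial>M) = ennreal (w (Suc l) * leakage (Suc l) L / (npts L)\<^sup>2)"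
      using w[of "Suc l"] leakage_nonneg[of "Suc l" L] by (simp add: ennreal_mult[symmetric] less_imp_le)
  qed
  finally show ?thesis .
qed

end

section \<open>Elementary estimates\<close>

text \<open>In the step, Bernoulli's inequality for a power of \<open>1 - 1 / x\<close> bounds the increment of
  \<open>x ^ Suc k\<close> by \<open>Suc k * x ^ k\<close>.\<close>

lemma sum_powers_ge: "(\<Sum>m\<le>L. real (Suc m) ^ k) * real (Suc k) \<ge> real (Suc L) ^ Suc k"
proof (induction L)
  case (Suc L)
  let ?x = "real (Suc (Suc L))"
  have "?x ^ Suc k - real (Suc k) * ?x ^ k \<le> real (Suc L) ^ Suc k"
  proof -
    have "1 + real (Suc k) * (- 1 / ?x) \<le> (1 + (- 1 / ?x)) ^ Suc k"
      by (rule Bernoulli_inequality) simp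
    from mult_left_mono[OF this, of "?x ^ Suc k"]
    have "?x ^ Suc k * (1 + real (Suc k) * (- 1 / ?x)) \<le> (?x * (1 + (- 1 / ?x))) ^ Suc k"
      unfolding power_mult_distrib by simp
    moreover have "?x * (1 + (- 1 / ?x)) = real (Suc L)" by (simp add: field_simps)
    moreover have "?x ^ Suc k * (1 + real (Suc k) * (- 1 / ?x)) = ?x ^ Suc k - real (Suc k) * ?x ^ k"
      by (simp add: field_simps)
    ultimately show ?thesis by metis
  qed
  with Suc show ?case by (simp add: distrib_right mult.commute[of "real (Suc k)"] del: of_nat_Suc power_Suc)
qed simp

text \<open>The mean value theorem; the bound on \<open>z\<close> serves for positive \<open>p\<close>, where it bounds an increase
  from below, as well as for negative \<open>p\<close>, where it bounds a decrease from below.\<close>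

lemma powr_increment:
  fixes x p :: real
  assumes x: "x > 0" and p: "p \<le> 1"
  obtains z where "(x + 1) powr p - x powr p = p * z" "z \<ge> (x + 1) powr (p - 1)"
proof -
  have "\<exists>y>x. y < x + 1 \<and> (x + 1) powr p - x powr p = (x + 1 - x) * (p * y powr (p - 1))"
    by (rule MVT2) (use x in \<open>auto intro!: derivative_eq_intros\<close>)
  then obtain y where y: "y > x" "y < x + 1" "(x + 1) powr p - x powr p = p * y powr (p - 1)" by auto
  moreover have "y powr (p - 1) \<ge> (x + 1) powr (p - 1)"
    using y x p by (intro powr_mono2') auto
  ultimately show ?thesis by (intro that)
qed

text \<open>Comparison with a telescoping sum. For \<open>l < T\<close> the terms are about \<open>l\<close> to the power
  \<open>1 - \<gamma>\<close>, with partial sums growing like \<open>T\<close> to the power \<open>2 - \<gamma>\<close>; beyond \<open>T\<close> they are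
  \<open>T\<close> times a summable power, with a tail of the same order.\<close>

lemma truncated_power_sum:
  fixes \<gamma> :: real
  assumes \<gamma>: "1 < \<gamma>" "\<gamma> < 2" and T: "T \<ge> 1"
  shows "(\<Sum>l<n. real (Suc (Suc l)) powr - \<gamma> * real (min (Suc l) T)) \<le> (1 / (2 - \<gamma>) + 1 / (\<gamma> - 1)) * real T powr (2 - \<gamma>)"
proof -
  let ?t = "\<lambda>l. real (Suc (Suc l)) powr - \<gamma> * real (min (Suc l) T)"
  \<comment> \<open>Constant in its second summand up to \<open>T\<close> and in its first summand from \<open>T\<close> on.\<close>
  define \<phi> where "\<phi> l = real (min l T) powr (2 - \<gamma>) / (2 - \<gamma>) + real T * (real T powr (1 - \<gamma>) - real (max l T) powr (1 - \<gamma>)) / (\<gamma> - 1)" for l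
  have step: "?t l \<le> \<phi> (Suc (Suc l)) - \<phi> (Suc l)" for l
  proof (cases "Suc l < T")
    case True
    obtain z where z: "(real (Suc l) + 1) powr (2 - \<gamma>) - real (Suc l) powr (2 - \<gamma>) = (2 - \<gamma>) * z" "z \<ge> (real (Suc l) + 1) powr (2 - \<gamma> - 1)"
      using powr_increment[of "real (Suc l)" "2 - \<gamma>"] \<gamma> by auto
    have "?t l \<le> real (Suc (Suc l)) powr - \<gamma> * real (Suc (Suc l))"
      by (intro mult_left_mono) auto
    also have "\<dots> = real (Suc (Suc l)) powr (1 - \<gamma>)"
      using powr_add[of "real (Suc (Suc l))" "- \<gamma>" 1] by simp
    also have "\<dots> \<le> z" using z(2) by (simp add: add.commute)
    also have "\<dots> = ((real (Suc l) + 1) powr (2 - \<gamma>) - real (Suc l) powr (2 - \<gamma>)) / (2 - \<gamma>)"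
      using z(1) \<gamma> by (simp add: field_simps)
    also have "\<dots> = \<phi> (Suc (Suc l)) - \<phi> (Suc l)"
      using True by (simp add: \<phi>_def diff_divide_distrib min_def max_def add.commute)
    finally show ?thesis .
  next
    case False
    obtain z where z: "(real (Suc l) + 1) powr (1 - \<gamma>) - real (Suc l) powr (1 - \<gamma>) = (1 - \<gamma>) * z" "z \<ge> (real (Suc l) + 1) powr (1 - \<gamma> - 1)"
      using powr_increment[of "real (Suc l)" "1 - \<gamma>"] \<gamma> by auto
    have "?t l = real T * real (Suc (Suc l)) powr - \<gamma>"
      using False by (simp add: min_def)
    also have "\<dots> \<le> real T * z" using z(2) by (intro mult_left_mono) (auto simp: add.commute)
    also have "z = (real (Suc l) powr (1 - \<gamma>) - (real (Suc l) + 1) powr (1 - \<gamma>)) / (\<gamma> - 1)"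
    proof -
      have "real (Suc l) powr (1 - \<gamma>) - (real (Suc l) + 1) powr (1 - \<gamma>) = (\<gamma> - 1) * z"
        using z(1) by (simp add: algebra_simps)
      then show ?thesis using \<gamma> by (simp add: field_simps)
    qed
    also have "real T * ((real (Suc l) powr (1 - \<gamma>) - (real (Suc l) + 1) powr (1 - \<gamma>)) / (\<gamma> - 1)) = \<phi> (Suc (Suc l)) - \<phi> (Suc l)"
      using False by (simp add: \<phi>_def min_def max_def add.commute diff_divide_distrib[symmetric] right_diff_distrib)
    finally show ?thesis .
  qed
  have "(\<Sum>l<n. ?t l) \<le> (\<Sum>l<n. \<phi> (Suc (Suc l)) - \<phi> (Suc l))"
    by (intro sum_mono step)
  also have "\<dots> = \<phi> (Suc n) - \<phi> 1" using sum_lessThan_telescope[of "\<lambda>l. \<phi> (Suc l)" n] by simp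
  also have "\<dots> \<le> (1 / (2 - \<gamma>) + 1 / (\<gamma> - 1)) * real T powr (2 - \<gamma>)"
  proof -
    have "\<phi> 1 \<ge> 0" using \<gamma> T by (simp add: \<phi>_def max_def min_def)
    moreover have "real (min (Suc n) T) powr (2 - \<gamma>) / (2 - \<gamma>) \<le> real T powr (2 - \<gamma>) / (2 - \<gamma>)"
      using \<gamma> by (intro divide_right_mono powr_mono2) auto
    moreover have "real T * (real T powr (1 - \<gamma>) - real (max (Suc n) T) powr (1 - \<gamma>)) / (\<gamma> - 1) \<le> real T powr (2 - \<gamma>) / (\<gamma> - 1)"
    proof (rule divide_right_mono)
      have "real T * (real T powr (1 - \<gamma>) - real (max (Suc n) T) powr (1 - \<gamma>)) \<le> real T * real T powr (1 - \<gamma>)"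
        by (intro mult_left_mono) auto
      also have "\<dots> = real T powr (2 - \<gamma>)" using powr_add[of "real T" 1 "1 - \<gamma>"] T by simp
      finally show "real T * (real T powr (1 - \<gamma>) - real (max (Suc n) T) powr (1 - \<gamma>)) \<le> real T powr (2 - \<gamma>)" .
    qed (use \<gamma> in simp)
    ultimately show ?thesis unfolding \<phi>_def[of "Suc n"] by (simp add: distrib_right)
  qed
  finally show ?thesis .
qed

lemma powr_square: "(x powr a)\<^sup>2 = x powr (2 * a)" for x a :: real
  by (simp add: power2_eq_square flip: powr_add)

lemma weight_powr_bounds:
  fixes s :: real
  assumes s: "s \<ge> 0"
  shows "(1 + (real l)\<^sup>2) powr - s \<le> 2 powr s * real (Suc l) powr (- 2 * s)"
    and "real (Suc l) powr (- 2 * s) \<le> (1 + (real l)\<^sup>2) powr - s"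
proof -
  have pos: "0 < 1 + (real l)\<^sup>2" by (simp add: add_pos_nonneg)
  have sq: "real (Suc l) powr (- 2 * s) = ((real (Suc l))\<^sup>2) powr - s"
  proof -
    have "((real (Suc l))\<^sup>2) powr - s = (real (Suc l) powr 2) powr - s" by simp
    also have "\<dots> = real (Suc l) powr (2 * - s)" by (rule powr_powr)
    finally show ?thesis by simp
  qed
  have "(real (Suc l))\<^sup>2 \<le> 2 * (1 + (real l)\<^sup>2)"
    using zero_le_power2[of "real l - 1"] by (simp add: power2_eq_square algebra_simps)
  then have "(2 * (1 + (real l)\<^sup>2)) powr - s \<le> ((real (Suc l))\<^sup>2) powr - s"
    using s by (intro powr_mono2') (auto simp del: of_nat_Suc)
  moreover have "(2 * (1 + (real l)\<^sup>2)) powr - s = 2 powr - s * (1 + (real l)\<^sup>2) powr - s"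
    by (subst powr_mult) auto
  ultimately have "2 powr s * (2 powr - s * (1 + (real l)\<^sup>2) powr - s) \<le> 2 powr s * ((real (Suc l))\<^sup>2) powr - s"
    by (intro mult_left_mono) auto
  moreover have "2 powr s * (2 powr - s * (1 + (real l)\<^sup>2) powr - s) = (1 + (real l)\<^sup>2) powr - s"
    by (simp add: powr_minus)
  ultimately show "(1 + (real l)\<^sup>2) powr - s \<le> 2 powr s * real (Suc l) powr (- 2 * s)" by (simp only: sq)
  have "1 + (real l)\<^sup>2 \<le> (real (Suc l))\<^sup>2" by (simp add: power2_eq_square algebra_simps)
  then show "real (Suc l) powr (- 2 * s) \<le> (1 + (real l)\<^sup>2) powr - s"
    unfolding sq using s pos by (intro powr_mono2') auto
qed

context harmonic_basis begin

section \<open>Asymptotics of the mean square error\<close>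

lemma card_I_bounds:
  assumes d: "DIM('a) = d + 1" "d \<ge> 1"
  obtains c C where "c > 0" "C > 0" "\<And>L. c * real (Suc L) powr d \<le> npts L" "\<And>L. npts L \<le> C * real (Suc L) powr d"
    "\<And>m. c * real (Suc m) powr (real d - 1) \<le> real (h m)" "\<And>m. real (h m) \<le> C * real (Suc m) powr (real d - 1)"
proof -
  obtain k where k: "d = Suc k" using d(2) by (cases d) auto
  have dk: "DIM('a) = Suc (Suc k)" using d k by simp
  obtain c C where cC: "c > 0" "C > 0" "\<And>m. c * real (Suc m) ^ k \<le> real (h m)" "\<And>m. real (h m) \<le> C * real (Suc m) ^ k"
    using h_bounds[OF dk] by blast
  have pk: "real (Suc m) powr (real d - 1) = real (Suc m) ^ k" for m
    by (simp add: k powr_realpow del: of_nat_Suc) (simp add: powr_realpow)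
  have pd: "real (Suc m) powr real d = real (Suc m) ^ Suc k" for m
    by (simp only: k powr_realpow of_nat_0_less_iff zero_less_Suc)
  define c' where "c' = c / real (Suc k)"
  have c': "c' > 0" "c' \<le> c" using cC(1) by (auto simp: c'_def field_simps)
  show ?thesis
  proof (rule that[of c' C])
    show "c' * real (Suc L) powr real d \<le> npts L" for L
    proof -
      have "c' * real (Suc L) ^ Suc k \<le> c' * ((\<Sum>m\<le>L. real (Suc m) ^ k) * real (Suc k))"
        using c' by (intro mult_left_mono sum_powers_ge) auto
      also have "\<dots> = (\<Sum>m\<le>L. c * real (Suc m) ^ k)" by (simp add: c'_def sum_distrib_left)
      also have "\<dots> \<le> (\<Sum>m\<le>L. real (h m))" by (intro sum_mono cC)
      finally show ?thesis unfolding pd npts_def card_I of_nat_sum .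
    qed
    show "npts L \<le> C * real (Suc L) powr real d" for L
    proof -
      have "npts L \<le> (\<Sum>m\<le>L. C * real (Suc L) ^ k)"
        unfolding npts_def card_I of_nat_sum
      proof (intro sum_mono)
        fix m assume "m \<in> {..L}"
        then have "C * real (Suc m) ^ k \<le> C * real (Suc L) ^ k"
          using cC(2) by (intro mult_left_mono power_mono) auto
        with cC(4)[of m] show "real (h m) \<le> C * real (Suc L) ^ k" by linarith
      qed
      also have "\<dots> = C * real (Suc L) ^ Suc k" by simp
      finally show ?thesis by (simp only: pd)
    qed
    show "c' * real (Suc m) powr (real d - 1) \<le> real (h m)" for m
      unfolding pk using cC(3)[of m] c' by (meson mult_right_mono order_trans of_nat_0_le_iff zero_le_power)
    show "real (h m) \<le> C * real (Suc m) powr (real d - 1)" for m unfolding pk by (rule cC)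
  qed (use c' cC in auto)
qed

lemma leakage_ge:
  assumes d: "DIM('a) = d + 1" "d \<ge> 1" and l: "1 \<le> l" "l \<le> Suc L"
  shows "real (h l) * real l * npts L / ((real d + 3) * real (Suc L)) \<le> leakage l L"
proof -
  let ?D = "2 * real L + real l + real d - 1"
  have dd: "real DIM('a) - 2 = real d - 1" by (simp add: d)
  have D: "?D > 0" using l d by simp
  have "real (h l) * (real l * (real l + real d - 1)) * npts L \<le> leakage l L * (real l * ?D)"
    using leakage_lower[of l L] by (simp add: lam_def sphere_eigenvalue_def d algebra_simps)
  then have "real l * (real (h l) * (real l + real d - 1) * npts L) \<le> real l * (leakage l L * ?D)"
    by (simp only: mult_ac)
  then have 1: "real (h l) * (real l + real d - 1) * npts L \<le> leakage l L * ?D"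
    by (rule mult_left_le_imp_le) (use l in simp)
  have "real (h l) * real l * npts L \<le> real (h l) * (real l + real d - 1) * npts L"
    using d by (intro mult_right_mono mult_left_mono) auto
  also note 1
  also have "leakage l L * ?D \<le> leakage l L * ((real d + 3) * real (Suc L))"
  proof (intro mult_left_mono leakage_nonneg)
    have "?D \<le> 3 * real (Suc L) + real d * 1" using l by simp
    also have "\<dots> \<le> 3 * real (Suc L) + real d * real (Suc L)" by (intro add_left_mono mult_left_mono) auto
    finally show "?D \<le> (real d + 3) * real (Suc L)" by (simp add: algebra_simps)
  qed
  finally show ?thesis by (simp add: divide_le_eq)
qed

lemma leakage_le:
  assumes C: "C > 0" "\<And>m. real (h m) \<le> C * real (Suc m) powr p" and p: "p \<ge> 0"
  shows "leakage l L \<le> real (h l) * (C * real (Suc L) powr p * real (min l (Suc L)))"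
proof -
  let ?A = "{m. m \<le> L \<and> L < m + l}"
  have "card ?A \<le> card {Suc L - l..L}" by (intro card_mono) auto
  moreover have "card {Suc L - l..L} \<le> min l (Suc L)" by simp
  ultimately have card: "card ?A \<le> min l (Suc L)" by linarith
  have "real (\<Sum>m\<in>?A. h m) \<le> (\<Sum>m\<in>?A. C * real (Suc L) powr p)"
    unfolding of_nat_sum
  proof (intro sum_mono)
    fix m assume "m \<in> ?A"
    then have "C * real (Suc m) powr p \<le> C * real (Suc L) powr p"
      using C(1) p by (intro mult_left_mono powr_mono2) auto
    with C(2)[of m] show "real (h m) \<le> C * real (Suc L) powr p" by linarith
  qed
  also have "\<dots> = C * real (Suc L) powr p * real (card ?A)" by simp
  also have "\<dots> \<le> C * real (Suc L) powr p * real (min l (Suc L))"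
    using C(1) card by (intro mult_left_mono) (auto simp del: min_less_iff_conj)
  finally have "real (\<Sum>m\<in>?A. h m) \<le> C * real (Suc L) powr p * real (min l (Suc L))" .
  from mult_left_mono[OF this, of "real (h l)"] leakage_upper[of l L] show ?thesis by linarith
qed

lemma sobolev_weight_bounds:
  assumes "sobolev_weight s w" "s \<ge> 0"
  obtains c1 c2 where "c1 > 0" "c2 > 0" "\<And>l. w l > 0" "\<And>l. c1 * (1 + (real l)\<^sup>2) powr - s \<le> w l"
    "\<And>l. c1 * real (Suc l) powr (- 2 * s) \<le> w l" "\<And>l. w l \<le> c2 * real (Suc l) powr (- 2 * s)"
proof -
  obtain c1 c2 where c: "c1 > 0" "c2 > 0" "\<And>l. w l > 0" "\<And>l. c1 * (1 + (real l)\<^sup>2) powr - s \<le> w l" "\<And>l. w l \<le> c2 * (1 + (real l)\<^sup>2) powr - s"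
    using assms(1) unfolding sobolev_weight_def by metis
  show ?thesis
  proof (rule that[of c1 "c2 * 2 powr s"])
    show "c1 * real (Suc l) powr (- 2 * s) \<le> w l" for l
      using mult_left_mono[OF weight_powr_bounds(2)[OF assms(2), of l], of c1] c(1) c(4)[of l] by linarith
    show "w l \<le> c2 * 2 powr s * real (Suc l) powr (- 2 * s)" for l
    proof -
      have "w l \<le> c2 * (2 powr s * real (Suc l) powr (- 2 * s))"
        by (rule order_trans[OF c(5) mult_left_mono[OF weight_powr_bounds(1)[OF assms(2)]]]) (use c(2) in simp)
      then show ?thesis by (simp only: mult.assoc)
    qed
  qed (use c in auto)
qed

text \<open>The product of \<open>w l\<close> and \<open>h l\<close> decays like \<open>l\<close> to the power \<open>- \<gamma>\<close> with
  \<open>\<gamma> = 2 s - d + 1\<close>. The condition on \<open>s\<close> is \<open>1 < \<gamma> < 2\<close>, the range in which both parts of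
  \<open>truncated_power_sum\<close> have the order of their common boundary term.\<close>

lemma mean_square_upper_rate:
  assumes d: "DIM('a) = d + 1" "d \<ge> 1" and s: "real d / 2 < s" "s < (real d + 1) / 2"
    and w: "sobolev_weight s w"
  shows "\<exists>D>0. \<forall>L (M :: 'w measure) X. harmonic_ensemble L M X \<longrightarrow>
    mean_square_wce Y w s M X \<le> ennreal (D * npts L powr (- 2 * s / real d))"
proof -
  have s0: "s \<ge> 0" using s d by linarith
  obtain c C where cC: "c > 0" "C > 0" "\<And>L. c * real (Suc L) powr d \<le> npts L" "\<And>L. npts L \<le> C * real (Suc L) powr d"
    "\<And>m. c * real (Suc m) powr (real d - 1) \<le> real (h m)" "\<And>m. real (h m) \<le> C * real (Suc m) powr (real d - 1)"
    using card_I_bounds[OF d] by metis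
  obtain c1 c2 where w: "c1 > 0" "c2 > 0" "\<And>l. w l > 0" "\<And>l. c1 * (1 + (real l)\<^sup>2) powr - s \<le> w l"
    "\<And>l. w l \<le> c2 * real (Suc l) powr (- 2 * s)"
    using sobolev_weight_bounds[OF w s0] by metis
  define \<gamma> where "\<gamma> = 2 * s - real d + 1"
  have \<gamma>: "1 < \<gamma>" "\<gamma> < 2" using s by (auto simp: \<gamma>_def field_simps)
  have wh: "w l * real (h l) \<le> c2 * C * real (Suc l) powr - \<gamma>" for l
  proof -
    have "w l * real (h l) \<le> (c2 * real (Suc l) powr (- 2 * s)) * (C * real (Suc l) powr (real d - 1))"
      using w cC by (intro mult_mono) (auto intro: mult_nonneg_nonneg less_imp_le)
    also have "\<dots> = c2 * C * (real (Suc l) powr (- 2 * s) * real (Suc l) powr (real d - 1))" by simp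
    also have "real (Suc l) powr (- 2 * s) * real (Suc l) powr (real d - 1) = real (Suc l) powr - \<gamma>"
      by (simp add: powr_add[symmetric] \<gamma>_def algebra_simps del: of_nat_Suc)
    finally show ?thesis .
  qed
  have sh: "summable (\<lambda>l. w l * real (h l))"
  proof (rule summable_comparison_test')
    have "summable (\<lambda>l. real l powr - \<gamma>)" using \<gamma> by (simp add: summable_real_powr_iff)
    then have "summable (\<lambda>l. real (Suc l) powr - \<gamma>)" by (subst summable_Suc_iff)
    then show "summable (\<lambda>l. c2 * C * real (Suc l) powr - \<gamma>)" by (rule summable_mult)
    show "norm (w l * real (h l)) \<le> c2 * C * real (Suc l) powr - \<gamma>" for l
      using wh[of l] w(3)[of l] by (simp add: abs_mult del: of_nat_Suc)
  qed
  define A where "A = 1 / (2 - \<gamma>) + 1 / (\<gamma> - 1)"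
  define D where "D = c2 * C * C * A * C powr (2 * s / d) / c\<^sup>2"
  have A: "A > 0" using \<gamma> by (simp add: A_def add_pos_pos)
  have "mean_square_wce Y w s M X \<le> ennreal (D * npts L powr (- 2 * s / real d))"
    if H: "harmonic_ensemble L M X" for L and M :: "'w measure" and X
  proof -
    let ?T = "real (Suc L)"
    let ?K = "c2 * C * C * ?T powr (real d - 1) / (npts L)\<^sup>2"
    let ?t = "\<lambda>l. real (Suc (Suc l)) powr - \<gamma> * real (min (Suc l) (Suc L))"
    let ?v = "\<lambda>l. w (Suc l) * leakage (Suc l) L / (npts L)\<^sup>2"
    have N: "npts L > 0" by (rule npts_pos)
    have term_le: "?v l \<le> ?K * (?t l)" for l
    proof -
      have "w (Suc l) * leakage (Suc l) L \<le> w (Suc l) * (real (h (Suc l)) * (C * ?T powr (real d - 1) * real (min (Suc l) (Suc L))))"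
        using w(3)[of "Suc l"] d by (intro mult_left_mono leakage_le cC) auto
      also have "\<dots> = (w (Suc l) * real (h (Suc l))) * (C * ?T powr (real d - 1) * real (min (Suc l) (Suc L)))" by simp
      also have "\<dots> \<le> (c2 * C * real (Suc (Suc l)) powr - \<gamma>) * (C * ?T powr (real d - 1) * real (min (Suc l) (Suc L)))"
        using cC(2) by (intro mult_right_mono wh) auto
      finally show ?thesis using N by (simp add: divide_right_mono mult_ac)
    qed
    have "mean_square_wce Y w s M X \<le> (\<Sum>l. ennreal (?v l))"
      by (rule mean_square_wce_upper[OF H w(3) w(1) w(4) sh s0])
    also have "\<dots> \<le> ennreal (?K * (A * ?T powr (2 - \<gamma>)))"
    proof (rule suminf_le_const)
      show "summable (\<lambda>l. ennreal (?v l))" by simp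
      fix n
      have "(\<Sum>l<n. ennreal (?v l)) = ennreal (\<Sum>l<n. ?v l)"
        using w(3) leakage_nonneg by (intro sum_ennreal) (simp add: less_imp_le)
      also have "\<dots> \<le> ennreal (\<Sum>l<n. ?K * (?t l))"
        by (intro ennreal_leI sum_mono term_le)
      also have "\<dots> \<le> ennreal (?K * (A * ?T powr (2 - \<gamma>)))"
        unfolding sum_distrib_left[symmetric] A_def
        using w(2) cC(2) by (intro ennreal_leI mult_left_mono truncated_power_sum \<gamma>) auto
      finally show "(\<Sum>l<n. ennreal (?v l)) \<le> ennreal (?K * (A * ?T powr (2 - \<gamma>)))" .
    qed
    also have "\<dots> \<le> ennreal (D * npts L powr (- 2 * s / real d))"
    proof (rule ennreal_leI)
      \<comment> \<open>The exponent is \<open>2 d - 2 s\<close>. The lower bound on the number of points controls the first part,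
        the upper bound the second, whose exponent is negative.\<close>
      have "?T powr (real d - 1) * ?T powr (2 - \<gamma>) = (?T powr d)\<^sup>2 * (?T powr d) powr (- 2 * s / d)"
      proof -
        have "real d - 1 + (2 - \<gamma>) = 2 * real d + real d * (- 2 * s / real d)" using d by (simp add: \<gamma>_def)
        then show ?thesis by (simp only: powr_square powr_powr powr_add[symmetric])
      qed
      also have "\<dots> \<le> (npts L / c)\<^sup>2 * (npts L / C) powr (- 2 * s / d)"
      proof (intro mult_mono power_mono powr_mono2')
        show "?T powr real d \<le> npts L / c" using cC(1) cC(3)[of L] by (simp add: field_simps)
        show "npts L / C \<le> ?T powr real d" using cC(2) cC(4)[of L] by (simp add: field_simps)
        show "- 2 * s / real d \<le> 0" using s0 by simp
      qed (use N cC in auto)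
      also have "\<dots> = (npts L)\<^sup>2 / c\<^sup>2 * (npts L powr (- 2 * s / d) * C powr (2 * s / d))"
        using N cC(2) by (simp add: power_divide powr_divide powr_minus field_simps)
      finally have "?T powr (real d - 1) * ?T powr (2 - \<gamma>) \<le> (npts L)\<^sup>2 / c\<^sup>2 * (npts L powr (- 2 * s / d) * C powr (2 * s / d))" .
      from mult_left_mono[OF this, of "c2 * C * C * A / (npts L)\<^sup>2"]
      have "c2 * C * C * A / (npts L)\<^sup>2 * (?T powr (real d - 1) * ?T powr (2 - \<gamma>)) \<le> c2 * C * C * A / (npts L)\<^sup>2 * ((npts L)\<^sup>2 / c\<^sup>2 * (npts L powr (- 2 * s / d) * C powr (2 * s / d)))"
        using A cC w by simp
      also have "\<dots> = D * npts L powr (- 2 * s / real d)" using N by (simp add: D_def)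
      finally show "?K * (A * ?T powr (2 - \<gamma>)) \<le> D * npts L powr (- 2 * s / real d)"
        by (simp add: mult_ac)
    qed
    finally show ?thesis .
  qed
  moreover have "D > 0" using w cC A by (simp add: D_def)
  ultimately show ?thesis by blast
qed

text \<open>At this exponent \<open>w l * h l * l\<close> is of order \<open>1 / l\<close>, while the lower bound for the leakage
  contributes the same factor for all degrees up to \<open>L\<close>.\<close>

lemma mean_square_lower_critical:
  assumes d: "DIM('a) = d + 1" "d \<ge> 1" and w: "sobolev_weight ((real d + 1) / 2) w"
  shows "\<exists>D>0. \<forall>L (M :: 'w measure) X. harmonic_ensemble L M X \<longrightarrow>
    ennreal (D * (\<Sum>l=1..L. 1 / real (Suc l)))
      \<le> ennreal (npts L powr ((real d + 1) / real d)) * mean_square_wce Y w ((real d + 1) / 2) M X"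
proof -
  let ?s = "(real d + 1) / 2"
  let ?u = "\<lambda>l. real (h l) * real l"
  obtain c C where cC: "c > 0" "C > 0" "\<And>L. c * real (Suc L) powr d \<le> npts L" "\<And>L. npts L \<le> C * real (Suc L) powr d"
    "\<And>m. c * real (Suc m) powr (real d - 1) \<le> real (h m)" "\<And>m. real (h m) \<le> C * real (Suc m) powr (real d - 1)"
    using card_I_bounds[OF d] by metis
  obtain c1 where w: "c1 > 0" "\<And>l. w l > 0" "\<And>l. c1 * real (Suc l) powr (- 2 * ?s) \<le> w l"
  proof (rule sobolev_weight_bounds[OF w])
    show "0 \<le> ?s" by simp
  qed (rule that)
  define D where "D = c1 * c / 2 / (real d + 3) * c powr (1 / d)"
  have "ennreal (D * (\<Sum>l=1..L. 1 / real (Suc l))) \<le> ennreal (npts L powr ((real d + 1) / real d)) * mean_square_wce Y w ?s M X"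
    if H: "harmonic_ensemble L M X" for L and M :: "'w measure" and X
  proof -
    let ?T = "real (Suc L)"
    have N: "npts L > 0" by (rule npts_pos)
    have wh: "c1 * c / 2 * (1 / real (Suc l)) \<le> w l * (?u l)" if l: "l \<ge> 1" for l
    proof -
      have "c1 * c / 2 * (1 / real (Suc l)) = c1 * c * (real (Suc l) powr (- 2 * ?s) * real (Suc l) powr (real d - 1)) * (real (Suc l) / 2)"
      proof -
        have "- 2 * ?s + (real d - 1) = - 2" by (simp add: field_simps)
        then have "real (Suc l) powr (- 2 * ?s) * real (Suc l) powr (real d - 1) = real (Suc l) powr (- 2)"
          by (simp only: powr_add[symmetric])
        also have "\<dots> = 1 / (real (Suc l))\<^sup>2" by (simp add: powr_minus_divide)
        finally show ?thesis by (simp add: power2_eq_square del: of_nat_Suc)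
      qed
      also have "\<dots> \<le> c1 * c * (real (Suc l) powr (- 2 * ?s) * real (Suc l) powr (real d - 1)) * real l"
        using l w(1) cC(1) by (intro mult_left_mono) auto
      also have "\<dots> = (c1 * real (Suc l) powr (- 2 * ?s)) * ((c * real (Suc l) powr (real d - 1)) * real l)" by (simp only: mult_ac)
      also have "\<dots> \<le> w l * (?u l)"
        using w(1) w(2)[of l] cC(1) by (intro mult_mono w(3) cC(5)) (auto intro!: mult_nonneg_nonneg)
      finally show ?thesis .
    qed
    have "D * (\<Sum>l=1..L. 1 / real (Suc l)) \<le> npts L powr ((real d + 1) / d) * (\<Sum>l=1..L. w l * leakage l L / (npts L)\<^sup>2)"
    proof -
      have T: "c powr (1 / d) * ?T \<le> npts L powr (1 / d)"
      proof -
        have "c powr (1 / d) * ?T = (c * ?T powr d) powr (1 / d)"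
          using cC(1) d by (simp add: powr_mult powr_powr del: of_nat_Suc)
        also have "\<dots> \<le> npts L powr (1 / d)" using cC by (intro powr_mono2) auto
        finally show ?thesis .
      qed
      have NN: "npts L powr ((real d + 1) / d) = npts L * npts L powr (1 / d)"
        using N d by (simp add: powr_add add_divide_distrib)
      have "D * (\<Sum>l=1..L. 1 / real (Suc l)) = (\<Sum>l=1..L. c powr (1 / d) / (real d + 3) * (c1 * c / 2 * (1 / real (Suc l))))"
        unfolding sum_distrib_left by (simp only: D_def divide_inverse mult_ac)
      also have "\<dots> \<le> (\<Sum>l=1..L. npts L powr ((real d + 1) / d) * (w l * leakage l L / (npts L)\<^sup>2))"
      proof (intro sum_mono)
        fix l assume l: "l \<in> {1..L}"
        have "c powr (1 / d) / (real d + 3) * (c1 * c / 2 * (1 / real (Suc l))) \<le> (npts L powr (1 / d) / ?T) / (real d + 3) * (w l * (?u l))"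
        proof (rule mult_mono)
          have "c powr (1 / d) \<le> npts L powr (1 / d) / ?T" using T by (simp add: pos_le_divide_eq)
          then show "c powr (1 / d) / (real d + 3) \<le> npts L powr (1 / d) / ?T / (real d + 3)"
            by (rule divide_right_mono) simp
          show "c1 * c / 2 * (1 / real (Suc l)) \<le> w l * (?u l)" using l by (intro wh) simp
        qed (use w(1) cC(1) in auto)
        also have "\<dots> = npts L powr ((real d + 1) / d) * (w l * (?u l * npts L / ((real d + 3) * ?T)) / (npts L)\<^sup>2)"
          unfolding NN using N by (simp add: power2_eq_square)
        also have "\<dots> \<le> npts L powr ((real d + 1) / d) * (w l * leakage l L / (npts L)\<^sup>2)"
          using l w(2)[of l] by (intro mult_left_mono divide_right_mono leakage_ge d) auto
        finally show "c powr (1 / d) / (real d + 3) * (c1 * c / 2 * (1 / real (Suc l))) \<le> npts L powr ((real d + 1) / d) * (w l * leakage l L / (npts L)\<^sup>2)" .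
      qed
      finally show ?thesis by (simp add: sum_distrib_left)
    qed
    then have "ennreal (D * (\<Sum>l=1..L. 1 / real (Suc l))) \<le> ennreal (npts L powr ((real d + 1) / d) * (\<Sum>l=1..L. w l * leakage l L / (npts L)\<^sup>2))"
      by (rule ennreal_leI)
    also have "\<dots> = ennreal (npts L powr ((real d + 1) / d)) * ennreal (\<Sum>l=1..L. w l * leakage l L / (npts L)\<^sup>2)"
      using w(2) leakage_nonneg by (intro ennreal_mult sum_nonneg) (auto simp: less_imp_le)
    also have "\<dots> \<le> ennreal (npts L powr ((real d + 1) / d)) * mean_square_wce Y w ?s M X"
      by (intro mult_left_mono mean_square_wce_lower[OF H w(2)]) simp
    finally show ?thesis .
  qed
  moreover have "D > 0" using w cC by (simp add: D_def)
  ultimately show ?thesis by blast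
qed

text \<open>The term of degree one suffices, and its order does not depend on \<open>s\<close>.\<close>

lemma mean_square_lower_supercritical:
  assumes d: "DIM('a) = d + 1" "d \<ge> 1" and w: "\<And>l. w l > 0"
  shows "\<exists>D>0. \<forall>L (M :: 'w measure) X. harmonic_ensemble L M X \<longrightarrow>
    ennreal (D * npts L powr (- (real d + 1) / real d)) \<le> mean_square_wce Y w s M X"
proof -
  obtain c C where cC: "c > 0" "C > 0" "\<And>L. c * real (Suc L) powr d \<le> npts L" "\<And>L. npts L \<le> C * real (Suc L) powr d"
    "\<And>m. c * real (Suc m) powr (real d - 1) \<le> real (h m)" "\<And>m. real (h m) \<le> C * real (Suc m) powr (real d - 1)"
    using card_I_bounds[OF d] by metis
  define D where "D = w 1 * real (h 1) / (real d + 3) * c powr (1 / d)"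
  have "ennreal (D * npts L powr (- (real d + 1) / real d)) \<le> mean_square_wce Y w s M X"
    if H: "harmonic_ensemble L M X" for L and M :: "'w measure" and X
  proof -
    let ?T = "real (Suc L)"
    have N: "npts L > 0" by (rule npts_pos)
    have T: "c powr (1 / d) * ?T \<le> npts L powr (1 / d)"
    proof -
      have "c powr (1 / d) * ?T = (c * ?T powr d) powr (1 / d)"
        using cC(1) d by (simp add: powr_mult powr_powr del: of_nat_Suc)
      also have "\<dots> \<le> npts L powr (1 / d)" using cC by (intro powr_mono2) auto
      finally show ?thesis .
    qed
    have e: "- (real d + 1) / real d = - 1 - 1 / d" using d by (simp add: field_simps)
    have NN: "npts L powr (- (real d + 1) / real d) = 1 / (npts L * npts L powr (1 / d))"
      unfolding e using N by (simp add: powr_diff powr_minus_divide)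
    have "D * npts L powr (- (real d + 1) / real d) \<le> w 1 * (real (h 1) * real 1 * npts L / ((real d + 3) * ?T)) / (npts L)\<^sup>2"
    proof -
      have "D * npts L powr (- (real d + 1) / real d) = w 1 * real (h 1) / (real d + 3) / npts L * (c powr (1 / d) / npts L powr (1 / d))"
        unfolding NN D_def by simp
      also have "\<dots> \<le> w 1 * real (h 1) / (real d + 3) / npts L * (1 / ?T)"
      proof (intro mult_left_mono)
        show "c powr (1 / d) / npts L powr (1 / d) \<le> 1 / ?T" 
        using T N by (subst divide_le_eq) (auto simp: mult.commute le_divide_eq)
      qed (use w[of 1] in auto)
      also have "\<dots> = w 1 * (real (h 1) * real 1 * npts L / ((real d + 3) * ?T)) / (npts L)\<^sup>2"
        using N by (simp add: power2_eq_square)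
      finally show ?thesis .
    qed
    also have "\<dots> \<le> w 1 * leakage 1 L / (npts L)\<^sup>2"
      using w[of 1] by (intro divide_right_mono mult_left_mono leakage_ge d) auto
    finally have "ennreal (D * npts L powr (- (real d + 1) / real d)) \<le> ennreal (\<Sum>l=1..1. w l * leakage l L / (npts L)\<^sup>2)"
      by (intro ennreal_leI) simp
    also have "\<dots> \<le> mean_square_wce Y w s M X" by (rule mean_square_wce_lower[OF H w])
    finally show ?thesis .
  qed
  moreover have "D > 0" using w[of 1] cC h1_pos by (simp add: D_def)
  ultimately show ?thesis by blast
qed

end

section \<open>Average QMC strength of the harmonic ensemble\<close>

theorem theorem1:
  fixes d :: nat
    and Y :: "nat \<Rightarrow> nat \<Rightarrow> 'a::euclidean_space \<Rightarrow> real"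
    and a :: "real \<Rightarrow> nat \<Rightarrow> real"
    and N :: "nat \<Rightarrow> nat"
    and M :: "nat \<Rightarrow> 'w measure"
    and X :: "nat \<Rightarrow> 'w \<Rightarrow> 'a set"
  assumes "d \<ge> 1" and "DIM('a) = d + 1"
    and "\<And>l. orthonormal_basis (spherical_harmonics l) (Y l)"
    and "\<And>s. s \<ge> 0 \<Longrightarrow> sobolev_weight s (a s)"
    and "\<And>L. N L = dim (sphere_polynomials L :: ('a \<Rightarrow> real) set)"
    and "\<And>L. harmonic_ensemble L (M (N L)) (X (N L))"
  shows "(\<forall>s. real d / 2 < s \<and> s < (real d + 1) / 2 \<longrightarrow>
            qmc_designs_on_average Y a (range N) M X s) \<and>
         ((\<lambda>L. ennreal (real (N L) powr ((real d + 1) / real d)) *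
               mean_square_wce Y (a ((real d + 1) / 2)) ((real d + 1) / 2) (M (N L)) (X (N L)))
            \<longlonglongrightarrow> \<infinity>) \<and>
         (\<forall>s. s > (real d + 1) / 2 \<longrightarrow> \<not> qmc_designs_on_average Y a (range N) M X s) \<and>
         is_average_qmc_strength Y a (range N) M X ((real d + 1) / 2)"
proof -
  let ?mse = "\<lambda>s L. mean_square_wce Y (a s) s (M (N L)) (X (N L))"
  interpret harmonic_basis Y using assms(1-3) by unfold_locales auto
  note d = assms(2,1)
  note H = assms(6)
  have N: "real (N L) = npts L" for L by (simp add: assms(5) dim_sphere_polynomials npts_def)
  have Npos: "real (N L) > 0" for L by (simp only: N npts_pos)
  have dim: "real DIM('a) - 1 = real d" by (simp add: d)
  have square: "(real (N L) powr (- s / real d))\<^sup>2 = real (N L) powr (- 2 * s / real d)" for L s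
    unfolding powr_square by simp
  have sub: "qmc_designs_on_average Y a (range N) M X s" if s: "real d / 2 < s" "s < (real d + 1) / 2" for s
  proof -
    have "sobolev_weight s (a s)" using s d by (intro assms(4)) simp
    then obtain D where D: "D > 0" "\<And>L. ?mse s L \<le> ennreal (D * real (N L) powr (- 2 * s / real d))"
      using mean_square_upper_rate[OF d s, where 'w='w] H unfolding N by blast
    have "?mse s L < \<infinity> \<and>
      sqrt (enn2real (?mse s L)) \<le> sqrt D * real (N L) powr (- s / (real DIM('a) - 1))" for L
    proof
      show "?mse s L < \<infinity>"
        using D(2)[of L] by (rule le_less_trans) simp
      have "enn2real (?mse s L) \<le> D * real (N L) powr (- 2 * s / real d)"
        using enn2real_mono[OF D(2)[of L]] D(1) by simp
      also have "\<dots> = (sqrt D * real (N L) powr (- s / real d))\<^sup>2"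
        by (simp only: power_mult_distrib square real_sqrt_pow2[OF less_imp_le[OF D(1)]])
      finally show "sqrt (enn2real (?mse s L)) \<le> sqrt D * real (N L) powr (- s / (real DIM('a) - 1))"
        unfolding dim using D(1) by (intro real_le_lsqrt) auto
    qed
    then show ?thesis unfolding qmc_designs_on_average_def using D(1) by (intro exI[of _ "sqrt D"]) auto
  qed
  have crit: "(\<lambda>L. ennreal (real (N L) powr ((real d + 1) / real d)) *
      ?mse ((real d + 1) / 2) L) \<longlonglongrightarrow> \<infinity>"
  proof -
    have "sobolev_weight ((real d + 1) / 2) (a ((real d + 1) / 2))" by (intro assms(4)) simp
    then obtain D where D: "D > 0" "\<And>L. ennreal (D * (\<Sum>l=1..L. 1 / real (Suc l)))
      \<le> ennreal (real (N L) powr ((real d + 1) / real d)) * ?mse ((real d + 1) / 2) L"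
      using mean_square_lower_critical[OF d, where 'w='w] H unfolding N by blast
    have "filterlim (\<lambda>L. \<Sum>l=1..L. 1 / real (Suc l)) at_top sequentially"
    proof -
      \<comment> \<open>The sum starts with \<open>1 / 2\<close>.\<close>
      have "(\<Sum>l=1..L. 1 / real (Suc l)) = - 1 + harm (Suc L)" for L
        by (induction L) (auto simp: harm_def inverse_eq_divide)
      moreover have "filterlim (\<lambda>L. harm (Suc L) :: real) at_top sequentially"
        using harm_at_top by (subst filterlim_sequentially_Suc)
      then have "filterlim (\<lambda>L. - 1 + harm (Suc L) :: real) at_top sequentially"
        by (rule filterlim_tendsto_add_at_top[OF tendsto_const])
      ultimately show ?thesis by simp
    qed
    then have "filterlim (\<lambda>L. D * (\<Sum>l=1..L. 1 / real (Suc l))) at_top sequentially"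
      by (rule filterlim_tendsto_pos_mult_at_top[OF tendsto_const D(1)])
    then have lim: "(\<lambda>L. ennreal (D * (\<Sum>l=1..L. 1 / real (Suc l)))) \<longlonglongrightarrow> \<infinity>"
      by (simp add: ennreal_tendsto_top_eq_at_top)
    show ?thesis
    proof (rule tendsto_sandwich[OF _ _ lim tendsto_const])
      show "\<forall>\<^sub>F L in sequentially. ennreal (D * (\<Sum>l=1..L. 1 / real (Suc l)))
        \<le> ennreal (real (N L) powr ((real d + 1) / real d)) * ?mse ((real d + 1) / 2) L"
        by (intro always_eventually allI D(2))
    qed simp
  qed
  have super: "\<not> qmc_designs_on_average Y a (range N) M X s" if s: "s > (real d + 1) / 2" for s
  proof
    assume "qmc_designs_on_average Y a (range N) M X s"
    then obtain C where C: "C > 0" "\<And>L. ?mse s L < \<infinity>"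
      "\<And>L. sqrt (enn2real (?mse s L)) \<le> C * real (N L) powr (- s / real d)"
      unfolding qmc_designs_on_average_def dim by blast
    have "sobolev_weight s (a s)" using s by (intro assms(4)) simp
    then have pos: "\<And>l. a s l > 0" by (simp add: sobolev_weight_def)
    obtain D where "D > 0" and all: "\<forall>L (M :: 'w measure) X. harmonic_ensemble L M X \<longrightarrow>
      ennreal (D * npts L powr (- (real d + 1) / real d)) \<le> mean_square_wce Y (a s) s M X"
      using mean_square_lower_supercritical[OF d, where 'w='w and w="a s" and s=s, OF pos] by blast
    then have D: "D > 0" "\<And>L. ennreal (D * real (N L) powr (- (real d + 1) / real d)) \<le> ?mse s L"
      using all[rule_format, OF H] by (simp_all only: N)
    \<comment> \<open>The power of the number of points by which the lower bound exceeds the rate in question.\<close>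
    define \<eta> where "\<eta> = (2 * s - (real d + 1)) / real d"
    have \<eta>: "\<eta> > 0" using s d by (simp add: \<eta>_def field_simps)
    have bound: "D * real (N L) powr \<eta> \<le> C\<^sup>2" for L
    proof -
      have "enn2real (?mse s L) = (sqrt (enn2real (?mse s L)))\<^sup>2" by simp
      also have "\<dots> \<le> (C * real (N L) powr (- s / real d))\<^sup>2" by (intro power_mono C) simp
      also have "\<dots> = C\<^sup>2 * real (N L) powr (- 2 * s / real d)" by (simp only: power_mult_distrib square)
      finally have "enn2real (?mse s L) \<le> C\<^sup>2 * real (N L) powr (- 2 * s / real d)" .
      moreover have "D * real (N L) powr (- (real d + 1) / real d) \<le> enn2real (?mse s L)"
        using enn2real_mono[OF D(2)[of L]] C(2)[of L] D(1) by simp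
      ultimately have "D * real (N L) powr (- (real d + 1) / real d) \<le> C\<^sup>2 * real (N L) powr (- 2 * s / real d)" by linarith
      from mult_right_mono[OF this, of "real (N L) powr (2 * s / real d)"]
      have "D * (real (N L) powr (- (real d + 1) / real d) * real (N L) powr (2 * s / real d)) \<le> C\<^sup>2 * (real (N L) powr (- 2 * s / real d) * real (N L) powr (2 * s / real d))"
        by (simp only: mult.assoc powr_ge_zero)
      moreover have "- (real d + 1) / real d + 2 * s / real d = \<eta>" "- 2 * s / real d + 2 * s / real d = 0"
        unfolding \<eta>_def by (simp_all only: add_divide_distrib[symmetric]) simp_all
      ultimately have "D * real (N L) powr \<eta> \<le> C\<^sup>2 * real (N L) powr 0"
        by (simp only: powr_add[symmetric])
      then show ?thesis using Npos[of L] by simp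
    qed
    have "filterlim (\<lambda>L. real (N L)) at_top sequentially"
    proof -
      obtain c C where c: "c > 0" "C > 0" "\<And>L. c * real (Suc L) powr d \<le> npts L" "\<And>L. npts L \<le> C * real (Suc L) powr d"
        "\<And>m. c * real (Suc m) powr (real d - 1) \<le> real (h m)" "\<And>m. real (h m) \<le> C * real (Suc m) powr (real d - 1)"
        using card_I_bounds[OF d] by metis
      have ge: "c * real L \<le> real (N L)" for L
      proof -
        have "real (Suc L) powr 1 \<le> real (Suc L) powr real d" using d by (intro powr_mono) auto
        then have "c * real L \<le> c * real (Suc L) powr real d" using c(1) by (intro mult_left_mono) auto
        with c(3)[of L] show ?thesis by (simp add: N)
      qed
      have "filterlim (\<lambda>L. c * real L) at_top sequentially"
        by (rule filterlim_tendsto_pos_mult_at_top[OF tendsto_const c(1) filterlim_real_sequentially])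
      then show ?thesis by (rule filterlim_at_top_mono) (intro always_eventually allI ge)
    qed
    then have "\<forall>\<^sub>F L in sequentially. (C\<^sup>2 / D) powr (1 / \<eta>) < real (N L)" by (simp add: filterlim_at_top_dense)
    then obtain L where "(C\<^sup>2 / D) powr (1 / \<eta>) < real (N L)"
      by (rule eventually_happens'[OF sequentially_bot, THEN exE])
    then have "((C\<^sup>2 / D) powr (1 / \<eta>)) powr \<eta> < real (N L) powr \<eta>"
      using \<eta> by (intro powr_less_mono2) auto
    then have L: "C\<^sup>2 / D < real (N L) powr \<eta>" using \<eta> C(1) D(1) by (simp add: powr_powr)
    from bound[of L] have "real (N L) powr \<eta> \<le> C\<^sup>2 / D" using D(1) by (simp add: le_divide_eq mult.commute)
    with L show False by linarith
  qed
  have "is_average_qmc_strength Y a (range N) M X ((real d + 1) / 2)"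
    unfolding is_average_qmc_strength_def Let_def dim
  proof (intro conjI ballI)
    show "(real d + 1) / 2 \<in> {t. real d / 2 < t \<and> (\<forall>s. real d / 2 < s \<and> s < t \<longrightarrow> qmc_designs_on_average Y a (range N) M X s)}"
      using sub by simp
    fix t assume t: "t \<in> {t. real d / 2 < t \<and> (\<forall>s. real d / 2 < s \<and> s < t \<longrightarrow> qmc_designs_on_average Y a (range N) M X s)}"
    show "t \<le> (real d + 1) / 2"
    proof (rule ccontr)
      assume "\<not> t \<le> (real d + 1) / 2"
      then obtain s where s: "(real d + 1) / 2 < s" "s < t" using dense[of "(real d + 1) / 2" t] by auto
      then have "real d / 2 < s" by simp
      with t s have "qmc_designs_on_average Y a (range N) M X s" by simp
      with super[OF s(1)] show False by simp
    qed
  qed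
  with sub crit super show ?thesis by blast
qed

end
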